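(* Let $k$ be a field, $A$ a finitely generated $k$-algebra, $n\in\mathbb{N}$, and let $\mathcal{X}$ be a full additive subcategory of $\operatorname{Mod} A$. (1) If $\mathcal{X}$ is a definable subcategory, then $\operatorname{Mod}(\mathcal{X},n)$ is closed in the constructible topology of $\operatorname{Mod}(A,n)$. (2) If $\mathcal{X}$ is a constructible subcategory, then $\operatorname{Mod}(\mathcal{X},n)$ is a constructible set in $\operatorname{Mod}(A,n)$.
   Context: Algebras are associative with identity, modules are left modules. A functor $F\colon\operatorname{Mod}A\to\mathrm{Ab}$ is finitely presented if there is an exact sequence $\operatorname{Hom}_A(Y,-)\to\operatorname{Hom}_A(X,-)\to F\to0$ with $X,Y$ finitely presented $A$-modules. A full subcategory of $\operatorname{Mod}A$ is definable if it equals $\{X\mid F(X)=0\text{ for all }F\in S\}$ for a set $S$ of finitely presented functors, and constructible if $S$ can be chosen to consist of a single functor. Scheme of modules: write $A\cong k\langle x_1,\dots,x_r\rangle/I$. Let $k[t]$ be the polynomial ring in $rn^2$ variables and $M_1,\dots,M_r$ the $n\times n$ matrices over $k[t]$ whose entries are the distinct variables. Let $J\subseteq k[t]$ be the smallest ideal such that $q(M_1,\dots,M_r)=0$ over $k[t]/J$ for all $q\in I$, and $C=k[t]/J$. Then $\operatorname{Mod}(A,n)=\operatorname{Spec}(C)$. The matrices $M_1,\dots,M_r$ over $C$ define an $A$-$C$-bimodule $M$ which is free over $C$ of rank $n$. For a full additive subcategory $\mathcal{X}\subseteq\operatorname{Mod}A$ let $\operatorname{Mod}(\mathcal{X},n)$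 be the set of all $p\in\operatorname{Mod}(A,n)$ with $M\otimes_C\operatorname{Frac}(C/p)\in\mathcal{X}$. The constructible topology on $\operatorname{Mod}(A,n)$ is the coarsest topology in which every $D_a=\{p\mid a\notin p\}$, $a\in C$, is both open and closed. A set is constructible if it is a finite combination of unions and intersections of sets $D_a$ and $\operatorname{Mod}(A,n)\setminus D_a$, $a\in C$. *)

theory Defs
  imports
    "HOL-Analysis.Abstract_Topology"
    "Jordan_Normal_Form.Matrix"
    "HOL-Algebra.Free_Abelian_Groups"
    "HOL-Algebra.Algebraic_Closure_Type"
    "HOL-Algebra.Module"
begin

section \<open>Left modules over a not necessarily commutative ring\<close>

text \<open>
  The library locale \<^locale>\<open>module\<close> requires a commutative ring of scalars.  Its record type is
  reused here; the fields \<^const>\<open>mult\<close> and \<^const>\<open>one\<close> of the module carry no information.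
\<close>

locale left_module = R?: ring R + M?: abelian_group M
  for R :: "('a, 'r) ring_scheme" and M :: "('a, 'm, 's) module_scheme" (structure) +
  assumes smult_closed:
      "\<lbrakk>a \<in> carrier R; x \<in> carrier M\<rbrakk> \<Longrightarrow> a \<odot>\<^bsub>M\<^esub> x \<in> carrier M"
    and smult_l_distr:
      "\<lbrakk>a \<in> carrier R; b \<in> carrier R; x \<in> carrier M\<rbrakk> \<Longrightarrow>
        (a \<oplus>\<^bsub>R\<^esub> b) \<odot>\<^bsub>M\<^esub> x = a \<odot>\<^bsub>M\<^esub> x \<oplus>\<^bsub>M\<^esub> b \<odot>\<^bsub>M\<^esub> x"
    and smult_r_distr:
      "\<lbrakk>a \<in> carrier R; x \<in> carrier M; y \<in> carrier M\<rbrakk> \<Longrightarrow>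
        a \<odot>\<^bsub>M\<^esub> (x \<oplus>\<^bsub>M\<^esub> y) = a \<odot>\<^bsub>M\<^esub> x \<oplus>\<^bsub>M\<^esub> a \<odot>\<^bsub>M\<^esub> y"
    and smult_assoc:
      "\<lbrakk>a \<in> carrier R; b \<in> carrier R; x \<in> carrier M\<rbrakk> \<Longrightarrow>
        (a \<otimes>\<^bsub>R\<^esub> b) \<odot>\<^bsub>M\<^esub> x = a \<odot>\<^bsub>M\<^esub> (b \<odot>\<^bsub>M\<^esub> x)"
    and smult_one:
      "x \<in> carrier M \<Longrightarrow> \<one>\<^bsub>R\<^esub> \<odot>\<^bsub>M\<^esub> x = x"

definition lin_maps ::
  "('a, 'r) ring_scheme \<Rightarrow> ('a, 'u) module \<Rightarrow> ('a, 'v) module \<Rightarrow> ('u \<Rightarrow> 'v) set" where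
  "lin_maps R V W = {f \<in> carrier V \<rightarrow>\<^sub>E carrier W.
     (\<forall>x\<in>carrier V. \<forall>y\<in>carrier V. f (x \<oplus>\<^bsub>V\<^esub> y) = f x \<oplus>\<^bsub>W\<^esub> f y) \<and>
     (\<forall>a\<in>carrier R. \<forall>x\<in>carrier V. f (a \<odot>\<^bsub>V\<^esub> x) = a \<odot>\<^bsub>W\<^esub> f x)}"

definition lin_iso :: "('a, 'r) ring_scheme \<Rightarrow> ('a, 'u) module \<Rightarrow> ('a, 'v) module \<Rightarrow> bool" where
  "lin_iso R V W \<longleftrightarrow> (\<exists>f\<in>lin_maps R V W. bij_betw f (carrier V) (carrier W))"

definition Hom_group ::
  "('a, 'r) ring_scheme \<Rightarrow> ('a, 'u) module \<Rightarrow> ('a, 'v) module \<Rightarrow> ('u \<Rightarrow> 'v) monoid" where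
  "Hom_group R V W = \<lparr>
     carrier = lin_maps R V W,
     mult = (\<lambda>f g. \<lambda>x\<in>carrier V. f x \<oplus>\<^bsub>W\<^esub> g x),
     one = (\<lambda>x\<in>carrier V. \<zero>\<^bsub>W\<^esub>)\<rparr>"

definition free_module :: "('a, 'r) ring_scheme \<Rightarrow> nat \<Rightarrow> ('a, nat \<Rightarrow> 'a) module" where
  "free_module R m = \<lparr>
     carrier = {..<m} \<rightarrow>\<^sub>E carrier R,
     mult = undefined,
     one = undefined,
     ring.zero = (\<lambda>i\<in>{..<m}. \<zero>\<^bsub>R\<^esub>),
     add = (\<lambda>u v. \<lambda>i\<in>{..<m}. u i \<oplus>\<^bsub>R\<^esub> v i),
     module.smult = (\<lambda>a u. \<lambda>i\<in>{..<m}. a \<otimes>\<^bsub>R\<^esub> u i)\<rparr>"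

definition direct_sum :: "('a, 'u) module \<Rightarrow> ('a, 'v) module \<Rightarrow> ('a, 'u \<times> 'v) module" where
  "direct_sum V W = \<lparr>
     carrier = carrier V \<times> carrier W,
     mult = undefined,
     one = undefined,
     ring.zero = (\<zero>\<^bsub>V\<^esub>, \<zero>\<^bsub>W\<^esub>),
     add = (\<lambda>(x, y) (x', y'). (x \<oplus>\<^bsub>V\<^esub> x', y \<oplus>\<^bsub>W\<^esub> y')),
     module.smult = (\<lambda>a (x, y). (a \<odot>\<^bsub>V\<^esub> x, a \<odot>\<^bsub>W\<^esub> y))\<rparr>"

definition fin_pres_module :: "('a, 'r) ring_scheme \<Rightarrow> ('a, 'm) module \<Rightarrow> bool" where
  "fin_pres_module R V \<longleftrightarrow> left_module R V \<and>
     (\<exists>l m. \<exists>f\<in>lin_maps R (free_module R m) (free_module R l). \<exists>g\<in>lin_maps R (free_module R l) V.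
        g ` carrier (free_module R l) = carrier V \<and>
        {v \<in> carrier (free_module R l). g v = \<zero>\<^bsub>V\<^esub>} = f ` carrier (free_module R m))"


section \<open>Functors from modules to abelian groups\<close>

text \<open>
  The objects of the category of left \<open>A\<close>-modules are the left \<open>A\<close>-modules whose carrier is a subset
  of a fixed type \<open>'m\<close>, which plays the role of the universe; the morphisms are the elements
  of \<^const>\<open>lin_maps\<close>.  If \<open>A\<close> is finitely generated over a field \<open>k\<close>, every finitely presented
  \<open>A\<close>-module and every module \<open>M \<otimes>\<^sub>C Frac (C/p)\<close> considered below has at
  most \<open>max(|k|, \<aleph>\<^sub>0)\<close> elements, so it has a copy in \<open>'m\<close> as soon as \<open>'m\<close> is infinite and \<open>k\<close> embeds
  in \<open>'m\<close>.  Under the same assumption any two objects have a direct sum in \<open>'m\<close>.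
\<close>

record ('a, 'm, 'g) ab_functor =
  on_obj :: "('a, 'm) module \<Rightarrow> 'g monoid"
  on_arr :: "('a, 'm) module \<Rightarrow> ('a, 'm) module \<Rightarrow> ('m \<Rightarrow> 'm) \<Rightarrow> 'g \<Rightarrow> 'g"

definition is_ab_functor :: "('a, 'r) ring_scheme \<Rightarrow> ('a, 'm, 'g) ab_functor \<Rightarrow> bool" where
  "is_ab_functor A F \<longleftrightarrow>
     (\<forall>V. left_module A V \<longrightarrow> comm_group (on_obj F V)) \<and>
     (\<forall>V W. left_module A V \<longrightarrow> left_module A W \<longrightarrow>
        (\<forall>f\<in>lin_maps A V W. on_arr F V W f \<in> hom (on_obj F V) (on_obj F W))) \<and>
     (\<forall>V. left_module A V \<longrightarrow>
        (\<forall>u\<in>carrier (on_obj F V). on_arr F V V (\<lambda>x\<in>carrier V. x) u = u)) \<and>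
     (\<forall>V W Z. left_module A V \<longrightarrow> left_module A W \<longrightarrow> left_module A Z \<longrightarrow>
        (\<forall>f\<in>lin_maps A V W. \<forall>g\<in>lin_maps A W Z. \<forall>u\<in>carrier (on_obj F V).
           on_arr F V Z (compose (carrier V) g f) u = on_arr F W Z g (on_arr F V W f u)))"

definition nat_trans ::
  "('a, 'r) ring_scheme \<Rightarrow> ('a, 'm, 'g) ab_functor \<Rightarrow> ('a, 'm, 'h) ab_functor \<Rightarrow>
   (('a, 'm) module \<Rightarrow> 'g \<Rightarrow> 'h) \<Rightarrow> bool" where
  "nat_trans A F G \<alpha> \<longleftrightarrow>
     (\<forall>V. left_module A V \<longrightarrow> \<alpha> V \<in> hom (on_obj F V) (on_obj G V)) \<and>
     (\<forall>V W. left_module A V \<longrightarrow> left_module A W \<longrightarrow>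
        (\<forall>f\<in>lin_maps A V W. \<forall>u\<in>carrier (on_obj F V).
           \<alpha> W (on_arr F V W f u) = on_arr G V W f (\<alpha> V u)))"

definition Hom_functor ::
  "('a, 'r) ring_scheme \<Rightarrow> ('a, 'm) module \<Rightarrow> ('a, 'm, 'm \<Rightarrow> 'm) ab_functor" where
  "Hom_functor A V = \<lparr>
     on_obj = Hom_group A V,
     on_arr = (\<lambda>W Z g f. compose (carrier V) g f)\<rparr>"

text \<open>Exactness of a sequence of functors is exactness at every module.\<close>

definition fin_pres_functor :: "('a, 'r) ring_scheme \<Rightarrow> ('a, 'm, 'g) ab_functor \<Rightarrow> bool" where
  "fin_pres_functor A F \<longleftrightarrow> is_ab_functor A F \<and>
     (\<exists>V W \<alpha> \<beta>. fin_pres_module A V \<and> fin_pres_module A W \<and>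
        nat_trans A (Hom_functor A W) (Hom_functor A V) \<alpha> \<and>
        nat_trans A (Hom_functor A V) F \<beta> \<and>
        (\<forall>Z. left_module A Z \<longrightarrow>
           kernel (Hom_group A V Z) (on_obj F Z) (\<beta> Z) = \<alpha> Z ` carrier (Hom_group A W Z) \<and>
           \<beta> Z ` carrier (Hom_group A V Z) = carrier (on_obj F Z)))"


section \<open>Subcategories\<close>

text \<open>
  Full subcategories are given by their class of objects.  The closure condition includes closure
  under isomorphism.
\<close>

definition full_additive_subcategory ::
  "('a, 'r) ring_scheme \<Rightarrow> ('a, 'm) module set \<Rightarrow> bool" where
  "full_additive_subcategory A \<X> \<longleftrightarrow>
     (\<forall>V\<in>\<X>. left_module A V) \<and>
     (\<forall>V\<in>\<X>. \<forall>Z. left_module A Z \<longrightarrow> lin_iso A V Z \<longrightarrow> Z \<in> \<X>) \<and>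
     (\<forall>Z. left_module A Z \<longrightarrow> carrier Z = {\<zero>\<^bsub>Z\<^esub>} \<longrightarrow> Z \<in> \<X>) \<and>
     (\<forall>V\<in>\<X>. \<forall>W\<in>\<X>. \<forall>Z. left_module A Z \<longrightarrow> lin_iso A (direct_sum V W) Z \<longrightarrow> Z \<in> \<X>)"

text \<open>The argument of type \<^typ>\<open>'g itself\<close> names the type in which the functors take values.\<close>

definition definable_subcategory ::
  "'g itself \<Rightarrow> ('a, 'r) ring_scheme \<Rightarrow> ('a, 'm) module set \<Rightarrow> bool" where
  "definable_subcategory ty A \<X> \<longleftrightarrow>
     (\<exists>S :: ('a, 'm, 'g) ab_functor set. (\<forall>F\<in>S. fin_pres_functor A F) \<and>
        \<X> = {V. left_module A V \<and> (\<forall>F\<in>S. trivial_group (on_obj F V))})"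

definition constructible_subcategory ::
  "'g itself \<Rightarrow> ('a, 'r) ring_scheme \<Rightarrow> ('a, 'm) module set \<Rightarrow> bool" where
  "constructible_subcategory ty A \<X> \<longleftrightarrow>
     (\<exists>F :: ('a, 'm, 'g) ab_functor. fin_pres_functor A F \<and>
        \<X> = {V. left_module A V \<and> trivial_group (on_obj F V)})"


section \<open>Finitely generated algebras\<close>

text \<open>
  A noncommutative polynomial is a finitely supported family of coefficients indexed by words, the
  letter \<open>l\<close> standing for the \<open>l\<close>-th variable.  The scalars of an algebra are given by
  a ring homomorphism from the field to the centre.
\<close>

definition free_algebra :: "nat \<Rightarrow> (nat list \<Rightarrow>\<^sub>0 'k::zero) set" where
  "free_algebra r = {q. \<forall>w\<in>Poly_Mapping.keys q. set w \<subseteq> {..<r}}"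

definition nc_eval ::
  "('b, 's) ring_scheme \<Rightarrow> ('k::zero \<Rightarrow> 'b) \<Rightarrow> (nat \<Rightarrow> 'b) \<Rightarrow> (nat list \<Rightarrow>\<^sub>0 'k) \<Rightarrow> 'b" where
  "nc_eval R \<sigma> y q =
     (\<Oplus>\<^bsub>R\<^esub>w\<in>Poly_Mapping.keys q.
        \<sigma> (Poly_Mapping.lookup q w) \<otimes>\<^bsub>R\<^esub> foldr (\<lambda>l z. y l \<otimes>\<^bsub>R\<^esub> z) w \<one>\<^bsub>R\<^esub>)"

text \<open>
  An algebra with a choice of finitely many generators, that is, with a surjection from a free
  algebra.
\<close>

locale fin_gen_algebra = ring A
  for A :: "('a, 's) ring_scheme" and \<eta> :: "'k::field \<Rightarrow> 'a" and r :: nat and x :: "nat \<Rightarrow> 'a" +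
  assumes scalar_hom: "\<eta> \<in> ring_hom (ring_of_type_algebra :: 'k ring) A"
    and scalar_central: "a \<in> carrier A \<Longrightarrow> \<eta> c \<otimes>\<^bsub>A\<^esub> a = a \<otimes>\<^bsub>A\<^esub> \<eta> c"
    and gens_closed: "l < r \<Longrightarrow> x l \<in> carrier A"
    and gens_generate: "nc_eval A \<eta> x ` free_algebra r = carrier A"

definition relation_ideal ::
  "('a, 's) ring_scheme \<Rightarrow> ('k::zero \<Rightarrow> 'a) \<Rightarrow> nat \<Rightarrow> (nat \<Rightarrow> 'a) \<Rightarrow> (nat list \<Rightarrow>\<^sub>0 'k) set" where
  "relation_ideal A \<eta> r x = {q \<in> free_algebra r. nc_eval A \<eta> x q = \<zero>\<^bsub>A\<^esub>}"


section \<open>The scheme of modules\<close>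

text \<open>
  The variable \<open>(l, i, j)\<close> is the entry in row \<open>i\<close> and column \<open>j\<close> of
  the \<open>l\<close>-th generic matrix, rows, columns and matrices being numbered from \<open>0\<close>.
\<close>

type_synonym 'k entry_poly = "((nat \<times> nat \<times> nat) \<Rightarrow>\<^sub>0 nat) \<Rightarrow>\<^sub>0 'k"

definition entry_ring :: "nat \<Rightarrow> nat \<Rightarrow> ('k::field entry_poly) ring" where
  "entry_ring r n = ring_of_type_algebra
     \<lparr>carrier := {f. \<forall>m\<in>Poly_Mapping.keys f.
                      Poly_Mapping.keys m \<subseteq> {..<r} \<times> {..<n} \<times> {..<n}}\<rparr>"

definition generic_mat :: "nat \<Rightarrow> nat \<Rightarrow> ('k::field entry_poly) mat" where
  "generic_mat n l = mat n n (\<lambda>(i, j). Poly_Mapping.single (Poly_Mapping.single (l, i, j) 1) 1)"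

definition generic_eval :: "nat \<Rightarrow> (nat list \<Rightarrow>\<^sub>0 'k) \<Rightarrow> ('k::field entry_poly) mat" where
  "generic_eval n q =
     nc_eval (ring_mat TYPE('k entry_poly) n ())
       (\<lambda>c. Poly_Mapping.single 0 c \<cdot>\<^sub>m 1\<^sub>m n) (generic_mat n) q"

text \<open>
  The smallest ideal modulo which all entries of \<open>q(M\<^sub>1, \<dots>, M\<^sub>r)\<close> vanish, for all relations \<open>q\<close>.
\<close>

definition scheme_ideal ::
  "('a, 's) ring_scheme \<Rightarrow> ('k::field \<Rightarrow> 'a) \<Rightarrow> nat \<Rightarrow> (nat \<Rightarrow> 'a) \<Rightarrow> nat \<Rightarrow> ('k entry_poly) set" where
  "scheme_ideal A \<eta> r x n = \<Inter> {J. ideal J (entry_ring r n) \<and>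
     (\<forall>q\<in>relation_ideal A \<eta> r x. \<forall>i<n. \<forall>j<n.
        J +>\<^bsub>entry_ring r n\<^esub> (generic_eval n q $$ (i, j)) = \<zero>\<^bsub>entry_ring r n Quot J\<^esub>)}"

definition coord_ring ::
  "('a, 's) ring_scheme \<Rightarrow> ('k::field \<Rightarrow> 'a) \<Rightarrow> nat \<Rightarrow> (nat \<Rightarrow> 'a) \<Rightarrow> nat \<Rightarrow>
   ('k entry_poly set) ring" where
  "coord_ring A \<eta> r x n = entry_ring r n Quot scheme_ideal A \<eta> r x n"

definition Spec :: "('c, 's) ring_scheme \<Rightarrow> 'c set set" where
  "Spec C = {p. primeideal p C}"

record ('a, 'c, 'u) bimodule = "('a, 'u) module" +
  rsmult :: "'u \<Rightarrow> 'c \<Rightarrow> 'u"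

text \<open>
  The bimodule of column vectors over the coordinate ring.  An element of the algebra acts
  by \<open>q(M\<^sub>1, \<dots>, M\<^sub>r)\<close> for any noncommutative polynomial \<open>q\<close> representing it; the choice
  of \<open>q\<close> does not matter because \<^const>\<open>relation_ideal\<close> acts as zero.
\<close>

definition universal_bimodule ::
  "('a, 's) ring_scheme \<Rightarrow> ('k::field \<Rightarrow> 'a) \<Rightarrow> nat \<Rightarrow> (nat \<Rightarrow> 'a) \<Rightarrow> nat \<Rightarrow>
   ('a, 'k entry_poly set, nat \<Rightarrow> 'k entry_poly set) bimodule" where
  "universal_bimodule A \<eta> r x n =
     (let P = entry_ring r n; J = scheme_ideal A \<eta> r x n; C = coord_ring A \<eta> r x n in
      \<lparr>carrier = {..<n} \<rightarrow>\<^sub>E carrier C,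
       mult = undefined,
       one = undefined,
       ring.zero = (\<lambda>i\<in>{..<n}. \<zero>\<^bsub>C\<^esub>),
       add = (\<lambda>u v. \<lambda>i\<in>{..<n}. u i \<oplus>\<^bsub>C\<^esub> v i),
       module.smult = (\<lambda>a v. let q = (SOME q. q \<in> free_algebra r \<and> nc_eval A \<eta> x q = a) in
          (\<lambda>i\<in>{..<n}. \<Oplus>\<^bsub>C\<^esub>j\<in>{..<n}. (J +>\<^bsub>P\<^esub> (generic_eval n q $$ (i, j))) \<otimes>\<^bsub>C\<^esub> v j)),
       rsmult = (\<lambda>v c. \<lambda>i\<in>{..<n}. v i \<otimes>\<^bsub>C\<^esub> c)\<rparr>)"


subsection \<open>Tensor products\<close>

definition tensor_relations ::
  "('c, 't) ring_scheme \<Rightarrow> ('a, 'c, 'u) bimodule \<Rightarrow> ('c, 'v) module \<Rightarrow> ('u \<times> 'v \<Rightarrow>\<^sub>0 int) set" where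
  "tensor_relations C M N =
     {frag_of (u \<oplus>\<^bsub>M\<^esub> u', v) - frag_of (u, v) - frag_of (u', v) | u u' v.
        u \<in> carrier M \<and> u' \<in> carrier M \<and> v \<in> carrier N} \<union>
     {frag_of (u, v \<oplus>\<^bsub>N\<^esub> v') - frag_of (u, v) - frag_of (u, v') | u v v'.
        u \<in> carrier M \<and> v \<in> carrier N \<and> v' \<in> carrier N} \<union>
     {frag_of (rsmult M u c, v) - frag_of (u, c \<odot>\<^bsub>N\<^esub> v) | u c v.
        u \<in> carrier M \<and> c \<in> carrier C \<and> v \<in> carrier N}"

text \<open>
  The tensor product \<open>M \<otimes>\<^sub>C N\<close> of an \<open>A\<close>-\<open>C\<close>-bimodule with a left \<open>C\<close>-module, as a left
  \<open>A\<close>-module: the free abelian group on pairs modulo the usual relations.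
\<close>

definition tensor_product ::
  "('c, 't) ring_scheme \<Rightarrow> ('a, 'c, 'u) bimodule \<Rightarrow> ('c, 'v) module \<Rightarrow>
   ('a, ('u \<times> 'v \<Rightarrow>\<^sub>0 int) set) module" where
  "tensor_product C M N =
     (let G = free_Abelian_group (carrier M \<times> carrier N);
          H = generate G (tensor_relations C M N) in
      \<lparr>carrier = carrier (G Mod H),
       mult = undefined,
       one = undefined,
       ring.zero = \<one>\<^bsub>G Mod H\<^esub>,
       add = (\<lambda>U V. U \<otimes>\<^bsub>G Mod H\<^esub> V),
       module.smult = (\<lambda>a U. \<Union>z\<in>U. H #>\<^bsub>G\<^esub> frag_extend (\<lambda>(u, v). frag_of (a \<odot>\<^bsub>M\<^esub> u, v)) z)\<rparr>)"


subsection \<open>Residue fields\<close>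

definition frac_rel :: "('d, 's) ring_scheme \<Rightarrow> (('d \<times> 'd) \<times> ('d \<times> 'd)) set" where
  "frac_rel D = {((a, b), (c, d)).
     a \<in> carrier D \<and> b \<in> carrier D - {\<zero>\<^bsub>D\<^esub>} \<and> c \<in> carrier D \<and> d \<in> carrier D - {\<zero>\<^bsub>D\<^esub>} \<and>
     a \<otimes>\<^bsub>D\<^esub> d = c \<otimes>\<^bsub>D\<^esub> b}"

definition Frac :: "('d, 's) ring_scheme \<Rightarrow> (('d \<times> 'd) set) ring" where
  "Frac D = \<lparr>
     carrier = (carrier D \<times> (carrier D - {\<zero>\<^bsub>D\<^esub>})) // frac_rel D,
     mult = (\<lambda>U V. \<Union>(a, b)\<in>U. \<Union>(c, d)\<in>V. frac_rel D `` {(a \<otimes>\<^bsub>D\<^esub> c, b \<otimes>\<^bsub>D\<^esub> d)}),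
     one = frac_rel D `` {(\<one>\<^bsub>D\<^esub>, \<one>\<^bsub>D\<^esub>)},
     ring.zero = frac_rel D `` {(\<zero>\<^bsub>D\<^esub>, \<one>\<^bsub>D\<^esub>)},
     add = (\<lambda>U V. \<Union>(a, b)\<in>U. \<Union>(c, d)\<in>V.
        frac_rel D `` {(a \<otimes>\<^bsub>D\<^esub> d \<oplus>\<^bsub>D\<^esub> c \<otimes>\<^bsub>D\<^esub> b, b \<otimes>\<^bsub>D\<^esub> d)})\<rparr>"

definition residue_module ::
  "('c, 's) ring_scheme \<Rightarrow> 'c set \<Rightarrow> ('c, ('c set \<times> 'c set) set) module" where
  "residue_module C p = (let D = C Quot p; K = Frac D in
     \<lparr>carrier = carrier K,
      mult = mult K,
      one = \<one>\<^bsub>K\<^esub>,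
      ring.zero = \<zero>\<^bsub>K\<^esub>,
      add = add K,
      module.smult = (\<lambda>c z. (frac_rel D `` {(p +>\<^bsub>C\<^esub> c, \<one>\<^bsub>D\<^esub>)}) \<otimes>\<^bsub>K\<^esub> z)\<rparr>)"


subsection \<open>The subset of the scheme defined by a subcategory\<close>

text \<open>
  Since the objects of \<open>\<X>\<close> live in the universe \<open>'m\<close>, membership of \<open>M \<otimes>\<^sub>C Frac (C/p)\<close> in the
  isomorphism-closed class \<open>\<X>\<close> means that it has an isomorphic copy in \<open>\<X>\<close>.
\<close>

definition Mod_subset ::
  "('a, 's) ring_scheme \<Rightarrow> ('k::field \<Rightarrow> 'a) \<Rightarrow> nat \<Rightarrow> (nat \<Rightarrow> 'a) \<Rightarrow> ('a, 'm) module set \<Rightarrow> nat \<Rightarrow>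
   ('k entry_poly set set) set" where
  "Mod_subset A \<eta> r x \<X> n = (let C = coord_ring A \<eta> r x n in
     {p \<in> Spec C. \<exists>N\<in>\<X>.
        lin_iso A (tensor_product C (universal_bimodule A \<eta> r x n) (residue_module C p)) N})"


section \<open>The constructible topology\<close>

definition basic_open :: "('c, 's) ring_scheme \<Rightarrow> 'c \<Rightarrow> 'c set set" where
  "basic_open C a = {p \<in> Spec C. a \<notin> p}"

definition constructible_topology :: "('c, 's) ring_scheme \<Rightarrow> 'c set topology" where
  "constructible_topology C = topology_generated_by
     (basic_open C ` carrier C \<union> (\<lambda>a. Spec C - basic_open C a) ` carrier C)"

inductive_set constructible_sets :: "('c, 's) ring_scheme \<Rightarrow> 'c set set set"
  for C :: "('c, 's) ring_scheme" where
  basic: "a \<in> carrier C \<Longrightarrow> basic_open C a \<in> constructible_sets C"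
| basic_compl: "a \<in> carrier C \<Longrightarrow> Spec C - basic_open C a \<in> constructible_sets C"
| union: "\<lbrakk>U \<in> constructible_sets C; V \<in> constructible_sets C\<rbrakk> \<Longrightarrow> U \<union> V \<in> constructible_sets C"
| inter: "\<lbrakk>U \<in> constructible_sets C; V \<in> constructible_sets C\<rbrakk> \<Longrightarrow> U \<inter> V \<in> constructible_sets C"

end

theory Submission
  imports Defs
begin

text \<open>
  Write \<open>\<kappa>(p)\<close> for the field \<open>Frac(C/p)\<close>.  The theorem holds because vanishing of a finitely
  presented functor on \<open>M \<otimes> \<kappa>(p)\<close> is a statement about linear systems over \<open>\<kappa>(p)\<close>
  with coefficients in \<open>C\<close>, and the truth of such a statement depends on \<open>p\<close> only through the
  vanishing at \<open>p\<close> of finitely many elements of \<open>C\<close>.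

  Let \<open>Hom(W, -) \<rightarrow> Hom(V, -) \<rightarrow> F \<rightarrow> 0\<close> be exact with \<open>V\<close> and \<open>W\<close> finitely presented.  By Yoneda the
  first map is composition with some \<open>f : V \<rightarrow> W\<close>, so \<open>F(Z) = 0\<close> iff every homomorphism \<open>V \<rightarrow> Z\<close> factors
  through \<open>f\<close>.  Presentations of \<open>V\<close> and \<open>W\<close> identify homomorphisms to \<open>Z\<close> with solutions in \<open>Z\<close>
  of finite homogeneous linear systems over \<open>A\<close>.  Hence \<open>F(Z) = 0\<close> becomes: every solution of a
  first system is the image, under a fixed matrix over \<open>A\<close>, of a solution of a second one
  (\<open>fin_pres_functor_vanishing\<close>).

  The bimodule \<open>M\<close> is \<open>C\<^sup>n\<close> with \<open>A\<close> acting by matrices over \<open>C\<close> (\<open>matrix_representation_action\<close>),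
  so \<open>M \<otimes> \<kappa>(p)\<close> is \<open>\<kappa>(p)\<^sup>n\<close> with the action by the images of these matrices (\<open>tensor_product_iso\<close>).
  For \<open>Z = \<kappa>(p)\<^sup>n\<close> the condition therefore concerns linear systems over \<open>\<kappa>(p)\<close> whose coefficients are
  images of elements of \<open>C\<close> that do not depend on \<open>p\<close>.  Gaussian elimination decides it: at every step the
  only question is which coefficients vanish at \<open>p\<close>, and the elimination is carried out without division,
  so that all new coefficients are again elements of \<open>C\<close>.  Thus the set of all \<open>p\<close> that satisfy the
  condition is a Boolean combination of sets \<open>D\<^sub>a\<close> (\<open>constructible_solvability\<close>).

  A definable subcategory imposes such a condition for each functor of a set, which cuts out
  an intersection of clopen sets; a constructible one imposes a single condition.  It remains to
  know that \<open>M \<otimes> \<kappa>(p)\<close> has a copy in the universe, which is a count of elements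
  (\<open>residue_vectors_embed\<close>).
\<close>


section \<open>Constructible sets and elimination of variables\<close>

lemma constructible_subset: "U \<in> constructible_sets C \<Longrightarrow> U \<subseteq> Spec C"
  by (induction rule: constructible_sets.induct) (auto simp: basic_open_def)

lemma constructible_compl: "U \<in> constructible_sets C \<Longrightarrow> Spec C - U \<in> constructible_sets C"
proof (induction rule: constructible_sets.induct)
  case (basic_compl a)
  have "Spec C - (Spec C - basic_open C a) = basic_open C a"
    by (auto simp: basic_open_def)
  with basic_compl show ?case by (simp add: constructible_sets.basic)
qed (simp_all add: constructible_sets.basic_compl constructible_sets.union constructible_sets.inter Diff_Un Diff_Int)

lemma (in ring) constructible_empty: "{} \<in> constructible_sets R"
proof -
  have "basic_open R \<zero> = {}"
    by (auto simp: basic_open_def Spec_def additive_subgroup.zero_closed ideal.axioms(1) primeideal.axioms(1))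
  then show ?thesis
    using constructible_sets.basic[OF zero_closed] by simp
qed

lemma (in ring) constructible_Spec: "Spec R \<in> constructible_sets R"
  using constructible_compl[OF constructible_empty] by simp

lemma (in ring) constructible_UN:
  "\<lbrakk>finite I; \<And>i. i \<in> I \<Longrightarrow> U i \<in> constructible_sets R\<rbrakk> \<Longrightarrow> (\<Union>i\<in>I. U i) \<in> constructible_sets R"
  by (induction I rule: finite_induct) (auto intro: constructible_empty constructible_sets.union)

lemma (in ring) constructible_Ball:
  "\<lbrakk>finite I; \<And>i. i \<in> I \<Longrightarrow> {p \<in> Spec R. Q i p} \<in> constructible_sets R\<rbrakk>
    \<Longrightarrow> {p \<in> Spec R. \<forall>i\<in>I. Q i p} \<in> constructible_sets R"
proof (induction I rule: finite_induct)
  case empty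
  then show ?case by (simp add: constructible_Spec)
next
  case (insert i I)
  have "{p \<in> Spec R. \<forall>i\<in>insert i I. Q i p} = {p \<in> Spec R. Q i p} \<inter> {p \<in> Spec R. \<forall>i\<in>I. Q i p}"
    by auto
  with insert show ?case by (simp add: constructible_sets.inter)
qed

text \<open>
  Both a generating set and its complement are open by definition of the topology, and complements
  of constructible sets are constructible; so constructible sets are clopen.
\<close>

lemma constructible_closedin:
  assumes "U \<in> constructible_sets C"
  shows "closedin (constructible_topology C) U"
proof -
  have *: "openin (constructible_topology C) U" if "U \<in> constructible_sets C" for U
    using that
    by (induction rule: constructible_sets.induct)
      (simp_all add: constructible_topology_def topology_generated_by_Basis openin_Un openin_Int)
  have top: "topspace (constructible_topology C) = Spec C"
  proof (rule equalityI)
    show "topspace (constructible_topology C) \<subseteq> Spec C"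
      unfolding constructible_topology_def topology_generated_by_topspace
      by (auto simp: basic_open_def)
    show "Spec C \<subseteq> topspace (constructible_topology C)"
      using openin_subset[OF *[OF assms]] openin_subset[OF *[OF constructible_compl[OF assms]]]
      by auto
  qed
  show ?thesis
    unfolding closedin_def top
    using constructible_subset[OF assms] *[OF constructible_compl[OF assms]] by simp
qed

text \<open>
  Linear algebra is done over all residue fields at once.  Of these fields only the maps
  from \<open>C\<close> and their kernels matter, because vanishing of a coefficient at \<open>p\<close> is the only case
  distinction that is ever made.
\<close>

locale field_family = cring C for C :: "('c, 's) ring_scheme" (structure) +
  fixes K :: "'c set \<Rightarrow> ('f, 't) ring_scheme" and \<phi> :: "'c set \<Rightarrow> 'c \<Rightarrow> 'f"
  assumes field_K: "p \<in> Spec C \<Longrightarrow> field (K p)"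
    and hom_\<phi>: "p \<in> Spec C \<Longrightarrow> \<phi> p \<in> ring_hom C (K p)"
    and \<phi>_eq_zero_iff: "\<lbrakk>p \<in> Spec C; c \<in> carrier C\<rbrakk> \<Longrightarrow> \<phi> p c = \<zero>\<^bsub>K p\<^esub> \<longleftrightarrow> c \<in> p"
begin

lemma \<phi>_closed: "\<lbrakk>p \<in> Spec C; c \<in> carrier C\<rbrakk> \<Longrightarrow> \<phi> p c \<in> carrier (K p)"
  using hom_\<phi> by (rule ring_hom_closed)

lemma ring_hom_ring_\<phi>: "p \<in> Spec C \<Longrightarrow> ring_hom_ring C (K p) (\<phi> p)"
  by (simp add: ring_hom_ringI2 ring_axioms field_K field.axioms domain.axioms(1) cring.axioms(1) hom_\<phi>)

lemma constructible_vanishing: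
  assumes "c \<in> carrier C"
  shows "{p \<in> Spec C. \<phi> p c = \<zero>\<^bsub>K p\<^esub>} \<in> constructible_sets C"
proof -
  have "{p \<in> Spec C. \<phi> p c = \<zero>\<^bsub>K p\<^esub>} = Spec C - basic_open C c"
    using assms by (auto simp: \<phi>_eq_zero_iff basic_open_def)
  with assms show ?thesis by (simp add: constructible_sets.basic_compl)
qed

lemma constructible_nonvanishing:
  assumes "c \<in> carrier C"
  shows "{p \<in> Spec C. \<phi> p c \<noteq> \<zero>\<^bsub>K p\<^esub>} \<in> constructible_sets C"
proof -
  have "{p \<in> Spec C. \<phi> p c \<noteq> \<zero>\<^bsub>K p\<^esub>} = basic_open C c"
    using assms by (auto simp: \<phi>_eq_zero_iff basic_open_def)
  with assms show ?thesis by (simp add: constructible_sets.basic)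
qed

text \<open>
  A linear form is a family of forms, one for each \<open>p\<close>, whose coefficients come from
  elements of \<open>C\<close> that are chosen once for all \<open>p\<close>.  The inductive description stands for
  coefficient vectors and keeps sums over the set of variables out of the elimination.
\<close>

inductive linear_form :: "'v set \<Rightarrow> ('c set \<Rightarrow> ('v \<Rightarrow> 'f) \<Rightarrow> 'f) \<Rightarrow> bool" for V where
  zero: "linear_form V (\<lambda>p z. \<zero>\<^bsub>K p\<^esub>)"
| coord: "v \<in> V \<Longrightarrow> linear_form V (\<lambda>p z. z v)"
| add: "\<lbrakk>linear_form V L; linear_form V M\<rbrakk> \<Longrightarrow> linear_form V (\<lambda>p z. L p z \<oplus>\<^bsub>K p\<^esub> M p z)"
| scale: "\<lbrakk>c \<in> carrier C; linear_form V L\<rbrakk> \<Longrightarrow> linear_form V (\<lambda>p z. \<phi> p c \<otimes>\<^bsub>K p\<^esub> L p z)"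

lemma linear_form_closed:
  assumes "linear_form V L" "p \<in> Spec C" "z \<in> V \<rightarrow> carrier (K p)"
  shows "L p z \<in> carrier (K p)"
proof -
  interpret K: field "K p" using assms(2) by (rule field_K)
  show ?thesis using assms(1,3)
    by (induction rule: linear_form.induct) (auto simp: \<phi>_closed assms(2))
qed

lemma linear_form_cong:
  assumes "linear_form V L" "\<And>v. v \<in> V \<Longrightarrow> z v = z' v"
  shows "L p z = L p z'"
  using assms by (induction rule: linear_form.induct) auto

lemma linear_form_empty:
  assumes "linear_form {} L" "p \<in> Spec C"
  shows "L p z = \<zero>\<^bsub>K p\<^esub>"
proof -
  interpret K: field "K p" using assms(2) by (rule field_K)
  show ?thesis using assms(1)
    by (induction rule: linear_form.induct) (auto simp: \<phi>_closed assms(2))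
qed

lemma linear_form_split_variable:
  assumes "linear_form (insert v V) L"
  shows "\<exists>c\<in>carrier C. \<exists>L'. linear_form V L' \<and>
    (\<forall>p\<in>Spec C. \<forall>z\<in>insert v V \<rightarrow> carrier (K p). L p z = \<phi> p c \<otimes>\<^bsub>K p\<^esub> z v \<oplus>\<^bsub>K p\<^esub> L' p z)"
  using assms
proof (induction rule: linear_form.induct)
  case zero
  show ?case
  proof (intro bexI[of _ "\<zero>\<^bsub>C\<^esub>"] exI[of _ "\<lambda>p z. \<zero>\<^bsub>K p\<^esub>"] conjI ballI)
    fix p z assume p: "p \<in> Spec C" and z: "z \<in> insert v V \<rightarrow> carrier (K p)"
    interpret K: field "K p" using p by (rule field_K)
    interpret h: ring_hom_ring C "K p" "\<phi> p" using p by (rule ring_hom_ring_\<phi>)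
    show "\<zero>\<^bsub>K p\<^esub> = \<phi> p \<zero>\<^bsub>C\<^esub> \<otimes>\<^bsub>K p\<^esub> z v \<oplus>\<^bsub>K p\<^esub> \<zero>\<^bsub>K p\<^esub>"
      using z by auto
  qed (simp_all add: linear_form.zero)
next
  case (coord w)
  show ?case
  proof (cases "w = v")
    case True
    show ?thesis
    proof (intro bexI[of _ "\<one>\<^bsub>C\<^esub>"] exI[of _ "\<lambda>p z. \<zero>\<^bsub>K p\<^esub>"] conjI ballI)
      fix p z assume p: "p \<in> Spec C" and z: "z \<in> insert v V \<rightarrow> carrier (K p)"
      interpret K: field "K p" using p by (rule field_K)
      interpret h: ring_hom_ring C "K p" "\<phi> p" using p by (rule ring_hom_ring_\<phi>)
      show "z w = \<phi> p \<one>\<^bsub>C\<^esub> \<otimes>\<^bsub>K p\<^esub> z v \<oplus>\<^bsub>K p\<^esub> \<zero>\<^bsub>K p\<^esub>"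
        using z True by auto
    qed (simp_all add: linear_form.zero)
  next
    case False
    show ?thesis
    proof (intro bexI[of _ "\<zero>\<^bsub>C\<^esub>"] exI[of _ "\<lambda>p z. z w"] conjI ballI)
      fix p z assume p: "p \<in> Spec C" and z: "z \<in> insert v V \<rightarrow> carrier (K p)"
      interpret K: field "K p" using p by (rule field_K)
      interpret h: ring_hom_ring C "K p" "\<phi> p" using p by (rule ring_hom_ring_\<phi>)
      have "z w \<in> carrier (K p)" "z v \<in> carrier (K p)" using z coord False by auto
      then show "z w = \<phi> p \<zero>\<^bsub>C\<^esub> \<otimes>\<^bsub>K p\<^esub> z v \<oplus>\<^bsub>K p\<^esub> z w" by simp
    next
      show "linear_form V (\<lambda>p z. z w)"
        using False coord by (intro linear_form.coord) simp
    qed auto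
  qed
next
  case (add L M)
  then obtain c L' d M' where c: "c \<in> carrier C" "linear_form V L'"
      "\<And>p z. \<lbrakk>p\<in>Spec C; z\<in>insert v V \<rightarrow> carrier (K p)\<rbrakk> \<Longrightarrow> L p z = \<phi> p c \<otimes>\<^bsub>K p\<^esub> z v \<oplus>\<^bsub>K p\<^esub> L' p z"
    and d: "d \<in> carrier C" "linear_form V M'"
      "\<And>p z. \<lbrakk>p\<in>Spec C; z\<in>insert v V \<rightarrow> carrier (K p)\<rbrakk> \<Longrightarrow> M p z = \<phi> p d \<otimes>\<^bsub>K p\<^esub> z v \<oplus>\<^bsub>K p\<^esub> M' p z"
    by blast
  show ?case
  proof (intro bexI[of _ "c \<oplus>\<^bsub>C\<^esub> d"] exI[of _ "\<lambda>p z. L' p z \<oplus>\<^bsub>K p\<^esub> M' p z"] conjI ballI)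
    fix p z assume p: "p \<in> Spec C" and z: "z \<in> insert v V \<rightarrow> carrier (K p)"
    interpret K: field "K p" using p by (rule field_K)
    interpret h: ring_hom_ring C "K p" "\<phi> p" using p by (rule ring_hom_ring_\<phi>)
    have "L' p z \<in> carrier (K p)" "M' p z \<in> carrier (K p)"
      using z by (auto intro: linear_form_closed[OF c(2) p] linear_form_closed[OF d(2) p])
    moreover have "z v \<in> carrier (K p)" using z by auto
    ultimately show "L p z \<oplus>\<^bsub>K p\<^esub> M p z = \<phi> p (c \<oplus>\<^bsub>C\<^esub> d) \<otimes>\<^bsub>K p\<^esub> z v \<oplus>\<^bsub>K p\<^esub> (L' p z \<oplus>\<^bsub>K p\<^esub> M' p z)"
      using c(1) d(1) by (simp add: c(3)[OF p z] d(3)[OF p z] K.l_distr K.a_ac)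
  next
    show "linear_form V (\<lambda>p z. L' p z \<oplus>\<^bsub>K p\<^esub> M' p z)" using c(2) d(2) by (rule linear_form.add)
  qed (use c(1) d(1) in simp)
next
  case (scale d L)
  then obtain c L' where c: "c \<in> carrier C" "linear_form V L'"
      "\<And>p z. \<lbrakk>p\<in>Spec C; z\<in>insert v V \<rightarrow> carrier (K p)\<rbrakk> \<Longrightarrow> L p z = \<phi> p c \<otimes>\<^bsub>K p\<^esub> z v \<oplus>\<^bsub>K p\<^esub> L' p z"
    by blast
  show ?case
  proof (intro bexI[of _ "d \<otimes>\<^bsub>C\<^esub> c"] exI[of _ "\<lambda>p z. \<phi> p d \<otimes>\<^bsub>K p\<^esub> L' p z"] conjI ballI)
    fix p z assume p: "p \<in> Spec C" and z: "z \<in> insert v V \<rightarrow> carrier (K p)"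
    interpret K: field "K p" using p by (rule field_K)
    interpret h: ring_hom_ring C "K p" "\<phi> p" using p by (rule ring_hom_ring_\<phi>)
    have "L' p z \<in> carrier (K p)"
      using z by (auto intro: linear_form_closed[OF c(2) p])
    moreover have "z v \<in> carrier (K p)" using z by auto
    ultimately show "\<phi> p d \<otimes>\<^bsub>K p\<^esub> L p z = \<phi> p (d \<otimes>\<^bsub>C\<^esub> c) \<otimes>\<^bsub>K p\<^esub> z v \<oplus>\<^bsub>K p\<^esub> (\<phi> p d \<otimes>\<^bsub>K p\<^esub> L' p z)"
      using c(1) scale(1) by (simp add: c(3)[OF p z] K.r_distr K.m_assoc)
  next
    show "linear_form V (\<lambda>p z. \<phi> p d \<otimes>\<^bsub>K p\<^esub> L' p z)" using scale(1) c(2) by (rule linear_form.scale)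
  qed (use c(1) scale(1) in simp)
qed

text \<open>
  If \<open>c \<cdot> t + L\<close> and \<open>d \<cdot> t + M\<close> are two forms with the variable \<open>t\<close> split off, this is the
  combination \<open>c \<cdot> M - d \<cdot> L\<close> in which \<open>t\<close> cancels.  It is written without division, so its
  coefficients stay in \<open>C\<close>.
\<close>

definition cross :: "'c \<Rightarrow> 'c \<Rightarrow> ('c set \<Rightarrow> ('v \<Rightarrow> 'f) \<Rightarrow> 'f) \<Rightarrow> ('c set \<Rightarrow> ('v \<Rightarrow> 'f) \<Rightarrow> 'f)
    \<Rightarrow> 'c set \<Rightarrow> ('v \<Rightarrow> 'f) \<Rightarrow> 'f" where
  "cross c d L M = (\<lambda>p z. \<phi> p c \<otimes>\<^bsub>K p\<^esub> M p z \<oplus>\<^bsub>K p\<^esub> \<phi> p (\<ominus>\<^bsub>C\<^esub> d) \<otimes>\<^bsub>K p\<^esub> L p z)"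

lemma linear_form_cross:
  "\<lbrakk>c \<in> carrier C; d \<in> carrier C; linear_form V L; linear_form V M\<rbrakk> \<Longrightarrow> linear_form V (cross c d L M)"
  unfolding cross_def by (intro linear_form.add linear_form.scale) auto

text \<open>
  When the pivot \<open>c\<close> does not vanish at \<open>p\<close>, the pivot equation determines \<open>t\<close>, and
  \<open>c \<cdot> M - d \<cdot> L = c \<cdot> (d \<cdot> t + M)\<close> for that \<open>t\<close>.
\<close>

lemma cross_eq_zero_iff:
  assumes p: "p \<in> Spec C" and cd: "c \<in> carrier C" "d \<in> carrier C"
    and LM: "L p z \<in> carrier (K p)" "M p z \<in> carrier (K p)"
    and t: "t \<in> carrier (K p)" "\<phi> p c \<noteq> \<zero>\<^bsub>K p\<^esub>" "\<phi> p c \<otimes>\<^bsub>K p\<^esub> t \<oplus>\<^bsub>K p\<^esub> L p z = \<zero>\<^bsub>K p\<^esub>"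
  shows "cross c d L M p z = \<zero>\<^bsub>K p\<^esub> \<longleftrightarrow> \<phi> p d \<otimes>\<^bsub>K p\<^esub> t \<oplus>\<^bsub>K p\<^esub> M p z = \<zero>\<^bsub>K p\<^esub>"
proof -
  interpret K: field "K p" using p by (rule field_K)
  interpret h: ring_hom_ring C "K p" "\<phi> p" using p by (rule ring_hom_ring_\<phi>)
  have L: "L p z = \<ominus>\<^bsub>K p\<^esub> (\<phi> p c \<otimes>\<^bsub>K p\<^esub> t)"
    using t LM cd by (metis K.minus_equality K.m_closed K.a_comm h.hom_closed K.minus_minus)
  have "cross c d L M p z = \<phi> p c \<otimes>\<^bsub>K p\<^esub> (\<phi> p d \<otimes>\<^bsub>K p\<^esub> t \<oplus>\<^bsub>K p\<^esub> M p z)"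
    unfolding cross_def L using cd t LM
    by (simp add: K.r_distr K.l_minus K.r_minus K.m_ac K.a_ac)
  then show ?thesis
    using t(1,2) cd LM K.integral_iff by simp
qed

lemma pivot_solution:
  assumes p: "p \<in> Spec C" and c: "c \<in> carrier C" "\<phi> p c \<noteq> \<zero>\<^bsub>K p\<^esub>" and b: "b \<in> carrier (K p)"
  shows "\<exists>t\<in>carrier (K p). \<phi> p c \<otimes>\<^bsub>K p\<^esub> t \<oplus>\<^bsub>K p\<^esub> b = \<zero>\<^bsub>K p\<^esub>"
proof
  interpret K: field "K p" using p by (rule field_K)
  have c': "\<phi> p c \<in> Units (K p)" using c p by (simp add: K.field_Units \<phi>_closed)
  let ?t = "inv\<^bsub>K p\<^esub> (\<phi> p c) \<otimes>\<^bsub>K p\<^esub> (\<ominus>\<^bsub>K p\<^esub> b)"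
  show "?t \<in> carrier (K p)" using c' b by simp
  have "\<phi> p c \<otimes>\<^bsub>K p\<^esub> ?t = \<ominus>\<^bsub>K p\<^esub> b"
    using c' b by (simp add: K.m_assoc[symmetric] K.Units_closed)
  then show "\<phi> p c \<otimes>\<^bsub>K p\<^esub> ?t \<oplus>\<^bsub>K p\<^esub> b = \<zero>\<^bsub>K p\<^esub>"
    using b by (simp add: K.l_neg)
qed

lemma linear_form_zero_vector:
  assumes "linear_form V L" "p \<in> Spec C"
  shows "L p (\<lambda>_. \<zero>\<^bsub>K p\<^esub>) = \<zero>\<^bsub>K p\<^esub>"
proof -
  interpret K: field "K p" using assms(2) by (rule field_K)
  show ?thesis using assms(1)
    by (induction rule: linear_form.induct) (auto simp: \<phi>_closed assms(2))
qed

lemma split_variable_family: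
  assumes "\<And>L. L \<in> F \<Longrightarrow> linear_form (insert v V) L"
  shows "\<exists>c R. \<forall>L\<in>F. c L \<in> carrier C \<and> linear_form V (R L) \<and>
    (\<forall>p\<in>Spec C. \<forall>z\<in>insert v V \<rightarrow> carrier (K p).
       L p z = \<phi> p (c L) \<otimes>\<^bsub>K p\<^esub> z v \<oplus>\<^bsub>K p\<^esub> R L p z)"
proof -
  have "\<exists>c. \<forall>L\<in>F. \<exists>M. c L \<in> carrier C \<and> linear_form V M \<and>
    (\<forall>p\<in>Spec C. \<forall>z\<in>insert v V \<rightarrow> carrier (K p). L p z = \<phi> p (c L) \<otimes>\<^bsub>K p\<^esub> z v \<oplus>\<^bsub>K p\<^esub> M p z)"
    by (rule bchoice) (use linear_form_split_variable[OF assms] in blast)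
  then obtain c where c: "\<forall>L\<in>F. \<exists>M. c L \<in> carrier C \<and> linear_form V M \<and>
    (\<forall>p\<in>Spec C. \<forall>z\<in>insert v V \<rightarrow> carrier (K p). L p z = \<phi> p (c L) \<otimes>\<^bsub>K p\<^esub> z v \<oplus>\<^bsub>K p\<^esub> M p z)" ..
  show ?thesis
    by (rule exI[of _ c]) (rule bchoice[OF c])
qed

lemma linear_form_fun_upd:
  "\<lbrakk>linear_form V L; v \<notin> V\<rbrakk> \<Longrightarrow> L p (z(v := t)) = L p z"
  by (rule linear_form_cong[of V L "z(v := t)" z p]) auto

text \<open>
  Elimination of one variable \<open>v\<close>.  If some equation has a coefficient of \<open>v\<close> that is nonzero
  at \<open>p\<close>, it serves as pivot and \<open>v\<close> disappears from all other forms.  If all these coefficients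
  vanish at \<open>p\<close>, then either \<open>v\<close> has a nonzero coefficient in \<open>M\<close>, and the vector with the single
  nonzero entry \<open>v = 1\<close> is a witness, or \<open>v\<close> occurs in no form.  Which case holds
  is a constructible condition on \<open>p\<close>.
\<close>

lemma constructible_nonzero_on_kernel:
  assumes "finite V" "finite F" "\<And>L. L \<in> F \<Longrightarrow> linear_form V L" "linear_form V M"
  shows "{p \<in> Spec C. \<exists>z\<in>V \<rightarrow> carrier (K p). (\<forall>L\<in>F. L p z = \<zero>\<^bsub>K p\<^esub>) \<and> M p z \<noteq> \<zero>\<^bsub>K p\<^esub>}
    \<in> constructible_sets C"
  using assms
proof (induction V arbitrary: F M rule: finite_induct)
  case empty
  then have "{p \<in> Spec C. \<exists>z\<in>{} \<rightarrow> carrier (K p). (\<forall>L\<in>F. L p z = \<zero>\<^bsub>K p\<^esub>) \<and> M p z \<noteq> \<zero>\<^bsub>K p\<^esub>} = {}"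
    by (auto simp: linear_form_empty)
  then show ?case using constructible_empty by metis
next
  case (insert v V)
  have "\<And>L. L \<in> insert M F \<Longrightarrow> linear_form (insert v V) L" using insert.prems by auto
  from split_variable_family[OF this]
  obtain c R where cR: "\<forall>L\<in>insert M F. c L \<in> carrier C \<and> linear_form V (R L) \<and>
    (\<forall>p\<in>Spec C. \<forall>z\<in>insert v V \<rightarrow> carrier (K p).
       L p z = \<phi> p (c L) \<otimes>\<^bsub>K p\<^esub> z v \<oplus>\<^bsub>K p\<^esub> R L p z)"
    by blast
  have c: "c L \<in> carrier C" and R: "linear_form V (R L)" if "L \<in> insert M F" for L
    using cR that by blast+
  have split: "L p z = \<phi> p (c L) \<otimes>\<^bsub>K p\<^esub> z v \<oplus>\<^bsub>K p\<^esub> R L p z"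
    if "L \<in> insert M F" "p \<in> Spec C" "z \<in> insert v V \<rightarrow> carrier (K p)" for L p z
    using cR that by blast
  define Q where "Q G N p \<longleftrightarrow> (\<exists>z\<in>V \<rightarrow> carrier (K p). (\<forall>L\<in>G. L p z = \<zero>\<^bsub>K p\<^esub>) \<and> N p z \<noteq> \<zero>\<^bsub>K p\<^esub>)" for G N p
  define X' where "X' L N = cross (c L) (c N) (R L) (R N)" for L N
  let ?S = "{p \<in> Spec C. \<exists>z\<in>insert v V \<rightarrow> carrier (K p). (\<forall>L\<in>F. L p z = \<zero>\<^bsub>K p\<^esub>) \<and> M p z \<noteq> \<zero>\<^bsub>K p\<^esub>}"
  let ?nz = "\<lambda>L. {p \<in> Spec C. \<phi> p (c L) \<noteq> \<zero>\<^bsub>K p\<^esub>}"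
  let ?T = "(\<Union>L\<in>F. ?nz L \<inter> {p \<in> Spec C. Q (X' L ` F) (X' L M) p}) \<union>
    ({p \<in> Spec C. \<forall>L\<in>F. \<phi> p (c L) = \<zero>\<^bsub>K p\<^esub>} \<inter> (?nz M \<union> {p \<in> Spec C. Q (R ` F) (R M) p}))"
  have Rcl: "R L p z \<in> carrier (K p)"
    if "L \<in> insert M F" "p \<in> Spec C" "z \<in> V \<rightarrow> carrier (K p)" for L p z
    using R[OF that(1)] that(2,3) by (rule linear_form_closed)
  have *: "p \<in> ?S \<longleftrightarrow> p \<in> ?T" if p: "p \<in> Spec C" for p
  proof -
    interpret K: field "K p" using p by (rule field_K)
    have S: "p \<in> ?S \<longleftrightarrow> (\<exists>z\<in>V \<rightarrow> carrier (K p). \<exists>t\<in>carrier (K p).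
      (\<forall>L\<in>F. \<phi> p (c L) \<otimes>\<^bsub>K p\<^esub> t \<oplus>\<^bsub>K p\<^esub> R L p z = \<zero>\<^bsub>K p\<^esub>) \<and>
      \<phi> p (c M) \<otimes>\<^bsub>K p\<^esub> t \<oplus>\<^bsub>K p\<^esub> R M p z \<noteq> \<zero>\<^bsub>K p\<^esub>)" (is "_ \<longleftrightarrow> ?S'")
    proof
      assume "p \<in> ?S"
      then obtain z where z: "z\<in>insert v V \<rightarrow> carrier (K p)" "\<forall>L\<in>F. L p z = \<zero>\<^bsub>K p\<^esub>" "M p z \<noteq> \<zero>\<^bsub>K p\<^esub>"
        by auto
      with split[OF _ p z(1)] show ?S'
        by (intro bexI[of _ z] bexI[of _ "z v"]) auto
    next
      assume ?S'
      then obtain z t where z: "z \<in> V \<rightarrow> carrier (K p)" and t: "t \<in> carrier (K p)"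
        and *: "\<forall>L\<in>F. \<phi> p (c L) \<otimes>\<^bsub>K p\<^esub> t \<oplus>\<^bsub>K p\<^esub> R L p z = \<zero>\<^bsub>K p\<^esub>"
          "\<phi> p (c M) \<otimes>\<^bsub>K p\<^esub> t \<oplus>\<^bsub>K p\<^esub> R M p z \<noteq> \<zero>\<^bsub>K p\<^esub>"
        by blast
      have zt: "z(v := t) \<in> insert v V \<rightarrow> carrier (K p)" using z t by auto
      show "p \<in> ?S"
        using * split[OF _ p zt] linear_form_fun_upd[OF R insert.hyps(2)] p zt by auto
    qed
    show ?thesis
    proof (cases "\<forall>L\<in>F. \<phi> p (c L) = \<zero>\<^bsub>K p\<^esub>")
      case True
      have "?S' \<longleftrightarrow> \<phi> p (c M) \<noteq> \<zero>\<^bsub>K p\<^esub> \<or> Q (R ` F) (R M) p"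
      proof
        assume ?S'
        then obtain z t where z: "z\<in>V \<rightarrow> carrier (K p)" and t: "t\<in>carrier (K p)"
          and F: "\<forall>N\<in>F. \<phi> p (c N) \<otimes>\<^bsub>K p\<^esub> t \<oplus>\<^bsub>K p\<^esub> R N p z = \<zero>\<^bsub>K p\<^esub>"
          and M: "\<phi> p (c M) \<otimes>\<^bsub>K p\<^esub> t \<oplus>\<^bsub>K p\<^esub> R M p z \<noteq> \<zero>\<^bsub>K p\<^esub>"
          by blast
        have 0: "\<zero>\<^bsub>K p\<^esub> \<otimes>\<^bsub>K p\<^esub> t \<oplus>\<^bsub>K p\<^esub> R N p z = R N p z" if "N \<in> insert M F" for N
          using t Rcl[OF that p z] by simp
        have "R N p z = \<zero>\<^bsub>K p\<^esub>" if "N \<in> F" for N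
          using F True 0[of N] that by auto
        moreover have "R M p z \<noteq> \<zero>\<^bsub>K p\<^esub>" if "\<phi> p (c M) = \<zero>\<^bsub>K p\<^esub>"
          using M 0[of M] that by auto
        ultimately show "\<phi> p (c M) \<noteq> \<zero>\<^bsub>K p\<^esub> \<or> Q (R ` F) (R M) p"
          unfolding Q_def using z by blast
      next
        assume A: "\<phi> p (c M) \<noteq> \<zero>\<^bsub>K p\<^esub> \<or> Q (R ` F) (R M) p"
        show ?S'
        proof (cases "\<phi> p (c M) = \<zero>\<^bsub>K p\<^esub>")
          case c0: True
          with A obtain z where "z\<in>V \<rightarrow> carrier (K p)" "\<forall>L\<in>F. R L p z = \<zero>\<^bsub>K p\<^esub>" "R M p z \<noteq> \<zero>\<^bsub>K p\<^esub>"
            by (auto simp: Q_def)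
          then show ?thesis
            using True c0 Rcl[OF _ p] by (intro bexI[of _ z] bexI[of _ "\<zero>\<^bsub>K p\<^esub>"]) auto
        next
          case False
          then show ?thesis
            using True linear_form_zero_vector[OF R p] c
            by (intro bexI[of _ "\<lambda>_. \<zero>\<^bsub>K p\<^esub>"] bexI[of _ "\<one>\<^bsub>K p\<^esub>"]) (auto simp: \<phi>_closed p)
        qed
      qed
      moreover have "p \<in> ?T \<longleftrightarrow> \<phi> p (c M) \<noteq> \<zero>\<^bsub>K p\<^esub> \<or> Q (R ` F) (R M) p"
        using True p by blast
      ultimately show ?thesis using S by blast
    next
      case False
      have key: "?S' \<longleftrightarrow> Q (X' L ` F) (X' L M) p" if L: "L \<in> F" "\<phi> p (c L) \<noteq> \<zero>\<^bsub>K p\<^esub>" for L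
      proof -
        have X': "X' L N p z = \<zero>\<^bsub>K p\<^esub> \<longleftrightarrow> \<phi> p (c N) \<otimes>\<^bsub>K p\<^esub> t \<oplus>\<^bsub>K p\<^esub> R N p z = \<zero>\<^bsub>K p\<^esub>"
          if "N \<in> insert M F" "z\<in>V \<rightarrow> carrier (K p)" "t \<in> carrier (K p)"
            "\<phi> p (c L) \<otimes>\<^bsub>K p\<^esub> t \<oplus>\<^bsub>K p\<^esub> R L p z = \<zero>\<^bsub>K p\<^esub>" for N z t
          unfolding X'_def using that L by (intro cross_eq_zero_iff p c Rcl) auto
        show ?thesis
        proof
          assume ?S'
          then obtain z t where z: "z\<in>V \<rightarrow> carrier (K p)" and t: "t\<in>carrier (K p)"
            and F: "\<forall>N\<in>F. \<phi> p (c N) \<otimes>\<^bsub>K p\<^esub> t \<oplus>\<^bsub>K p\<^esub> R N p z = \<zero>\<^bsub>K p\<^esub>"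
            and M: "\<phi> p (c M) \<otimes>\<^bsub>K p\<^esub> t \<oplus>\<^bsub>K p\<^esub> R M p z \<noteq> \<zero>\<^bsub>K p\<^esub>"
            by blast
          have "X' L N p z = \<zero>\<^bsub>K p\<^esub>" if "N \<in> F" for N
            using X'[OF _ z t] F L(1) that by blast
          moreover have "X' L M p z \<noteq> \<zero>\<^bsub>K p\<^esub>"
            using X'[OF _ z t] F L(1) M by blast
          ultimately show "Q (X' L ` F) (X' L M) p" unfolding Q_def using z by blast
        next
          assume "Q (X' L ` F) (X' L M) p"
          then obtain z where z: "z\<in>V \<rightarrow> carrier (K p)" "\<forall>N\<in>F. X' L N p z = \<zero>\<^bsub>K p\<^esub>" "X' L M p z \<noteq> \<zero>\<^bsub>K p\<^esub>"
            unfolding Q_def by auto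
          moreover obtain t where "t\<in>carrier (K p)" "\<phi> p (c L) \<otimes>\<^bsub>K p\<^esub> t \<oplus>\<^bsub>K p\<^esub> R L p z = \<zero>\<^bsub>K p\<^esub>"
            using pivot_solution[OF p c L(2) Rcl[OF _ p z(1)]] L(1) by blast
          ultimately show ?S' using X'[of _ z t] by (intro bexI[of _ z] bexI[of _ t]) auto
        qed
      qed
      have "p \<in> ?T \<longleftrightarrow> (\<exists>L\<in>F. \<phi> p (c L) \<noteq> \<zero>\<^bsub>K p\<^esub> \<and> Q (X' L ` F) (X' L M) p)"
        using False p by blast
      also have "\<dots> \<longleftrightarrow> ?S'" using key False by blast
      finally show ?thesis using S by blast
    qed
  qed
  have "?S = ?T" using * by blast
  moreover have "{p \<in> Spec C. Q (X' L ` F) (X' L M) p} \<in> constructible_sets C" if "L \<in> F" for L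
  proof -
    have "linear_form V (X' L N)" if "N \<in> insert M F" for N
      unfolding X'_def using \<open>L \<in> F\<close> that by (intro linear_form_cross c R) auto
    then show ?thesis
      unfolding Q_def using insert.prems(1) by (intro insert.IH[of "X' L ` F" "X' L M"]) blast+
  qed
  moreover have "{p \<in> Spec C. Q (R ` F) (R M) p} \<in> constructible_sets C"
    unfolding Q_def using R insert.prems(1) by (intro insert.IH[of "R ` F" "R M"]) blast+
  ultimately show ?case
    using insert.prems(1) c
    by (auto intro!: constructible_sets.union constructible_sets.inter constructible_UN
        constructible_Ball constructible_vanishing constructible_nonvanishing)
qed

text \<open>
  Gaussian elimination of the existentially quantified variables \<open>W\<close>, again by cases on which
  coefficient can serve as pivot.  When no such variable is left, the condition says that each
  form in \<open>F\<close> vanishes on the common kernel of \<open>G\<close>, which is the negation of the condition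
  in \<open>constructible_nonzero_on_kernel\<close>.
\<close>

theorem constructible_solvability:
  fixes V W :: "'v set"
  assumes "finite V" "finite G" "\<And>L. L \<in> G \<Longrightarrow> linear_form V L"
    and "finite W" "V \<inter> W = {}" "finite F" "\<And>L. L \<in> F \<Longrightarrow> linear_form (V \<union> W) L"
  shows "{p \<in> Spec C. \<forall>z\<in>V \<rightarrow> carrier (K p). (\<forall>L\<in>G. L p z = \<zero>\<^bsub>K p\<^esub>) \<longrightarrow>
      (\<exists>y\<in>V \<union> W \<rightarrow> carrier (K p). (\<forall>v\<in>V. y v = z v) \<and> (\<forall>L\<in>F. L p y = \<zero>\<^bsub>K p\<^esub>))}
    \<in> constructible_sets C"
  using assms(4-)
proof (induction W arbitrary: F rule: finite_induct)
  case empty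
  then have F: "\<And>L. L \<in> F \<Longrightarrow> linear_form V L" by simp
  let ?S = "{p \<in> Spec C. \<forall>z\<in>V \<rightarrow> carrier (K p). (\<forall>L\<in>G. L p z = \<zero>\<^bsub>K p\<^esub>) \<longrightarrow>
      (\<exists>y\<in>V \<union> {} \<rightarrow> carrier (K p). (\<forall>v\<in>V. y v = z v) \<and> (\<forall>L\<in>F. L p y = \<zero>\<^bsub>K p\<^esub>))}"
  let ?T = "\<lambda>M. {p \<in> Spec C. \<exists>z\<in>V \<rightarrow> carrier (K p). (\<forall>L\<in>G. L p z = \<zero>\<^bsub>K p\<^esub>) \<and> M p z \<noteq> \<zero>\<^bsub>K p\<^esub>}"
  have *: "(\<exists>y\<in>V \<union> {} \<rightarrow> carrier (K p). (\<forall>v\<in>V. y v = z v) \<and> (\<forall>L\<in>F. L p y = \<zero>\<^bsub>K p\<^esub>)) \<longleftrightarrow>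
    (\<forall>L\<in>F. L p z = \<zero>\<^bsub>K p\<^esub>)" if "z\<in>V \<rightarrow> carrier (K p)" for p z
  proof
    assume "\<exists>y\<in>V \<union> {} \<rightarrow> carrier (K p). (\<forall>v\<in>V. y v = z v) \<and> (\<forall>L\<in>F. L p y = \<zero>\<^bsub>K p\<^esub>)"
    then obtain y where y: "\<forall>v\<in>V. y v = z v" "\<forall>L\<in>F. L p y = \<zero>\<^bsub>K p\<^esub>" by blast
    have "L p y = L p z" if "L \<in> F" for L
      using linear_form_cong[OF F[OF that]] y(1) by blast
    with y(2) show "\<forall>L\<in>F. L p z = \<zero>\<^bsub>K p\<^esub>" by metis
  next
    assume "\<forall>L\<in>F. L p z = \<zero>\<^bsub>K p\<^esub>"
    with that show "\<exists>y\<in>V \<union> {} \<rightarrow> carrier (K p). (\<forall>v\<in>V. y v = z v) \<and> (\<forall>L\<in>F. L p y = \<zero>\<^bsub>K p\<^esub>)"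
      by auto
  qed
  have "?S = {p \<in> Spec C. \<forall>z\<in>V \<rightarrow> carrier (K p). (\<forall>L\<in>G. L p z = \<zero>\<^bsub>K p\<^esub>) \<longrightarrow>
      (\<forall>L\<in>F. L p z = \<zero>\<^bsub>K p\<^esub>)}"
    by (intro Collect_cong conj_cong ball_cong imp_cong refl *)
  also have "\<dots> = {p \<in> Spec C. \<forall>M\<in>F. p \<in> Spec C - ?T M}"
    by blast
  finally have "?S = {p \<in> Spec C. \<forall>M\<in>F. p \<in> Spec C - ?T M}" .
  moreover have "{p \<in> Spec C. p \<in> Spec C - ?T M} \<in> constructible_sets C" if "M \<in> F" for M
  proof -
    have "{p \<in> Spec C. p \<in> Spec C - ?T M} = Spec C - ?T M" by blast
    with constructible_compl[OF constructible_nonzero_on_kernel[OF assms(1-3) F[OF that]]]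
    show ?thesis by (simp only:)
  qed
  ultimately show ?case
    using empty.prems(2) by (simp only: constructible_Ball)
next
  case (insert v W)
  let ?VW = "V \<union> W"
  have v: "v \<notin> ?VW" using insert by auto
  have "\<And>L. L \<in> F \<Longrightarrow> linear_form (insert v ?VW) L" using insert.prems by auto
  from split_variable_family[OF this]
  obtain c R where cR: "\<forall>L\<in>F. c L \<in> carrier C \<and> linear_form ?VW (R L) \<and>
    (\<forall>p\<in>Spec C. \<forall>z\<in>insert v ?VW \<rightarrow> carrier (K p).
       L p z = \<phi> p (c L) \<otimes>\<^bsub>K p\<^esub> z v \<oplus>\<^bsub>K p\<^esub> R L p z)"
    by blast
  have c: "c L \<in> carrier C" and R: "linear_form ?VW (R L)" if "L \<in> F" for L
    using cR that by blast+
  have split: "L p z = \<phi> p (c L) \<otimes>\<^bsub>K p\<^esub> z v \<oplus>\<^bsub>K p\<^esub> R L p z"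
    if "L \<in> F" "p \<in> Spec C" "z \<in> insert v ?VW \<rightarrow> carrier (K p)" for L p z
    using cR that by blast
  define Q where "Q H p z \<longleftrightarrow> (\<exists>y\<in>?VW \<rightarrow> carrier (K p). (\<forall>v\<in>V. y v = z v) \<and> (\<forall>L\<in>H. L p y = \<zero>\<^bsub>K p\<^esub>))" for H p z
  define X' where "X' L N = cross (c L) (c N) (R L) (R N)" for L N
  let ?nz = "\<lambda>L. {p \<in> Spec C. \<phi> p (c L) \<noteq> \<zero>\<^bsub>K p\<^esub>}"
  define B where "B H = {p \<in> Spec C. \<forall>z\<in>V \<rightarrow> carrier (K p). (\<forall>L\<in>G. L p z = \<zero>\<^bsub>K p\<^esub>) \<longrightarrow> Q H p z}" for H
  let ?S = "{p \<in> Spec C. \<forall>z\<in>V \<rightarrow> carrier (K p). (\<forall>L\<in>G. L p z = \<zero>\<^bsub>K p\<^esub>) \<longrightarrow>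
      (\<exists>y\<in>V \<union> insert v W \<rightarrow> carrier (K p). (\<forall>v\<in>V. y v = z v) \<and> (\<forall>L\<in>F. L p y = \<zero>\<^bsub>K p\<^esub>))}"
  let ?T = "(\<Union>L\<in>F. ?nz L \<inter> B (X' L ` F)) \<union>
    ({p \<in> Spec C. \<forall>L\<in>F. \<phi> p (c L) = \<zero>\<^bsub>K p\<^esub>} \<inter> B (R ` F))"
  have Rcl: "R L p z \<in> carrier (K p)"
    if "L \<in> F" "p \<in> Spec C" "z \<in> ?VW \<rightarrow> carrier (K p)" for L p z
    using R[OF that(1)] that(2,3) by (rule linear_form_closed)
  have *: "p \<in> ?S \<longleftrightarrow> p \<in> ?T" if p: "p \<in> Spec C" for p
  proof -
    interpret K: field "K p" using p by (rule field_K)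
    define E where "E z \<longleftrightarrow> (\<exists>y\<in>?VW \<rightarrow> carrier (K p). (\<forall>v\<in>V. y v = z v) \<and> (\<exists>t\<in>carrier (K p).
      \<forall>L\<in>F. \<phi> p (c L) \<otimes>\<^bsub>K p\<^esub> t \<oplus>\<^bsub>K p\<^esub> R L p y = \<zero>\<^bsub>K p\<^esub>))" for z
    have E: "(\<exists>y\<in>V \<union> insert v W \<rightarrow> carrier (K p). (\<forall>v\<in>V. y v = z v) \<and> (\<forall>L\<in>F. L p y = \<zero>\<^bsub>K p\<^esub>)) \<longleftrightarrow> E z"
      (is "?E \<longleftrightarrow> _") for z
    proof
      assume ?E
      then obtain y where y: "y\<in>insert v ?VW \<rightarrow> carrier (K p)" "\<forall>v\<in>V. y v = z v" "\<forall>L\<in>F. L p y = \<zero>\<^bsub>K p\<^esub>"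
        by auto
      with split[OF _ p y(1)] show "E z"
        unfolding E_def by (intro bexI[of _ y] bexI[of _ "y v"] conjI) auto
    next
      assume "E z"
      then obtain y t where y: "y \<in> ?VW \<rightarrow> carrier (K p)" "\<forall>v\<in>V. y v = z v" and t: "t \<in> carrier (K p)"
        and *: "\<forall>L\<in>F. \<phi> p (c L) \<otimes>\<^bsub>K p\<^esub> t \<oplus>\<^bsub>K p\<^esub> R L p y = \<zero>\<^bsub>K p\<^esub>"
        unfolding E_def by blast
      have yt: "y(v := t) \<in> insert v ?VW \<rightarrow> carrier (K p)" using y(1) t by auto
      have "L p (y(v := t)) = \<zero>\<^bsub>K p\<^esub>" if "L \<in> F" for L
        using * that split[OF that p yt] linear_form_fun_upd[OF R[OF that] v] by simp
      moreover have "(y(v := t)) w = z w" if "w \<in> V" for w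
        using y(2) v that by auto
      moreover have "y(v := t) \<in> V \<union> insert v W \<rightarrow> carrier (K p)" using yt by simp
      ultimately show ?E by blast
    qed
    (* both sides get a name, so that only their propositional relation is left to prove *)
    define pS where "pS \<longleftrightarrow> p \<in> ?S"
    define pT where "pT \<longleftrightarrow> p \<in> ?T"
    have "pS \<longleftrightarrow> pT"
    proof (cases "\<forall>L\<in>F. \<phi> p (c L) = \<zero>\<^bsub>K p\<^esub>")
      case True
      have "E z \<longleftrightarrow> Q (R ` F) p z" for z
        unfolding E_def Q_def
      proof (intro bex_cong refl conj_cong)
        fix y assume y: "y \<in> ?VW \<rightarrow> carrier (K p)"
        have "(\<phi> p (c L) \<otimes>\<^bsub>K p\<^esub> t \<oplus>\<^bsub>K p\<^esub> R L p y = \<zero>\<^bsub>K p\<^esub>) \<longleftrightarrow> R L p y = \<zero>\<^bsub>K p\<^esub>"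
          if "L \<in> F" "t \<in> carrier (K p)" for L t
          using True that Rcl[OF that(1) p y] by simp
        then show "(\<exists>t\<in>carrier (K p). \<forall>L\<in>F. \<phi> p (c L) \<otimes>\<^bsub>K p\<^esub> t \<oplus>\<^bsub>K p\<^esub> R L p y = \<zero>\<^bsub>K p\<^esub>) \<longleftrightarrow>
            (\<forall>N\<in>R ` F. N p y = \<zero>\<^bsub>K p\<^esub>)"
          using K.zero_closed by blast
      qed
      then have "pS \<longleftrightarrow> p \<in> B (R ` F)" unfolding pS_def by (simp only: E B_def mem_Collect_eq)
      moreover have "pT \<longleftrightarrow> p \<in> B (R ` F)" unfolding pT_def using True p by blast
      ultimately show ?thesis by blast
    next
      case False
      have key: "E z \<longleftrightarrow> Q (X' L ` F) p z" if L: "L \<in> F" "\<phi> p (c L) \<noteq> \<zero>\<^bsub>K p\<^esub>" for L z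
      proof -
        have X: "X' L N p y = \<zero>\<^bsub>K p\<^esub> \<longleftrightarrow> \<phi> p (c N) \<otimes>\<^bsub>K p\<^esub> t \<oplus>\<^bsub>K p\<^esub> R N p y = \<zero>\<^bsub>K p\<^esub>"
          if "N \<in> F" "y\<in>?VW \<rightarrow> carrier (K p)" "t \<in> carrier (K p)"
            "\<phi> p (c L) \<otimes>\<^bsub>K p\<^esub> t \<oplus>\<^bsub>K p\<^esub> R L p y = \<zero>\<^bsub>K p\<^esub>" for N y t
          unfolding X'_def using that L by (intro cross_eq_zero_iff p c Rcl) auto
        show ?thesis
          unfolding E_def Q_def
        proof (intro bex_cong refl conj_cong)
          fix y assume y: "y \<in> ?VW \<rightarrow> carrier (K p)"
          obtain t where "t\<in>carrier (K p)" "\<phi> p (c L) \<otimes>\<^bsub>K p\<^esub> t \<oplus>\<^bsub>K p\<^esub> R L p y = \<zero>\<^bsub>K p\<^esub>"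
            using pivot_solution[OF p c L(2) Rcl[OF _ p y]] L(1) by blast
          with X[OF _ y] L show "(\<exists>t\<in>carrier (K p). \<forall>L\<in>F. \<phi> p (c L) \<otimes>\<^bsub>K p\<^esub> t \<oplus>\<^bsub>K p\<^esub> R L p y = \<zero>\<^bsub>K p\<^esub>) \<longleftrightarrow>
            (\<forall>N\<in>X' L ` F. N p y = \<zero>\<^bsub>K p\<^esub>)"
            by blast
        qed
      qed
      have "pS \<longleftrightarrow> p \<in> B (X' L ` F)" if "L \<in> F" "\<phi> p (c L) \<noteq> \<zero>\<^bsub>K p\<^esub>" for L
        unfolding pS_def using key[OF that] by (simp only: E B_def mem_Collect_eq)
      moreover have "pT \<longleftrightarrow> (\<exists>L\<in>F. \<phi> p (c L) \<noteq> \<zero>\<^bsub>K p\<^esub> \<and> p \<in> B (X' L ` F))"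
        unfolding pT_def using False p by blast
      ultimately show ?thesis using False by blast
    qed
    then show ?thesis unfolding pS_def pT_def .
  qed
  have "?S = ?T" using * by blast
  moreover have "B (X' L ` F) \<in> constructible_sets C" if "L \<in> F" for L
  proof -
    have "linear_form ?VW (X' L N)" if "N \<in> F" for N
      unfolding X'_def using \<open>L \<in> F\<close> that by (intro linear_form_cross c R) auto
    then show ?thesis
      unfolding B_def Q_def using insert.prems(1,2) by (intro insert.IH[of "X' L ` F"]) blast+
  qed
  moreover have "B (R ` F) \<in> constructible_sets C"
    unfolding B_def Q_def using R insert.prems(1,2) by (intro insert.IH[of "R ` F"]) blast+
  ultimately show ?case
    using insert.prems(2) c
    by (auto intro!: constructible_sets.union constructible_sets.inter constructible_UN
        constructible_Ball constructible_vanishing constructible_nonvanishing)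
qed

lemma linear_form_finsum:
  assumes "finite I" "\<And>i. i \<in> I \<Longrightarrow> linear_form V (L i)"
  shows "\<exists>M. linear_form V M \<and>
    (\<forall>p\<in>Spec C. \<forall>z\<in>V \<rightarrow> carrier (K p). M p z = (\<Oplus>\<^bsub>K p\<^esub>i\<in>I. L i p z))"
  using assms
proof (induction I rule: finite_induct)
  case empty
  show ?case
  proof (intro exI conjI ballI)
    show "linear_form V (\<lambda>p z. \<zero>\<^bsub>K p\<^esub>)" by (rule linear_form.zero)
    fix p z assume "p \<in> Spec C"
    then interpret K: field "K p" by (rule field_K)
    show "\<zero>\<^bsub>K p\<^esub> = (\<Oplus>\<^bsub>K p\<^esub>i\<in>{}. L i p z)" by simp
  qed
next
  case (insert i I)
  then obtain M where M: "linear_form V M"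
    "\<And>p z. \<lbrakk>p\<in>Spec C; z\<in>V \<rightarrow> carrier (K p)\<rbrakk> \<Longrightarrow> M p z = (\<Oplus>\<^bsub>K p\<^esub>i\<in>I. L i p z)" by auto
  show ?case
  proof (intro exI conjI ballI)
    show "linear_form V (\<lambda>p z. L i p z \<oplus>\<^bsub>K p\<^esub> M p z)"
      using M(1) insert.prems by (intro linear_form.add) simp_all
    fix p z assume p: "p \<in> Spec C" and z: "z\<in>V \<rightarrow> carrier (K p)"
    interpret K: field "K p" using p by (rule field_K)
    show "L i p z \<oplus>\<^bsub>K p\<^esub> M p z = (\<Oplus>\<^bsub>K p\<^esub>i\<in>insert i I. L i p z)"
    proof (subst K.finsum_insert)
      have cl: "L j p z \<in> carrier (K p)" if "j \<in> insert i I" for j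
        by (rule linear_form_closed[OF insert.prems[OF that] p z])
      show "(\<lambda>j. L j p z) \<in> I \<rightarrow> carrier (K p)" "L i p z \<in> carrier (K p)"
        using cl by auto
    qed (simp_all add: insert.hyps M(2)[OF p z])
  qed
qed

end

section \<open>Residue fields\<close>

context domain
begin

abbreviation frac :: "'a \<Rightarrow> 'a \<Rightarrow> ('a \<times> 'a) set" where
  "frac a b \<equiv> frac_rel R `` {(a, b)}"

lemma frac_mult_cross:
  assumes "a \<in> carrier R" "b \<in> carrier R" "c \<in> carrier R" "d \<in> carrier R" "e \<in> carrier R" "f \<in> carrier R"
    "d \<noteq> \<zero>" "a \<otimes> d = c \<otimes> b" "c \<otimes> f = e \<otimes> d"
  shows "a \<otimes> f = e \<otimes> b"
proof -
  have "d \<otimes> (a \<otimes> f) = (a \<otimes> d) \<otimes> f" using assms(1-6) by (simp add: m_ac)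
  also have "\<dots> = (c \<otimes> f) \<otimes> b" unfolding assms(8) using assms(1-6) by (simp add: m_ac)
  also have "\<dots> = d \<otimes> (e \<otimes> b)" unfolding assms(9) using assms(1-6) by (simp add: m_ac)
  finally show ?thesis using assms m_lcancel by simp
qed

lemma equiv_frac_rel: "equiv (carrier R \<times> (carrier R - {\<zero>})) (frac_rel R)"
proof (rule equivI)
  show "frac_rel R \<subseteq> (carrier R \<times> (carrier R - {\<zero>})) \<times> (carrier R \<times> (carrier R - {\<zero>}))"
    by (auto simp: frac_rel_def)
  show "refl_on (carrier R \<times> (carrier R - {\<zero>})) (frac_rel R)"
    by (auto simp: refl_on_def frac_rel_def)
  show "sym (frac_rel R)"
    by (auto simp: sym_def frac_rel_def)
  show "trans (frac_rel R)"
  proof (rule transI)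
    fix x y z assume "(x, y) \<in> frac_rel R" "(y, z) \<in> frac_rel R"
    then show "(x, z) \<in> frac_rel R"
      by (cases x; cases y; cases z) (auto simp: frac_rel_def intro: frac_mult_cross)
  qed
qed

lemma frac_eq_iff:
  assumes "a \<in> carrier R" "b \<in> carrier R - {\<zero>}" "c \<in> carrier R" "d \<in> carrier R - {\<zero>}"
  shows "frac a b = frac c d \<longleftrightarrow> a \<otimes> d = c \<otimes> b"
proof -
  have "frac a b = frac c d \<longleftrightarrow> ((a, b), (c, d)) \<in> frac_rel R"
    using assms by (intro eq_equiv_class_iff[OF equiv_frac_rel]) auto
  also have "\<dots> \<longleftrightarrow> a \<otimes> d = c \<otimes> b" using assms by (auto simp: frac_rel_def)
  finally show ?thesis .
qed

lemma frac_closed: "\<lbrakk>a \<in> carrier R; b \<in> carrier R - {\<zero>}\<rbrakk> \<Longrightarrow> frac a b \<in> carrier (Frac R)"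
  by (auto simp: Frac_def intro!: quotientI)

lemma frac_cases:
  assumes "u \<in> carrier (Frac R)"
  obtains a b where "a \<in> carrier R" "b \<in> carrier R - {\<zero>}" "u = frac a b"
  using assms by (auto simp: Frac_def elim!: quotientE)

lemma frac_memD: "(a', b') \<in> frac a b \<Longrightarrow>
   a' \<in> carrier R \<and> b' \<in> carrier R - {\<zero>} \<and> a \<otimes> b' = a' \<otimes> b"
  by (auto simp: frac_rel_def)

lemma frac_self: "\<lbrakk>a \<in> carrier R; b \<in> carrier R - {\<zero>}\<rbrakk> \<Longrightarrow> (a, b) \<in> frac a b"
  by (auto simp: frac_rel_def)

lemma denominators_mult: "\<lbrakk>b \<in> carrier R - {\<zero>}; d \<in> carrier R - {\<zero>}\<rbrakk> \<Longrightarrow> b \<otimes> d \<in> carrier R - {\<zero>}"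
  using integral_iff by auto

text \<open>
  The operations of \<^const>\<open>Frac\<close> are unions over all representatives; they collapse as soon as the
  result does not depend on the representatives.
\<close>

lemma frac_UN:
  assumes ab: "a \<in> carrier R" "b \<in> carrier R - {\<zero>}" and cd: "c \<in> carrier R" "d \<in> carrier R - {\<zero>}"
    and H: "\<And>a' b' c' d'. \<lbrakk>(a', b') \<in> frac a b; (c', d') \<in> frac c d\<rbrakk> \<Longrightarrow> H a' b' c' d' = H a b c d"
  shows "(\<Union>(a, b)\<in>frac a b. \<Union>(c, d)\<in>frac c d. H a b c d) = H a b c d"
proof (intro equalityI subsetI)
  fix x assume "x \<in> (\<Union>(a, b)\<in>frac a b. \<Union>(c, d)\<in>frac c d. H a b c d)"
  then obtain a' b' c' d' where "(a', b') \<in> frac a b" "(c', d') \<in> frac c d" "x \<in> H a' b' c' d'"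
    by blast
  with H show "x \<in> H a b c d" by metis
next
  fix x assume "x \<in> H a b c d"
  with frac_self[OF ab] frac_self[OF cd]
  show "x \<in> (\<Union>(a, b)\<in>frac a b. \<Union>(c, d)\<in>frac c d. H a b c d)" by blast
qed

lemma frac_mult:
  assumes "a \<in> carrier R" "b \<in> carrier R - {\<zero>}" "c \<in> carrier R" "d \<in> carrier R - {\<zero>}"
  shows "frac a b \<otimes>\<^bsub>Frac R\<^esub> frac c d = frac (a \<otimes> c) (b \<otimes> d)"
proof -
  have "frac (a' \<otimes> c') (b' \<otimes> d') = frac (a \<otimes> c) (b \<otimes> d)"
    if "(a', b') \<in> frac a b" "(c', d') \<in> frac c d" for a' b' c' d'
  proof -
    have 1: "a' \<in> carrier R" "b' \<in> carrier R - {\<zero>}" "c' \<in> carrier R" "d' \<in> carrier R - {\<zero>}"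
      "a \<otimes> b' = a' \<otimes> b" "c \<otimes> d' = c' \<otimes> d" using that[THEN frac_memD] by auto
    have "(a' \<otimes> c') \<otimes> (b \<otimes> d) = (a' \<otimes> b) \<otimes> (c' \<otimes> d)" using assms 1 by (simp add: m_ac)
    also have "\<dots> = (a \<otimes> c) \<otimes> (b' \<otimes> d')"
      unfolding 1(5,6)[symmetric] using assms 1(1-4) by (simp add: m_ac)
    finally show ?thesis
      using assms 1(1-4) denominators_mult by (subst frac_eq_iff) auto
  qed
  with frac_UN[OF assms, of "\<lambda>a b c d. frac (a \<otimes> c) (b \<otimes> d)"] show ?thesis
    by (simp add: Frac_def)
qed

lemma frac_add:
  assumes "a \<in> carrier R" "b \<in> carrier R - {\<zero>}" "c \<in> carrier R" "d \<in> carrier R - {\<zero>}"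
  shows "frac a b \<oplus>\<^bsub>Frac R\<^esub> frac c d = frac (a \<otimes> d \<oplus> c \<otimes> b) (b \<otimes> d)"
proof -
  have "frac (a' \<otimes> d' \<oplus> c' \<otimes> b') (b' \<otimes> d') = frac (a \<otimes> d \<oplus> c \<otimes> b) (b \<otimes> d)"
    if "(a', b') \<in> frac a b" "(c', d') \<in> frac c d" for a' b' c' d'
  proof -
    have 1: "a' \<in> carrier R" "b' \<in> carrier R - {\<zero>}" "c' \<in> carrier R" "d' \<in> carrier R - {\<zero>}"
      "a \<otimes> b' = a' \<otimes> b" "c \<otimes> d' = c' \<otimes> d" using that[THEN frac_memD] by auto
    have "(a' \<otimes> d' \<oplus> c' \<otimes> b') \<otimes> (b \<otimes> d) = (a' \<otimes> b) \<otimes> (d \<otimes> d') \<oplus> (c' \<otimes> d) \<otimes> (b \<otimes> b')"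
      using assms 1(1-4) by (simp add: l_distr r_distr m_ac)
    also have "\<dots> = (a \<otimes> d \<oplus> c \<otimes> b) \<otimes> (b' \<otimes> d')"
      unfolding 1(5,6)[symmetric] using assms 1(1-4) by (simp add: l_distr r_distr m_ac)
    finally show ?thesis
      using assms 1(1-4) denominators_mult by (subst frac_eq_iff) auto
  qed
  with frac_UN[OF assms, of "\<lambda>a b c d. frac (a \<otimes> d \<oplus> c \<otimes> b) (b \<otimes> d)"] show ?thesis
    by (simp add: Frac_def)
qed

lemma Frac_one: "\<one>\<^bsub>Frac R\<^esub> = frac \<one> \<one>" and Frac_zero: "\<zero>\<^bsub>Frac R\<^esub> = frac \<zero> \<one>"
  by (simp_all add: Frac_def)

lemma cring_Frac: "cring (Frac R)"
proof (rule cringI)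
  note [simp] = frac_mult frac_add Frac_one Frac_zero frac_eq_iff
  have nz [simp]: "b \<otimes> d \<noteq> \<zero>" if "b \<in> carrier R" "b \<noteq> \<zero>" "d \<in> carrier R" "d \<noteq> \<zero>" for b d
    using that integral_iff by auto
  show "abelian_group (Frac R)"
  proof (rule abelian_groupI)
    fix x y assume "x \<in> carrier (Frac R)" "y \<in> carrier (Frac R)"
    then show "x \<oplus>\<^bsub>Frac R\<^esub> y \<in> carrier (Frac R)"
      by (elim frac_cases) (auto intro!: frac_closed)
  next
    show "\<zero>\<^bsub>Frac R\<^esub> \<in> carrier (Frac R)" by (auto intro!: frac_closed)
  next
    fix x y z assume "x \<in> carrier (Frac R)" "y \<in> carrier (Frac R)" "z \<in> carrier (Frac R)"
    then show "x \<oplus>\<^bsub>Frac R\<^esub> y \<oplus>\<^bsub>Frac R\<^esub> z = x \<oplus>\<^bsub>Frac R\<^esub> (y \<oplus>\<^bsub>Frac R\<^esub> z)"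
      by (elim frac_cases) (simp add: l_distr r_distr m_ac a_ac)
  next
    fix x y assume "x \<in> carrier (Frac R)" "y \<in> carrier (Frac R)"
    then show "x \<oplus>\<^bsub>Frac R\<^esub> y = y \<oplus>\<^bsub>Frac R\<^esub> x"
      by (elim frac_cases) (simp add: m_ac a_ac)
  next
    fix x assume "x \<in> carrier (Frac R)"
    then show "\<zero>\<^bsub>Frac R\<^esub> \<oplus>\<^bsub>Frac R\<^esub> x = x"
      by (elim frac_cases) (simp add: m_ac)
  next
    fix x assume "x \<in> carrier (Frac R)"
    then obtain a b where ab: "a \<in> carrier R" "b \<in> carrier R - {\<zero>}" and x: "x = frac a b" by (rule frac_cases)
    then show "\<exists>y\<in>carrier (Frac R). y \<oplus>\<^bsub>Frac R\<^esub> x = \<zero>\<^bsub>Frac R\<^esub>"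
      by (intro bexI[of _ "frac (\<ominus> a) b"]) (auto simp: l_minus l_neg intro!: frac_closed)
  qed
  show "comm_monoid (Frac R)"
  proof (rule comm_monoidI)
    fix x y assume "x \<in> carrier (Frac R)" "y \<in> carrier (Frac R)"
    then show "x \<otimes>\<^bsub>Frac R\<^esub> y \<in> carrier (Frac R)"
      by (elim frac_cases) (auto intro!: frac_closed)
  next
    show "\<one>\<^bsub>Frac R\<^esub> \<in> carrier (Frac R)" by (auto intro!: frac_closed)
  next
    fix x y z assume "x \<in> carrier (Frac R)" "y \<in> carrier (Frac R)" "z \<in> carrier (Frac R)"
    then show "x \<otimes>\<^bsub>Frac R\<^esub> y \<otimes>\<^bsub>Frac R\<^esub> z = x \<otimes>\<^bsub>Frac R\<^esub> (y \<otimes>\<^bsub>Frac R\<^esub> z)"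
      by (elim frac_cases) (simp add: m_ac)
  next
    fix x assume "x \<in> carrier (Frac R)"
    then show "\<one>\<^bsub>Frac R\<^esub> \<otimes>\<^bsub>Frac R\<^esub> x = x"
      by (elim frac_cases) (simp add: m_ac)
  next
    fix x y assume "x \<in> carrier (Frac R)" "y \<in> carrier (Frac R)"
    then show "x \<otimes>\<^bsub>Frac R\<^esub> y = y \<otimes>\<^bsub>Frac R\<^esub> x"
      by (elim frac_cases) (simp add: m_ac)
  qed
  fix x y z assume "x \<in> carrier (Frac R)" "y \<in> carrier (Frac R)" "z \<in> carrier (Frac R)"
  then show "(x \<oplus>\<^bsub>Frac R\<^esub> y) \<otimes>\<^bsub>Frac R\<^esub> z = x \<otimes>\<^bsub>Frac R\<^esub> z \<oplus>\<^bsub>Frac R\<^esub> y \<otimes>\<^bsub>Frac R\<^esub> z"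
    by (elim frac_cases) (simp add: l_distr r_distr m_ac)
qed

lemma frac_one_eq_zero_iff: "a \<in> carrier R \<Longrightarrow> frac a \<one> = \<zero>\<^bsub>Frac R\<^esub> \<longleftrightarrow> a = \<zero>"
  by (simp add: Frac_zero frac_eq_iff)

lemma field_Frac: "field (Frac R)"
proof -
  interpret F: cring "Frac R" by (rule cring_Frac)
  show ?thesis
  proof (rule F.cring_fieldI2)
    show "\<zero>\<^bsub>Frac R\<^esub> \<noteq> \<one>\<^bsub>Frac R\<^esub>"
      using frac_one_eq_zero_iff[of \<one>] by (simp add: Frac_one)
    fix u assume u: "u \<in> carrier (Frac R)" "u \<noteq> \<zero>\<^bsub>Frac R\<^esub>"
    from u(1) obtain a b where ab: "a \<in> carrier R" "b \<in> carrier R - {\<zero>}" "u = frac a b" by (rule frac_cases)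
    then have "a \<noteq> \<zero>" using u(2) by (auto simp: Frac_zero frac_eq_iff)
    with ab denominators_mult show "\<exists>v\<in>carrier (Frac R). u \<otimes>\<^bsub>Frac R\<^esub> v = \<one>\<^bsub>Frac R\<^esub>"
      by (intro bexI[of _ "frac b a"]) (auto simp: frac_mult Frac_one frac_eq_iff m_comm intro!: frac_closed)
  qed
qed

lemma frac_one_hom: "(\<lambda>a. frac a \<one>) \<in> ring_hom R (Frac R)"
  by (rule ring_hom_memI) (auto simp: frac_mult frac_add Frac_one intro!: frac_closed)

end

text \<open>
  The canonical map from \<open>C\<close> to the residue field at \<open>p\<close>.
\<close>

definition residue_map :: "('c, 's) ring_scheme \<Rightarrow> 'c set \<Rightarrow> 'c \<Rightarrow> ('c set \<times> 'c set) set" where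
  "residue_map C p c = frac_rel (C Quot p) `` {(p +>\<^bsub>C\<^esub> c, \<one>\<^bsub>C Quot p\<^esub>)}"

context
  fixes C :: "('c, 's) ring_scheme" and p
  assumes p: "primeideal p C"
begin

interpretation primeideal p C by (rule p)
interpretation D: domain "C Quot p" by (rule quotient_is_domain)

lemma field_residue: "field (Frac (C Quot p))"
  by (rule D.field_Frac)

lemma residue_map_hom: "residue_map C p \<in> ring_hom C (Frac (C Quot p))"
  using ring_hom_trans[OF rcos_ring_hom D.frac_one_hom]
  by (simp add: residue_map_def[abs_def] comp_def)

lemma residue_map_eq_zero_iff:
  assumes "c \<in> carrier C"
  shows "residue_map C p c = \<zero>\<^bsub>Frac (C Quot p)\<^esub> \<longleftrightarrow> c \<in> p"
proof -
  have "p +>\<^bsub>C\<^esub> c \<in> carrier (C Quot p)" using assms by (auto simp: FactRing_def A_RCOSETS_def')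
  then have "residue_map C p c = \<zero>\<^bsub>Frac (C Quot p)\<^esub> \<longleftrightarrow> p +>\<^bsub>C\<^esub> c = \<zero>\<^bsub>C Quot p\<^esub>"
    unfolding residue_map_def by (rule D.frac_one_eq_zero_iff)
  also have "\<dots> \<longleftrightarrow> p +>\<^bsub>C\<^esub> c = p" by (simp add: FactRing_def)
  also have "\<dots> \<longleftrightarrow> c \<in> p"
    using rcos_const_imp_mem[OF assms] a_rcos_const by blast
  finally show ?thesis .
qed

end

section \<open>Cardinality\<close>

lemma infinite_times_self_lepoll: "infinite M \<Longrightarrow> lepoll (M \<times> M) M"
  using card_of_Times_same_infinite[of M] eqpoll_iff_card_of_ordIso eqpoll_imp_lepoll by blast

lemma times_lepoll_infinite: "\<lbrakk>infinite M; lepoll A M; lepoll B M\<rbrakk> \<Longrightarrow> lepoll (A \<times> B) M"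
  using times_lepoll_mono infinite_times_self_lepoll lepoll_trans by blast

text \<open>
  Everything built below from an infinite universe \<open>M\<close> in finitely many steps is coded by finite
  subsets of sets no larger than \<open>M\<close>, hence embeds in \<open>M\<close>.
\<close>

lemma Fpow_lepoll_infinite:
  assumes "infinite M" "lepoll A M"
  shows "lepoll (Fpow A) M"
proof -
  from assms(2) obtain f where f: "inj_on f A" "f ` A \<subseteq> M" by (auto simp: lepoll_def)
  have "lepoll (Fpow A) (Fpow M)"
    using inj_on_image_Fpow[OF f(1)] image_Fpow_mono[OF f(2)] unfolding lepoll_def by blast
  also have "eqpoll \<dots> M" using assms(1) by (rule eqpoll_Fpow)
  finally show ?thesis .
qed

lemma poly_mapping_lepoll_infinite:
  assumes "infinite M" "lepoll (UNIV :: 'x set) M" "lepoll (UNIV :: 'y::zero set) M"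
  shows "lepoll (UNIV :: ('x \<Rightarrow>\<^sub>0 'y) set) M"
proof -
  have "lepoll (UNIV :: ('x \<Rightarrow>\<^sub>0 'y) set) ({f :: 'x \<Rightarrow> 'y. f ` UNIV \<subseteq> UNIV \<and> {x. f x \<noteq> 0} \<subseteq> UNIV \<and> finite {x. f x \<noteq> 0}})"
    unfolding lepoll_def
    by (rule exI[of _ Poly_Mapping.lookup]) (auto intro: inj_onI poly_mapping_eqI)
  also have "lepoll \<dots> (Fpow ((UNIV :: 'x set) \<times> (UNIV :: 'y set)))"
    by (rule lepoll_restricted_funspace)
  also have "lepoll \<dots> M"
    using assms by (intro Fpow_lepoll_infinite times_lepoll_infinite)
  finally show ?thesis .
qed

lemma PiE_lepoll_infinite:
  assumes "infinite M" "lepoll A M"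
  shows "lepoll ({..<n::nat} \<rightarrow>\<^sub>E A) M"
proof -
  have "inj_on (\<lambda>f. (\<lambda>i. (i, f i)) ` {..<n}) ({..<n} \<rightarrow>\<^sub>E A)"
  proof (rule inj_onI)
    fix f g assume f: "f \<in> {..<n} \<rightarrow>\<^sub>E A" and g: "g \<in> {..<n} \<rightarrow>\<^sub>E A"
      and eq: "(\<lambda>i. (i, f i)) ` {..<n} = (\<lambda>i. (i, g i)) ` {..<n}"
    have "f i = g i" if "i \<in> {..<n}" for i
    proof -
      have "(i, f i) \<in> (\<lambda>i. (i, g i)) ` {..<n}" unfolding eq[symmetric] using that by (rule imageI)
      then show ?thesis by auto
    qed
    then show "f = g" by (rule PiE_ext[OF f g])
  qed
  moreover have "(\<lambda>f. (\<lambda>i. (i, f i)) ` {..<n}) ` ({..<n} \<rightarrow>\<^sub>E A) \<subseteq> Fpow ((UNIV :: nat set) \<times> A)"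
    by (auto simp: Fpow_def)
  ultimately have "lepoll ({..<n} \<rightarrow>\<^sub>E A) (Fpow ((UNIV :: nat set) \<times> A))"
    unfolding lepoll_def by blast
  also have "lepoll \<dots> M"
    using assms infinite_le_lepoll by (intro Fpow_lepoll_infinite times_lepoll_infinite) blast+
  finally show ?thesis .
qed

lemma entry_poly_lepoll:
  fixes \<iota> :: "'k::field \<Rightarrow> 'm"
  assumes "infinite (UNIV :: 'm set)" "inj \<iota>"
  shows "lepoll (UNIV :: 'k entry_poly set) (UNIV :: 'm set)"
proof -
  have nat: "lepoll (UNIV :: nat set) (UNIV :: 'm set)"
    using assms(1) infinite_le_lepoll by blast
  have "lepoll (UNIV :: (nat \<times> nat \<times> nat) set) (UNIV :: 'm set)"
    using times_lepoll_infinite[OF assms(1) nat times_lepoll_infinite[OF assms(1) nat nat]] by simp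
  moreover have "lepoll (UNIV :: 'k set) (UNIV :: 'm set)"
    using assms(2) by (auto simp: lepoll_def)
  ultimately show ?thesis
    using nat assms(1) by (intro poly_mapping_lepoll_infinite) auto
qed

lemma carrier_FactRing: "carrier (R Quot I) = (\<lambda>a. I +>\<^bsub>R\<^esub> a) ` carrier R"
  by (auto simp: FactRing_def A_RCOSETS_def')

lemma carrier_FactRing_lepoll: "lepoll (carrier (R Quot I)) (carrier R)"
  unfolding carrier_FactRing by (rule image_lepoll)

lemma carrier_Frac_lepoll: "lepoll (carrier (Frac D)) (carrier D \<times> carrier D)"
proof (rule subset_image_lepoll)
  show "carrier (Frac D) \<subseteq> (\<lambda>x. frac_rel D `` {x}) ` (carrier D \<times> carrier D)"
    by (auto simp: Frac_def quotient_def)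
qed

section \<open>Modules, presentations and vanishing of functors\<close>

lemma (in abelian_monoid) finsum_swap:
  assumes "finite I" "finite J" "\<And>i j. \<lbrakk>i \<in> I; j \<in> J\<rbrakk> \<Longrightarrow> f i j \<in> carrier G"
  shows "(\<Oplus>i\<in>I. \<Oplus>j\<in>J. f i j) = (\<Oplus>j\<in>J. \<Oplus>i\<in>I. f i j)"
  using assms(1,3)
proof (induction I rule: finite_induct)
  case empty
  then show ?case by simp
next
  case (insert i I)
  have 1: "(\<lambda>j. f i j) \<in> J \<rightarrow> carrier G" and 2: "(\<lambda>j. \<Oplus>i\<in>I. f i j) \<in> J \<rightarrow> carrier G"
    and 3: "(\<lambda>i. \<Oplus>j\<in>J. f i j) \<in> I \<rightarrow> carrier G"
    using insert.prems by (auto intro!: finsum_closed)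
  have "(\<Oplus>i\<in>insert i I. \<Oplus>j\<in>J. f i j) = (\<Oplus>j\<in>J. f i j) \<oplus> (\<Oplus>j\<in>J. \<Oplus>i\<in>I. f i j)"
    using insert 1 3 by (subst finsum_insert) auto
  also have "\<dots> = (\<Oplus>j\<in>J. f i j \<oplus> (\<Oplus>i\<in>I. f i j))"
    by (rule finsum_addf[symmetric, OF 1 2])
  also have "\<dots> = (\<Oplus>j\<in>J. \<Oplus>i\<in>insert i I. f i j)"
    using insert.hyps insert.prems by (intro finsum_cong') (auto simp: Pi_iff)
  finally show ?case .
qed

lemma finsum_pointwise:
  assumes "abelian_monoid Q" "abelian_monoid N"
    and Q: "carrier Q = S \<rightarrow>\<^sub>E carrier N" "\<zero>\<^bsub>Q\<^esub> = (\<lambda>s\<in>S. \<zero>\<^bsub>N\<^esub>)"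
      "\<And>u v. u \<oplus>\<^bsub>Q\<^esub> v = (\<lambda>s\<in>S. u s \<oplus>\<^bsub>N\<^esub> v s)"
    and "finite I" "u \<in> I \<rightarrow> carrier Q"
  shows "(\<Oplus>\<^bsub>Q\<^esub>i\<in>I. u i) = (\<lambda>s\<in>S. \<Oplus>\<^bsub>N\<^esub>i\<in>I. u i s)"
proof -
  interpret Q: abelian_monoid Q by fact
  interpret N: abelian_monoid N by fact
  show ?thesis using assms(6,7)
  proof (induction I rule: finite_induct)
    case empty
    then show ?case by (simp add: Q(2))
  next
    case (insert i I)
    have cl: "u k s \<in> carrier N" if "k \<in> insert i I" "s \<in> S" for k s
      using insert.prems that by (auto simp: Q(1))
    have u: "u i \<in> carrier Q" "u \<in> I \<rightarrow> carrier Q" using insert.prems by auto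
    have "(\<Oplus>\<^bsub>Q\<^esub>i\<in>insert i I. u i) = u i \<oplus>\<^bsub>Q\<^esub> (\<lambda>s\<in>S. \<Oplus>\<^bsub>N\<^esub>i\<in>I. u i s)"
      using insert.IH[OF u(2)] insert.hyps u by (simp del: restrict_apply)
    also have "\<dots> = (\<lambda>s\<in>S. \<Oplus>\<^bsub>N\<^esub>i\<in>insert i I. u i s)"
      unfolding Q(3)
    proof (rule restrict_ext)
      fix s assume s: "s \<in> S"
      then show "u i s \<oplus>\<^bsub>N\<^esub> (\<lambda>s\<in>S. \<Oplus>\<^bsub>N\<^esub>i\<in>I. u i s) s = (\<Oplus>\<^bsub>N\<^esub>i\<in>insert i I. u i s)"
        using insert.hyps cl[OF _ s] by (subst N.finsum_insert) auto
    qed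
    finally show ?case .
  qed
qed

definition lincomb :: "('a, 'u, 'e) module_scheme \<Rightarrow> 'i set \<Rightarrow> ('i \<Rightarrow> 'a) \<Rightarrow> ('i \<Rightarrow> 'u) \<Rightarrow> 'u" where
  "lincomb M I c z = (\<Oplus>\<^bsub>M\<^esub>i\<in>I. c i \<odot>\<^bsub>M\<^esub> z i)"

context left_module
begin

lemma smult_zero_right: "a \<in> carrier R \<Longrightarrow> a \<odot> \<zero> = \<zero>"
  using smult_r_distr[of a \<zero> \<zero>] smult_closed[of a \<zero>]
  by (metis M.add.l_cancel_one' M.l_zero M.zero_closed)

lemma smult_zero_left: "x \<in> carrier M \<Longrightarrow> \<zero>\<^bsub>R\<^esub> \<odot> x = \<zero>"
  using smult_l_distr[of "\<zero>\<^bsub>R\<^esub>" "\<zero>\<^bsub>R\<^esub>" x] smult_closed[of "\<zero>\<^bsub>R\<^esub>" x]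
  by (metis M.add.l_cancel_one' R.l_zero R.zero_closed)

lemma smult_finsum_left:
  assumes "finite I" "f \<in> I \<rightarrow> carrier R" "x \<in> carrier M"
  shows "(\<Oplus>\<^bsub>R\<^esub>i\<in>I. f i) \<odot> x = (\<Oplus>i\<in>I. f i \<odot> x)"
  using assms(1,2)
proof (induction I rule: finite_induct)
  case (insert i I)
  then have "f i \<in> carrier R" "(\<Oplus>\<^bsub>R\<^esub>i\<in>I. f i) \<in> carrier R" "f \<in> I \<rightarrow> carrier R"
    by (auto intro: R.finsum_closed)
  with insert assms(3) show ?case
    by (simp add: smult_l_distr smult_closed Pi_iff)
qed (simp add: smult_zero_left assms(3))

lemma smult_finsum_right:
  assumes "finite I" "f \<in> I \<rightarrow> carrier M" "a \<in> carrier R"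
  shows "a \<odot> (\<Oplus>i\<in>I. f i) = (\<Oplus>i\<in>I. a \<odot> f i)"
  using assms(1,2)
proof (induction I rule: finite_induct)
  case (insert i I)
  then have "f i \<in> carrier M" "(\<Oplus>i\<in>I. f i) \<in> carrier M" "f \<in> I \<rightarrow> carrier M"
    by (auto intro: M.finsum_closed)
  with insert assms(3) show ?case
    by (simp add: smult_r_distr smult_closed Pi_iff)
qed (simp add: smult_zero_right assms(3))

lemma lincomb_closed:
  "\<lbrakk>c \<in> I \<rightarrow> carrier R; z \<in> I \<rightarrow> carrier M\<rbrakk> \<Longrightarrow> lincomb M I c z \<in> carrier M"
  unfolding lincomb_def by (rule M.finsum_closed) (auto intro: smult_closed)

lemma lincomb_cong:
  "\<lbrakk>c \<in> I \<rightarrow> carrier R; z \<in> I \<rightarrow> carrier M; \<And>i. i \<in> I \<Longrightarrow> c i = c' i; \<And>i. i \<in> I \<Longrightarrow> z i = z' i\<rbrakk> \<Longrightarrow>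
    lincomb M I c z = lincomb M I c' z'"
  unfolding lincomb_def by (rule M.finsum_cong') (auto simp: Pi_iff intro!: smult_closed)

lemma lincomb_add:
  assumes "c \<in> I \<rightarrow> carrier R" "c' \<in> I \<rightarrow> carrier R" "z \<in> I \<rightarrow> carrier M"
  shows "lincomb M I (\<lambda>i. c i \<oplus>\<^bsub>R\<^esub> c' i) z = lincomb M I c z \<oplus> lincomb M I c' z"
proof -
  have "lincomb M I (\<lambda>i. c i \<oplus>\<^bsub>R\<^esub> c' i) z = (\<Oplus>i\<in>I. c i \<odot> z i \<oplus> c' i \<odot> z i)"
    unfolding lincomb_def using assms
    by (intro M.finsum_cong') (auto simp: Pi_iff smult_l_distr intro!: smult_closed)
  also have "\<dots> = lincomb M I c z \<oplus> lincomb M I c' z"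
    unfolding lincomb_def using assms by (intro M.finsum_addf) (auto intro: smult_closed)
  finally show ?thesis .
qed

lemma lincomb_add_right:
  assumes "c \<in> I \<rightarrow> carrier R" "z \<in> I \<rightarrow> carrier M" "z' \<in> I \<rightarrow> carrier M"
  shows "lincomb M I c (\<lambda>i. z i \<oplus> z' i) = lincomb M I c z \<oplus> lincomb M I c z'"
proof -
  have "lincomb M I c (\<lambda>i. z i \<oplus> z' i) = (\<Oplus>i\<in>I. c i \<odot> z i \<oplus> c i \<odot> z' i)"
    unfolding lincomb_def using assms
    by (intro M.finsum_cong') (auto simp: Pi_iff smult_r_distr intro!: smult_closed)
  also have "\<dots> = lincomb M I c z \<oplus> lincomb M I c z'"
    unfolding lincomb_def using assms by (intro M.finsum_addf) (auto intro: smult_closed)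
  finally show ?thesis .
qed

lemma lincomb_unit:
  assumes "finite I" "j \<in> I" "z \<in> I \<rightarrow> carrier M"
  shows "lincomb M I (\<lambda>i. if j = i then \<one>\<^bsub>R\<^esub> else \<zero>\<^bsub>R\<^esub>) z = z j"
proof -
  have "lincomb M I (\<lambda>i. if j = i then \<one>\<^bsub>R\<^esub> else \<zero>\<^bsub>R\<^esub>) z = (\<Oplus>i\<in>I. if j = i then z i else \<zero>)"
    unfolding lincomb_def using assms
    by (intro M.finsum_cong') (auto simp: Pi_iff smult_one smult_zero_left)
  also have "\<dots> = z j" using assms by (intro M.add.finprod_singleton) auto
  finally show ?thesis .
qed

lemma lincomb_smult:
  assumes "finite I" "a \<in> carrier R" "c \<in> I \<rightarrow> carrier R" "z \<in> I \<rightarrow> carrier M"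
  shows "lincomb M I (\<lambda>i. a \<otimes>\<^bsub>R\<^esub> c i) z = a \<odot> lincomb M I c z"
proof -
  have "lincomb M I (\<lambda>i. a \<otimes>\<^bsub>R\<^esub> c i) z = (\<Oplus>i\<in>I. a \<odot> (c i \<odot> z i))"
    unfolding lincomb_def using assms
    by (intro M.finsum_cong') (auto simp: Pi_iff smult_assoc intro!: smult_closed)
  also have "\<dots> = a \<odot> lincomb M I c z"
    unfolding lincomb_def using assms by (intro smult_finsum_right[symmetric]) (auto intro: smult_closed)
  finally show ?thesis .
qed

lemma lincomb_finsum:
  assumes "finite I" "finite J" "\<And>i j. \<lbrakk>i \<in> I; j \<in> J\<rbrakk> \<Longrightarrow> r i j \<in> carrier R"
    and d: "d \<in> I \<rightarrow> carrier R" and z: "z \<in> J \<rightarrow> carrier M"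
  shows "lincomb M J (\<lambda>j. \<Oplus>\<^bsub>R\<^esub>i\<in>I. d i \<otimes>\<^bsub>R\<^esub> r i j) z = lincomb M I d (\<lambda>i. lincomb M J (r i) z)"
proof -
  have di: "d i \<in> carrier R" if "i \<in> I" for i using d that by auto
  have zj: "z j \<in> carrier M" if "j \<in> J" for j using z that by auto
  note cl = di zj assms(3)
  have "lincomb M J (\<lambda>j. \<Oplus>\<^bsub>R\<^esub>i\<in>I. d i \<otimes>\<^bsub>R\<^esub> r i j) z = (\<Oplus>j\<in>J. \<Oplus>i\<in>I. d i \<odot> (r i j \<odot> z j))"
    unfolding lincomb_def
  proof (rule M.finsum_cong')
    fix j assume j: "j \<in> J"
    have "(\<Oplus>\<^bsub>R\<^esub>i\<in>I. d i \<otimes>\<^bsub>R\<^esub> r i j) \<odot> z j = (\<Oplus>i\<in>I. (d i \<otimes>\<^bsub>R\<^esub> r i j) \<odot> z j)"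
      using assms j by (intro smult_finsum_left) auto
    also have "\<dots> = (\<Oplus>i\<in>I. d i \<odot> (r i j \<odot> z j))"
      using cl j by (intro M.finsum_cong') (auto simp: smult_assoc smult_closed)
    finally show "(\<Oplus>\<^bsub>R\<^esub>i\<in>I. d i \<otimes>\<^bsub>R\<^esub> r i j) \<odot> z j = (\<Oplus>i\<in>I. d i \<odot> (r i j \<odot> z j))" .
  qed (use cl in \<open>auto intro!: M.finsum_closed smult_closed\<close>)
  also have "\<dots> = (\<Oplus>i\<in>I. \<Oplus>j\<in>J. d i \<odot> (r i j \<odot> z j))"
    using assms(1,2) cl by (intro M.finsum_swap) (auto intro!: smult_closed)
  also have "\<dots> = lincomb M I d (\<lambda>i. lincomb M J (r i) z)"
    unfolding lincomb_def
    using assms(2) cl by (intro M.finsum_cong') (auto intro!: smult_finsum_right[symmetric] M.finsum_closed smult_closed)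
  finally show ?thesis .
qed

end

lemma lin_mapsD:
  assumes "f \<in> lin_maps A V W"
  shows "f \<in> carrier V \<rightarrow>\<^sub>E carrier W" "x \<in> carrier V \<Longrightarrow> f x \<in> carrier W"
    "\<lbrakk>x \<in> carrier V; y \<in> carrier V\<rbrakk> \<Longrightarrow> f (x \<oplus>\<^bsub>V\<^esub> y) = f x \<oplus>\<^bsub>W\<^esub> f y"
    "\<lbrakk>a \<in> carrier A; x \<in> carrier V\<rbrakk> \<Longrightarrow> f (a \<odot>\<^bsub>V\<^esub> x) = a \<odot>\<^bsub>W\<^esub> f x"
  using assms unfolding lin_maps_def by auto

lemma lin_mapsI:
  assumes "f \<in> carrier V \<rightarrow>\<^sub>E carrier W"
    "\<And>x y. \<lbrakk>x \<in> carrier V; y \<in> carrier V\<rbrakk> \<Longrightarrow> f (x \<oplus>\<^bsub>V\<^esub> y) = f x \<oplus>\<^bsub>W\<^esub> f y"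
    "\<And>a x. \<lbrakk>a \<in> carrier A; x \<in> carrier V\<rbrakk> \<Longrightarrow> f (a \<odot>\<^bsub>V\<^esub> x) = a \<odot>\<^bsub>W\<^esub> f x"
  shows "f \<in> lin_maps A V W"
  using assms unfolding lin_maps_def by auto

lemma lin_map_zero:
  assumes "left_module A V" "left_module A W" "f \<in> lin_maps A V W"
  shows "f \<zero>\<^bsub>V\<^esub> = \<zero>\<^bsub>W\<^esub>"
proof -
  interpret V: left_module A V by fact
  interpret W: left_module A W by fact
  have "f \<zero>\<^bsub>V\<^esub> \<oplus>\<^bsub>W\<^esub> f \<zero>\<^bsub>V\<^esub> = f \<zero>\<^bsub>V\<^esub>"
    using lin_mapsD(3)[OF assms(3), of "\<zero>\<^bsub>V\<^esub>" "\<zero>\<^bsub>V\<^esub>"] by simp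
  then show ?thesis using lin_mapsD(2)[OF assms(3) V.M.zero_closed] W.M.add.l_cancel_one' by metis
qed

lemma lin_map_lincomb:
  assumes "left_module A V" "left_module A W" "f \<in> lin_maps A V W"
    and "finite I" "c \<in> I \<rightarrow> carrier A" "z \<in> I \<rightarrow> carrier V"
  shows "f (lincomb V I c z) = lincomb W I c (\<lambda>i. f (z i))"
proof -
  interpret V: left_module A V by fact
  interpret W: left_module A W by fact
  note f = lin_mapsD[OF assms(3)]
  show ?thesis unfolding lincomb_def using assms(4-)
  proof (induction I rule: finite_induct)
    case empty
    then show ?case by (simp add: lin_map_zero[OF assms(1-3)])
  next
    case (insert i I)
    then have cl: "c i \<in> carrier A" "z i \<in> carrier V" "c \<in> I \<rightarrow> carrier A" "z \<in> I \<rightarrow> carrier V" by auto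
    have 1: "(\<lambda>i. c i \<odot>\<^bsub>V\<^esub> z i) \<in> I \<rightarrow> carrier V" "(\<lambda>i. c i \<odot>\<^bsub>W\<^esub> f (z i)) \<in> I \<rightarrow> carrier W"
      using cl f(2) by (auto intro!: V.smult_closed W.smult_closed)
    have "f (\<Oplus>\<^bsub>V\<^esub>i\<in>insert i I. c i \<odot>\<^bsub>V\<^esub> z i) = f (c i \<odot>\<^bsub>V\<^esub> z i \<oplus>\<^bsub>V\<^esub> (\<Oplus>\<^bsub>V\<^esub>i\<in>I. c i \<odot>\<^bsub>V\<^esub> z i))"
      using insert.hyps 1 cl by (subst V.M.finsum_insert) (auto intro: V.smult_closed)
    also have "\<dots> = c i \<odot>\<^bsub>W\<^esub> f (z i) \<oplus>\<^bsub>W\<^esub> (\<Oplus>\<^bsub>W\<^esub>i\<in>I. c i \<odot>\<^bsub>W\<^esub> f (z i))"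
      using insert.IH[OF cl(3,4)] cl V.M.finsum_closed[OF 1(1)] by (simp add: f V.smult_closed)
    also have "\<dots> = (\<Oplus>\<^bsub>W\<^esub>i\<in>insert i I. c i \<odot>\<^bsub>W\<^esub> f (z i))"
      using insert.hyps 1 cl f(2) by (subst W.M.finsum_insert) (auto intro: W.smult_closed)
    finally show ?case .
  qed
qed

lemma lin_maps_compose:
  assumes f: "f \<in> lin_maps A U V" and g: "g \<in> lin_maps A V W" and U: "left_module A U"
  shows "compose (carrier U) g f \<in> lin_maps A U W"
proof (rule lin_mapsI)
  interpret U: left_module A U by fact
  note f = lin_mapsD[OF f] and g = lin_mapsD[OF g]
  show "compose (carrier U) g f \<in> carrier U \<rightarrow>\<^sub>E carrier W"
    using f(2) g(2) by (auto simp: compose_def)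
  show "compose (carrier U) g f (x \<oplus>\<^bsub>U\<^esub> y) = compose (carrier U) g f x \<oplus>\<^bsub>W\<^esub> compose (carrier U) g f y"
    if "x \<in> carrier U" "y \<in> carrier U" for x y
    using that by (simp add: compose_def f g)
  show "compose (carrier U) g f (a \<odot>\<^bsub>U\<^esub> x) = a \<odot>\<^bsub>W\<^esub> compose (carrier U) g f x"
    if "a \<in> carrier A" "x \<in> carrier U" for a x
    using that by (simp add: compose_def f g U.smult_closed)
qed

lemma lin_iso_trans:
  assumes "left_module A U" "lin_iso A U V" "lin_iso A V W"
  shows "lin_iso A U W"
proof -
  from assms(2,3) obtain f g where f: "f \<in> lin_maps A U V" "bij_betw f (carrier U) (carrier V)"
    and g: "g \<in> lin_maps A V W" "bij_betw g (carrier V) (carrier W)"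
    by (auto simp: lin_iso_def)
  have "bij_betw (compose (carrier U) g f) (carrier U) (carrier W)"
    using f(2) g(2) by (rule bij_betw_compose)
  with lin_maps_compose[OF f(1) g(1) assms(1)] show ?thesis by (auto simp: lin_iso_def)
qed

lemma lin_iso_sym:
  assumes "left_module A V" "lin_iso A V W"
  shows "lin_iso A W V"
proof -
  interpret V: left_module A V by fact
  from assms(2) obtain f where f: "f \<in> lin_maps A V W" and bij: "bij_betw f (carrier V) (carrier W)"
    by (auto simp: lin_iso_def)
  define g where "g = (\<lambda>y\<in>carrier W. inv_into (carrier V) f y)"
  have bij': "bij_betw g (carrier W) (carrier V)"
    using bij_betw_inv_into[OF bij] unfolding g_def by (simp cong: bij_betw_cong)
  have gf: "g (f x) = x" if "x \<in> carrier V" for x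
    using that bij lin_mapsD(2)[OF f] by (simp add: g_def bij_betw_inv_into_left)
  have ex: "\<exists>x\<in>carrier V. y = f x" if "y \<in> carrier W" for y
    using that bij by (auto simp: bij_betw_def)
  have "g \<in> lin_maps A W V"
  proof (rule lin_mapsI)
    show "g \<in> carrier W \<rightarrow>\<^sub>E carrier V"
      using bij' by (auto simp: g_def bij_betw_def)
    show "g (y \<oplus>\<^bsub>W\<^esub> y') = g y \<oplus>\<^bsub>V\<^esub> g y'" if y: "y \<in> carrier W" "y' \<in> carrier W" for y y'
    proof -
      from ex[OF y(1)] ex[OF y(2)] obtain x x' where x: "x \<in> carrier V" "x' \<in> carrier V" "y = f x" "y' = f x'" by blast
      then show ?thesis using gf[of "x \<oplus>\<^bsub>V\<^esub> x'"] by (simp add: lin_mapsD(3)[OF f] gf)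
    qed
    show "g (a \<odot>\<^bsub>W\<^esub> y) = a \<odot>\<^bsub>V\<^esub> g y" if a: "a \<in> carrier A" and y: "y \<in> carrier W" for a y
    proof -
      from ex[OF y] obtain x where x: "x \<in> carrier V" "y = f x" by blast
      then show ?thesis using a gf[of "a \<odot>\<^bsub>V\<^esub> x"] by (simp add: lin_mapsD(4)[OF f] gf V.smult_closed)
    qed
  qed
  with bij' show ?thesis by (auto simp: lin_iso_def)
qed

text \<open>
  Transport of structure along an injection puts a module into the universe \<open>'m\<close>.
\<close>

lemma left_module_transport:
  fixes V :: "('a, 'u) module" and g :: "'u \<Rightarrow> 'm"
  assumes "left_module A V" "inj_on g (carrier V)"
  shows "\<exists>N :: ('a, 'm) module. left_module A N \<and> lin_iso A V N"
proof -
  interpret V: left_module A V by fact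
  define h where "h = inv_into (carrier V) g"
  have hg: "h (g x) = x" if "x \<in> carrier V" for x
    using assms(2) that by (simp add: h_def)
  define N :: "('a, 'm) module" where "N = \<lparr>carrier = g ` carrier V, mult = undefined, one = undefined,
    ring.zero = g \<zero>\<^bsub>V\<^esub>, add = (\<lambda>x y. g (h x \<oplus>\<^bsub>V\<^esub> h y)), module.smult = (\<lambda>a x. g (a \<odot>\<^bsub>V\<^esub> h x))\<rparr>"
  have N: "carrier N = g ` carrier V" "\<zero>\<^bsub>N\<^esub> = g \<zero>\<^bsub>V\<^esub>"
    "x \<oplus>\<^bsub>N\<^esub> y = g (h x \<oplus>\<^bsub>V\<^esub> h y)" "a \<odot>\<^bsub>N\<^esub> x = g (a \<odot>\<^bsub>V\<^esub> h x)" for x y a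
    by (simp_all add: N_def)
  note V = V.smult_closed
  have "abelian_group N"
  proof (rule abelian_groupI)
    fix x assume "x \<in> carrier N"
    then obtain v where v: "v \<in> carrier V" "x = g v" by (auto simp: N)
    then have "g (\<ominus>\<^bsub>V\<^esub> v) \<oplus>\<^bsub>N\<^esub> x = \<zero>\<^bsub>N\<^esub>" by (simp add: N hg V.M.l_neg)
    with v show "\<exists>y\<in>carrier N. y \<oplus>\<^bsub>N\<^esub> x = \<zero>\<^bsub>N\<^esub>" by (auto simp: N)
  qed (auto simp: N hg V.M.a_ac)
  moreover have "left_module_axioms A N"
    by (unfold_locales; clarsimp simp: N hg V V.smult_l_distr V.smult_r_distr V.smult_assoc V.smult_one)
  ultimately have "left_module A N"
    using V.R.ring_axioms by (simp add: left_module_def)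
  moreover have "(\<lambda>x\<in>carrier V. g x) \<in> lin_maps A V N"
    by (rule lin_mapsI) (auto simp: N hg V)
  moreover have "bij_betw (\<lambda>x\<in>carrier V. g x) (carrier V) (carrier N)"
    using assms(2) by (simp add: N bij_betw_def cong: inj_on_cong)
  ultimately show ?thesis unfolding lin_iso_def by blast
qed

text \<open>
  Generators \<open>b\<close> and a generating set of relations \<open>r\<close>: the content of an exact sequence
  \<open>A\<^sup>m \<rightarrow> A\<^sup>l \<rightarrow> V \<rightarrow> 0\<close> in terms of elements, which is the form in which \<open>Hom(V, Z)\<close> becomes
  a solution set.
\<close>

definition presentation ::
  "('a, 'r) ring_scheme \<Rightarrow> ('a, 'm) module \<Rightarrow> nat \<Rightarrow> nat \<Rightarrow> (nat \<Rightarrow> 'm) \<Rightarrow> (nat \<Rightarrow> nat \<Rightarrow> 'a) \<Rightarrow> bool" where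
  "presentation A V l m b r \<longleftrightarrow>
     b \<in> {..<l} \<rightarrow> carrier V \<and> (\<forall>i<m. r i \<in> {..<l} \<rightarrow> carrier A) \<and>
     (\<forall>v\<in>carrier V. \<exists>c\<in>{..<l} \<rightarrow> carrier A. v = lincomb V {..<l} c b) \<and>
     (\<forall>i<m. lincomb V {..<l} (r i) b = \<zero>\<^bsub>V\<^esub>) \<and>
     (\<forall>c\<in>{..<l} \<rightarrow> carrier A. lincomb V {..<l} c b = \<zero>\<^bsub>V\<^esub> \<longrightarrow>
        (\<exists>d\<in>{..<m} \<rightarrow> carrier A. \<forall>j<l. c j = (\<Oplus>\<^bsub>A\<^esub>i\<in>{..<m}. d i \<otimes>\<^bsub>A\<^esub> r i j)))"

context ring
begin

definition unit_vector :: "nat \<Rightarrow> nat \<Rightarrow> nat \<Rightarrow> 'a" where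
  "unit_vector l j = (\<lambda>i\<in>{..<l}. if i = j then \<one> else \<zero>)"

lemma free_module_simps:
  "carrier (free_module R l) = {..<l} \<rightarrow>\<^sub>E carrier R"
  "\<zero>\<^bsub>free_module R l\<^esub> = (\<lambda>i\<in>{..<l}. \<zero>)"
  "u \<oplus>\<^bsub>free_module R l\<^esub> v = (\<lambda>i\<in>{..<l}. u i \<oplus> v i)"
  "a \<odot>\<^bsub>free_module R l\<^esub> u = (\<lambda>i\<in>{..<l}. a \<otimes> u i)"
  by (simp_all add: free_module_def)

lemma left_module_free: "left_module R (free_module R l)"
proof -
  have "abelian_group (free_module R l)"
  proof (rule abelian_groupI)
    fix u assume "u \<in> carrier (free_module R l)"
    then have "(\<lambda>i\<in>{..<l}. \<ominus> u i) \<in> carrier (free_module R l)"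
      "(\<lambda>i\<in>{..<l}. \<ominus> u i) \<oplus>\<^bsub>free_module R l\<^esub> u = \<zero>\<^bsub>free_module R l\<^esub>"
      by (auto simp: free_module_simps l_neg PiE_iff)
    then show "\<exists>v\<in>carrier (free_module R l). v \<oplus>\<^bsub>free_module R l\<^esub> u = \<zero>\<^bsub>free_module R l\<^esub>" by blast
  qed (auto simp: free_module_simps a_ac PiE_iff extensional_def fun_eq_iff)
  moreover have "left_module_axioms R (free_module R l)"
    by unfold_locales
      (auto simp: free_module_simps PiE_iff l_distr r_distr m_assoc extensional_def fun_eq_iff)
  ultimately show ?thesis using ring_axioms by (simp add: left_module_def)
qed

lemma free_module_finsum:
  assumes "finite I" "u \<in> I \<rightarrow> carrier (free_module R l)"
  shows "(\<Oplus>\<^bsub>free_module R l\<^esub>i\<in>I. u i) = (\<lambda>j\<in>{..<l}. \<Oplus>i\<in>I. u i j)"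
proof -
  interpret F: left_module R "free_module R l" by (rule left_module_free)
  show ?thesis
    by (rule finsum_pointwise[OF F.M.abelian_monoid_axioms abelian_monoid_axioms _ _ _ assms])
      (simp_all add: free_module_simps)
qed

lemma unit_vector_closed: "unit_vector l j \<in> carrier (free_module R l)"
  by (auto simp: unit_vector_def free_module_simps)

lemma free_module_lincomb:
  assumes c: "c \<in> {..<l} \<rightarrow> carrier R"
  shows "lincomb (free_module R l) {..<l} c (unit_vector l) = (\<lambda>j\<in>{..<l}. c j)"
proof -
  interpret F: left_module R "free_module R l" by (rule left_module_free)
  have cl: "(\<lambda>i. c i \<odot>\<^bsub>free_module R l\<^esub> unit_vector l i) \<in> {..<l} \<rightarrow> carrier (free_module R l)"
    using c by (auto intro!: F.smult_closed unit_vector_closed)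
  have "lincomb (free_module R l) {..<l} c (unit_vector l) =
    (\<lambda>j\<in>{..<l}. \<Oplus>i\<in>{..<l}. (c i \<odot>\<^bsub>free_module R l\<^esub> unit_vector l i) j)"
    unfolding lincomb_def using cl by (intro free_module_finsum) auto
  also have "\<dots> = (\<lambda>j\<in>{..<l}. c j)"
  proof (rule restrict_ext)
    fix j assume j: "j \<in> {..<l}"
    have "(\<Oplus>i\<in>{..<l}. (c i \<odot>\<^bsub>free_module R l\<^esub> unit_vector l i) j) = (\<Oplus>i\<in>{..<l}. if j = i then c i else \<zero>)"
      using c j by (intro finsum_cong') (auto simp: free_module_simps unit_vector_def Pi_iff)
    also have "\<dots> = c j" using c j by (intro add.finprod_singleton) auto
    finally show "(\<Oplus>i\<in>{..<l}. (c i \<odot>\<^bsub>free_module R l\<^esub> unit_vector l i) j) = c j" .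
  qed
  finally show ?thesis .
qed

lemma lin_map_free_module:
  assumes "left_module R V" "g \<in> lin_maps R (free_module R l) V" "c \<in> {..<l} \<rightarrow> carrier R"
  shows "g (\<lambda>j\<in>{..<l}. c j) = lincomb V {..<l} c (\<lambda>j. g (unit_vector l j))"
  using lin_map_lincomb[OF left_module_free assms(1,2) _ assms(3), of "unit_vector l"]
  by (simp add: free_module_lincomb[OF assms(3)] unit_vector_closed Pi_iff)

lemma fin_pres_module_presentation:
  assumes "fin_pres_module R V"
  shows "\<exists>l m b r. presentation R V l m b r"
proof -
  from assms have V: "left_module R V" by (simp add: fin_pres_module_def)
  from assms obtain l m f g where f: "f \<in> lin_maps R (free_module R m) (free_module R l)"
    and g: "g \<in> lin_maps R (free_module R l) V"
    and surj: "g ` carrier (free_module R l) = carrier V"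
    and ker: "{v \<in> carrier (free_module R l). g v = \<zero>\<^bsub>V\<^esub>} = f ` carrier (free_module R m)"
    unfolding fin_pres_module_def by blast
  interpret V: left_module R V by fact
  let ?b = "\<lambda>j. g (unit_vector l j)" and ?r = "\<lambda>i. f (unit_vector m i)"
  have r: "?r i \<in> carrier (free_module R l)" for i
    using lin_mapsD(2)[OF f unit_vector_closed] .
  have comb: "lincomb V {..<l} c ?b = g c" if "c \<in> carrier (free_module R l)" for c
  proof -
    have "(\<lambda>j\<in>{..<l}. c j) = c" "c \<in> {..<l} \<rightarrow> carrier R"
      using that by (auto simp: free_module_simps PiE_iff extensional_restrict)
    with lin_map_free_module[OF V g, of c] show ?thesis by simp
  qed
  have "presentation R V l m ?b ?r"
    unfolding presentation_def
  proof (intro conjI ballI allI impI)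
    show "?b \<in> {..<l} \<rightarrow> carrier V" using lin_mapsD(2)[OF g unit_vector_closed] by auto
    show "?r i \<in> {..<l} \<rightarrow> carrier R" for i using r[of i] by (auto simp: free_module_simps)
    show "\<exists>c\<in>{..<l} \<rightarrow> carrier R. v = lincomb V {..<l} c ?b" if "v \<in> carrier V" for v
    proof -
      from that surj obtain c where "c \<in> carrier (free_module R l)" "v = g c" by blast
      with comb show ?thesis by (intro bexI[of _ c]) (auto simp: free_module_simps)
    qed
    show "lincomb V {..<l} (?r i) ?b = \<zero>\<^bsub>V\<^esub>" for i
      using ker unit_vector_closed[of m i] by (subst comb[OF r]) blast
    show "\<exists>d\<in>{..<m} \<rightarrow> carrier R. \<forall>j<l. c j = (\<Oplus>i\<in>{..<m}. d i \<otimes> ?r i j)"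
      if c: "c \<in> {..<l} \<rightarrow> carrier R" and 0: "lincomb V {..<l} c ?b = \<zero>\<^bsub>V\<^esub>" for c
    proof -
      let ?c = "\<lambda>j\<in>{..<l}. c j"
      have "?c \<in> carrier (free_module R l)" using c by (auto simp: free_module_simps)
      moreover have "g ?c = \<zero>\<^bsub>V\<^esub>" using lin_map_free_module[OF V g c] 0 by simp
      ultimately have "?c \<in> f ` carrier (free_module R m)" unfolding ker[symmetric] by simp
      then obtain d where d: "d \<in> carrier (free_module R m)" "f d = ?c" by force
      have d': "d \<in> {..<m} \<rightarrow> carrier R" "(\<lambda>i\<in>{..<m}. d i) = d"
        using d(1) by (auto simp: free_module_simps PiE_iff extensional_restrict)
      interpret F: left_module R "free_module R l" by (rule left_module_free)
      have "?c = lincomb (free_module R l) {..<m} d ?r"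
        using lin_map_free_module[OF left_module_free f d'(1)] d d'(2) by simp
      also have "\<dots> = (\<lambda>j\<in>{..<l}. \<Oplus>i\<in>{..<m}. (d i \<odot>\<^bsub>free_module R l\<^esub> ?r i) j)"
        unfolding lincomb_def using d'(1) r by (intro free_module_finsum) (auto intro!: F.smult_closed)
      finally have *: "?c j = (\<lambda>j\<in>{..<l}. \<Oplus>i\<in>{..<m}. (d i \<odot>\<^bsub>free_module R l\<^esub> ?r i) j) j" for j
        by (rule fun_cong)
      have "c j = (\<Oplus>i\<in>{..<m}. d i \<otimes> ?r i j)" if "j < l" for j
        using *[of j] that by (simp add: free_module_simps)
      with d'(1) show ?thesis by blast
    qed
  qed
  then show ?thesis by blast
qed

end

text \<open>
  A solution of the relations in \<open>Z\<close> extends to a homomorphism: \<open>\<Sum> c\<^sub>j b\<^sub>j\<close> is sent to \<open>\<Sum> c\<^sub>j z\<^sub>j\<close>.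
  If \<open>\<Sum> c\<^sub>j b\<^sub>j = 0\<close>, then \<open>c\<close> is a combination of the relations, so
  \<open>\<Sum> c\<^sub>j z\<^sub>j = 0\<close> as well, and the map is well defined.
\<close>

lemma presentation_lift:
  assumes "left_module A V" "left_module A Z" and P: "presentation A V l m b r"
    and z: "z \<in> {..<l} \<rightarrow> carrier Z" and rel: "\<forall>i<m. lincomb Z {..<l} (r i) z = \<zero>\<^bsub>Z\<^esub>"
  shows "\<exists>u\<in>lin_maps A V Z. \<forall>j<l. u (b j) = z j"
proof -
  interpret V: left_module A V by (rule assms(1))
  interpret Z: left_module A Z by (rule assms(2))
  have b: "b \<in> {..<l} \<rightarrow> carrier V" and r: "\<And>i. i < m \<Longrightarrow> r i \<in> {..<l} \<rightarrow> carrier A"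
    and gen: "\<And>v. v \<in> carrier V \<Longrightarrow> \<exists>c\<in>{..<l} \<rightarrow> carrier A. v = lincomb V {..<l} c b"
    and syz: "\<And>c. \<lbrakk>c\<in>{..<l} \<rightarrow> carrier A; lincomb V {..<l} c b = \<zero>\<^bsub>V\<^esub>\<rbrakk> \<Longrightarrow>
        \<exists>d\<in>{..<m} \<rightarrow> carrier A. \<forall>j<l. c j = (\<Oplus>\<^bsub>A\<^esub>i\<in>{..<m}. d i \<otimes>\<^bsub>A\<^esub> r i j)"
    using P unfolding presentation_def by blast+
  have zero: "lincomb Z {..<l} c z = \<zero>\<^bsub>Z\<^esub>"
    if c: "c \<in> {..<l} \<rightarrow> carrier A" and c0: "lincomb V {..<l} c b = \<zero>\<^bsub>V\<^esub>" for c
  proof -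
    from syz[OF c c0] obtain d where d: "d \<in> {..<m} \<rightarrow> carrier A"
      and cd: "\<forall>j<l. c j = (\<Oplus>\<^bsub>A\<^esub>i\<in>{..<m}. d i \<otimes>\<^bsub>A\<^esub> r i j)" by blast
    have "lincomb Z {..<l} c z = lincomb Z {..<l} (\<lambda>j. \<Oplus>\<^bsub>A\<^esub>i\<in>{..<m}. d i \<otimes>\<^bsub>A\<^esub> r i j) z"
      using c z cd by (intro Z.lincomb_cong) auto
    also have "\<dots> = lincomb Z {..<m} d (\<lambda>i. lincomb Z {..<l} (r i) z)"
      using r d z by (intro Z.lincomb_finsum) auto
    also have "\<dots> = (\<Oplus>\<^bsub>Z\<^esub>i\<in>{..<m}. \<zero>\<^bsub>Z\<^esub>)"
      unfolding lincomb_def[of _ "{..<m}"] using rel d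
      by (intro Z.M.finsum_cong') (auto simp: Z.smult_zero_right Pi_iff)
    finally show ?thesis by simp
  qed
  have lc: "\<And>c. c \<in> {..<l} \<rightarrow> carrier A \<Longrightarrow> lincomb V {..<l} c b \<in> carrier V"
    and lcZ: "\<And>c. c \<in> {..<l} \<rightarrow> carrier A \<Longrightarrow> lincomb Z {..<l} c z \<in> carrier Z"
    using V.lincomb_closed b Z.lincomb_closed z by blast+
  have wd: "lincomb Z {..<l} c z = lincomb Z {..<l} c' z"
    if c: "c \<in> {..<l} \<rightarrow> carrier A" "c' \<in> {..<l} \<rightarrow> carrier A"
      and eq: "lincomb V {..<l} c b = lincomb V {..<l} c' b" for c c'
  proof -
    let ?d = "\<lambda>j. c j \<ominus>\<^bsub>A\<^esub> c' j"
    have d: "?d \<in> {..<l} \<rightarrow> carrier A" using c by auto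
    have cd: "c j = ?d j \<oplus>\<^bsub>A\<^esub> c' j" if "j < l" for j
    proof -
      have "c j \<in> carrier A" "c' j \<in> carrier A" using c that by auto
      then show ?thesis by (simp add: V.R.minus_eq V.R.a_assoc V.R.l_neg)
    qed
    have "lincomb V {..<l} c b = lincomb V {..<l} (\<lambda>j. ?d j \<oplus>\<^bsub>A\<^esub> c' j) b"
      using c b cd by (intro V.lincomb_cong) auto
    also have "\<dots> = lincomb V {..<l} ?d b \<oplus>\<^bsub>V\<^esub> lincomb V {..<l} c' b"
      by (rule V.lincomb_add[OF d c(2) b])
    finally have "lincomb V {..<l} ?d b = \<zero>\<^bsub>V\<^esub>"
      using eq lc[OF d] lc[OF c(2)] V.M.add.r_cancel_one' by metis
    then have "lincomb Z {..<l} ?d z = \<zero>\<^bsub>Z\<^esub>" by (rule zero[OF d])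
    moreover have "lincomb Z {..<l} c z = lincomb Z {..<l} (\<lambda>j. ?d j \<oplus>\<^bsub>A\<^esub> c' j) z"
      using c z cd by (intro Z.lincomb_cong) auto
    moreover have "\<dots> = lincomb Z {..<l} ?d z \<oplus>\<^bsub>Z\<^esub> lincomb Z {..<l} c' z"
      by (rule Z.lincomb_add[OF d c(2) z])
    ultimately show ?thesis using lcZ[OF c(2)] by simp
  qed
  define co where "co v = (SOME c. c \<in> {..<l} \<rightarrow> carrier A \<and> v = lincomb V {..<l} c b)" for v
  have co: "co v \<in> {..<l} \<rightarrow> carrier A" "v = lincomb V {..<l} (co v) b" if "v \<in> carrier V" for v
  proof -
    from gen[OF that] have "\<exists>c. c \<in> {..<l} \<rightarrow> carrier A \<and> v = lincomb V {..<l} c b" by blast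
    from someI_ex[OF this] have "co v \<in> {..<l} \<rightarrow> carrier A \<and> v = lincomb V {..<l} (co v) b"
      by (simp only: co_def)
    then show "co v \<in> {..<l} \<rightarrow> carrier A" "v = lincomb V {..<l} (co v) b" by auto
  qed
  define u where "u = (\<lambda>v\<in>carrier V. lincomb Z {..<l} (co v) z)"
  have u: "u v = lincomb Z {..<l} c z" if "c \<in> {..<l} \<rightarrow> carrier A" "v = lincomb V {..<l} c b" for v c
  proof -
    have v: "v \<in> carrier V" using that lc by simp
    then have "u v = lincomb Z {..<l} (co v) z" by (simp add: u_def)
    also have "\<dots> = lincomb Z {..<l} c z"
      using co[OF v] that by (intro wd) auto
    finally show ?thesis .
  qed
  show ?thesis
  proof (intro bexI allI impI)
    show "u \<in> lin_maps A V Z"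
    proof (rule lin_mapsI)
      show "u \<in> carrier V \<rightarrow>\<^sub>E carrier Z"
        unfolding u_def using lcZ co by simp
      show "u (x \<oplus>\<^bsub>V\<^esub> y) = u x \<oplus>\<^bsub>Z\<^esub> u y" if x: "x \<in> carrier V" and y: "y \<in> carrier V" for x y
      proof -
        have "u (x \<oplus>\<^bsub>V\<^esub> y) = lincomb Z {..<l} (\<lambda>j. co x j \<oplus>\<^bsub>A\<^esub> co y j) z"
        proof (rule u)
          show "(\<lambda>j. co x j \<oplus>\<^bsub>A\<^esub> co y j) \<in> {..<l} \<rightarrow> carrier A" using co(1)[OF x] co(1)[OF y] by auto
          show "x \<oplus>\<^bsub>V\<^esub> y = lincomb V {..<l} (\<lambda>j. co x j \<oplus>\<^bsub>A\<^esub> co y j) b"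
            using V.lincomb_add[OF co(1)[OF x] co(1)[OF y] b] co(2)[OF x] co(2)[OF y] by simp
        qed
        also have "\<dots> = u x \<oplus>\<^bsub>Z\<^esub> u y"
          using Z.lincomb_add[OF co(1)[OF x] co(1)[OF y] z] x y by (simp add: u_def)
        finally show ?thesis .
      qed
      show "u (a \<odot>\<^bsub>V\<^esub> x) = a \<odot>\<^bsub>Z\<^esub> u x" if a: "a \<in> carrier A" and x: "x \<in> carrier V" for a x
      proof -
        have "u (a \<odot>\<^bsub>V\<^esub> x) = lincomb Z {..<l} (\<lambda>j. a \<otimes>\<^bsub>A\<^esub> co x j) z"
        proof (rule u)
          show "(\<lambda>j. a \<otimes>\<^bsub>A\<^esub> co x j) \<in> {..<l} \<rightarrow> carrier A" using co(1)[OF x] a by auto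
          show "a \<odot>\<^bsub>V\<^esub> x = lincomb V {..<l} (\<lambda>j. a \<otimes>\<^bsub>A\<^esub> co x j) b"
            using V.lincomb_smult[OF _ a co(1)[OF x] b] co(2)[OF x] by simp
        qed
        also have "\<dots> = a \<odot>\<^bsub>Z\<^esub> u x"
          using Z.lincomb_smult[OF _ a co(1)[OF x] z] x by (simp add: u_def)
        finally show ?thesis .
      qed
    qed
    fix j assume j: "j < l"
    let ?e = "\<lambda>i. if j = i then \<one>\<^bsub>A\<^esub> else \<zero>\<^bsub>A\<^esub>"
    have "u (b j) = lincomb Z {..<l} ?e z"
      using V.lincomb_unit[OF _ _ b, of j] j by (intro u) auto
    also have "\<dots> = z j" using j z by (intro Z.lincomb_unit) auto
    finally show "u (b j) = z j" .
  qed
qed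

lemma presentation_relations:
  assumes "left_module A V" "left_module A Z" and P: "presentation A V l m b r"
    and u: "u \<in> lin_maps A V Z" and "i < m"
  shows "lincomb Z {..<l} (r i) (\<lambda>j. u (b j)) = \<zero>\<^bsub>Z\<^esub>"
proof -
  have "b \<in> {..<l} \<rightarrow> carrier V" "r i \<in> {..<l} \<rightarrow> carrier A" "lincomb V {..<l} (r i) b = \<zero>\<^bsub>V\<^esub>"
    using P \<open>i < m\<close> by (auto simp: presentation_def)
  then show ?thesis
    using lin_map_lincomb[OF assms(1,2) u, of "{..<l}" "r i" b] lin_map_zero[OF assms(1,2) u] by simp
qed

lemma presentation_unique:
  assumes "left_module A V" "left_module A Z" and P: "presentation A V l m b r"
    and u: "u \<in> lin_maps A V Z" and u': "u' \<in> lin_maps A V Z" and eq: "\<And>j. j < l \<Longrightarrow> u (b j) = u' (b j)"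
  shows "u = u'"
proof (rule PiE_ext[OF lin_mapsD(1)[OF u] lin_mapsD(1)[OF u']])
  interpret Z: left_module A Z by (rule assms(2))
  fix v assume "v \<in> carrier V"
  with P obtain c where c: "c \<in> {..<l} \<rightarrow> carrier A" "v = lincomb V {..<l} c b" by (auto simp: presentation_def)
  have b: "b \<in> {..<l} \<rightarrow> carrier V" using P by (simp add: presentation_def)
  have ub: "(\<lambda>j. u (b j)) \<in> {..<l} \<rightarrow> carrier Z" using b lin_mapsD(2)[OF u] by auto
  show "u v = u' v"
    using lin_map_lincomb[OF assms(1,2) u _ c(1) b] lin_map_lincomb[OF assms(1,2) u' _ c(1) b] c(2)
      Z.lincomb_cong[OF c(1) ub refl eq] by simp
qed

text \<open>
  Every solution \<open>z\<close> of the system \<open>r\<close> has the form \<open>a y\<close> for a solution \<open>y\<close> of the system \<open>r'\<close>.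
  For presented modules \<open>V\<close> and \<open>W\<close> and a homomorphism \<open>V \<rightarrow> W\<close> with matrix \<open>a\<close> this says that
  \<open>Hom(W, Z) \<rightarrow> Hom(V, Z)\<close> is surjective.
\<close>

definition solvability_condition ::
  "nat \<Rightarrow> nat \<Rightarrow> (nat \<Rightarrow> nat \<Rightarrow> 'a) \<Rightarrow> nat \<Rightarrow> nat \<Rightarrow> (nat \<Rightarrow> nat \<Rightarrow> 'a) \<Rightarrow> (nat \<Rightarrow> nat \<Rightarrow> 'a) \<Rightarrow>
   ('a, 'z) module \<Rightarrow> bool" where
  "solvability_condition l m r l' m' r' a Z \<longleftrightarrow>
     (\<forall>z\<in>{..<l} \<rightarrow> carrier Z. (\<forall>i<m. lincomb Z {..<l} (r i) z = \<zero>\<^bsub>Z\<^esub>) \<longrightarrow>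
        (\<exists>y\<in>{..<l'} \<rightarrow> carrier Z. (\<forall>i<m'. lincomb Z {..<l'} (r' i) y = \<zero>\<^bsub>Z\<^esub>) \<and>
           (\<forall>i<l. lincomb Z {..<l'} (a i) y = z i)))"

text \<open>
  Yoneda: \<open>h = h \<circ> id\<^sub>W\<close> is the image of \<open>id\<^sub>W\<close> under \<open>Hom(W, h)\<close>, so by naturality \<open>\<alpha>\<close> is
  precomposition with its value at \<open>id\<^sub>W\<close>.
\<close>

lemma yoneda_precomposition:
  assumes V: "left_module A V" and W: "left_module A W" and Z: "left_module A Z"
    and \<alpha>: "nat_trans A (Hom_functor A W) (Hom_functor A V) \<alpha>" and h: "h \<in> lin_maps A W Z"
  shows "\<alpha> W (\<lambda>x\<in>carrier W. x) \<in> lin_maps A V W"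
    and "\<alpha> Z h = compose (carrier V) h (\<alpha> W (\<lambda>x\<in>carrier W. x))"
proof -
  let ?id = "\<lambda>x\<in>carrier W. x"
  interpret W: left_module A W by fact
  have id: "?id \<in> lin_maps A W W"
    by (rule lin_mapsI) (auto simp: W.smult_closed)
  have "\<alpha> W \<in> hom (Hom_group A W W) (Hom_group A V W)"
    using \<alpha> W by (simp add: nat_trans_def Hom_functor_def)
  then show "\<alpha> W ?id \<in> lin_maps A V W"
    using id by (auto simp: hom_def Hom_group_def)
  have "compose (carrier W) h ?id = h"
    using lin_mapsD(1)[OF h] by (auto simp: compose_def PiE_def extensional_def fun_eq_iff)
  moreover have "\<alpha> Z (compose (carrier W) h ?id) = compose (carrier V) h (\<alpha> W ?id)"
    using \<alpha> W Z h id unfolding nat_trans_def by (simp add: Hom_functor_def Hom_group_def)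
  ultimately show "\<alpha> Z h = compose (carrier V) h (\<alpha> W ?id)" by simp
qed

text \<open>
  By exactness \<open>F(Z)\<close> vanishes iff \<open>Hom(W, Z) \<rightarrow> Hom(V, Z)\<close> is surjective.  By Yoneda this map is
  composition with some \<open>f : V \<rightarrow> W\<close>, and presentations of \<open>V\<close> and \<open>W\<close> turn surjectivity into a
  statement about solutions of linear systems in \<open>Z\<close>.  The systems depend on \<open>F\<close> but not on \<open>Z\<close>.
\<close>

theorem fin_pres_functor_vanishing:
  assumes "ring A" and F: "fin_pres_functor A (F :: ('a, 'm, 'g) ab_functor)"
  shows "\<exists>l m r l' m' r' a.
    (\<forall>i<m. r i \<in> {..<l} \<rightarrow> carrier A) \<and> (\<forall>i<m'. r' i \<in> {..<l'} \<rightarrow> carrier A) \<and>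
    (\<forall>i<l. a i \<in> {..<l'} \<rightarrow> carrier A) \<and>
    (\<forall>Z. left_module A Z \<longrightarrow> (trivial_group (on_obj F Z) \<longleftrightarrow> solvability_condition l m r l' m' r' a Z))"
proof -
  interpret A: ring A by fact
  have "\<exists>V W \<alpha> \<beta>. fin_pres_module A V \<and> fin_pres_module A W \<and>
        nat_trans A (Hom_functor A W) (Hom_functor A V) \<alpha> \<and>
        nat_trans A (Hom_functor A V) F \<beta> \<and>
        (\<forall>Z. left_module A Z \<longrightarrow>
           kernel (Hom_group A V Z) (on_obj F Z) (\<beta> Z) = \<alpha> Z ` carrier (Hom_group A W Z) \<and>
           \<beta> Z ` carrier (Hom_group A V Z) = carrier (on_obj F Z))"
    using F unfolding fin_pres_functor_def by (rule conjunct2)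
  then obtain V W \<alpha> \<beta> where D: "fin_pres_module A V \<and> fin_pres_module A W \<and>
        nat_trans A (Hom_functor A W) (Hom_functor A V) \<alpha> \<and>
        nat_trans A (Hom_functor A V) F \<beta> \<and>
        (\<forall>Z. left_module A Z \<longrightarrow>
           kernel (Hom_group A V Z) (on_obj F Z) (\<beta> Z) = \<alpha> Z ` carrier (Hom_group A W Z) \<and>
           \<beta> Z ` carrier (Hom_group A V Z) = carrier (on_obj F Z))"
    by (elim exE)
  have fp: "fin_pres_module A V" "fin_pres_module A W"
    and \<alpha>: "nat_trans A (Hom_functor A W) (Hom_functor A V) \<alpha>"
    and \<beta>: "nat_trans A (Hom_functor A V) F \<beta>"
    using D by simp_all
  have ex: "kernel (Hom_group A V Z) (on_obj F Z) (\<beta> Z) = \<alpha> Z ` carrier (Hom_group A W Z)"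
    "\<beta> Z ` carrier (Hom_group A V Z) = carrier (on_obj F Z)" if "left_module A Z" for Z
    using D that by simp_all
  have V: "left_module A V" and W: "left_module A W" using fp by (auto simp: fin_pres_module_def)
  interpret V: left_module A V by (rule V)
  interpret W: left_module A W by (rule W)
  from A.fin_pres_module_presentation[OF fp(1)] obtain l m b r where P: "presentation A V l m b r" by blast
  from A.fin_pres_module_presentation[OF fp(2)] obtain l' m' b' r' where P': "presentation A W l' m' b' r'" by blast
  have b: "b \<in> {..<l} \<rightarrow> carrier V" and b': "b' \<in> {..<l'} \<rightarrow> carrier W"
    using P P' by (simp_all add: presentation_def)
  define f where "f = \<alpha> W (\<lambda>x\<in>carrier W. x)"
  have "(\<lambda>x\<in>carrier W. x) \<in> lin_maps A W W" by (rule lin_mapsI) (auto simp: W.smult_closed)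
  with yoneda_precomposition(1)[OF V W W \<alpha>] have f: "f \<in> lin_maps A V W" by (simp add: f_def)
  have "\<forall>i\<in>{..<l}. \<exists>c. c \<in> {..<l'} \<rightarrow> carrier A \<and> f (b i) = lincomb W {..<l'} c b'"
  proof
    fix i assume "i \<in> {..<l}"
    then have "f (b i) \<in> carrier W" using b lin_mapsD(2)[OF f] by auto
    with P' show "\<exists>c. c \<in> {..<l'} \<rightarrow> carrier A \<and> f (b i) = lincomb W {..<l'} c b'"
      unfolding presentation_def by blast
  qed
  from bchoice[OF this] obtain a where
    "\<forall>i\<in>{..<l}. a i \<in> {..<l'} \<rightarrow> carrier A \<and> f (b i) = lincomb W {..<l'} (a i) b'" ..
  then have a: "a i \<in> {..<l'} \<rightarrow> carrier A" "f (b i) = lincomb W {..<l'} (a i) b'" if "i < l" for i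
    using that by simp_all
  have main: "trivial_group (on_obj F Z) \<longleftrightarrow> solvability_condition l m r l' m' r' a Z" if Z: "left_module A Z" for Z
  proof -
    interpret Z: left_module A Z by (rule Z)
    have "comm_group (on_obj F Z)"
      using F Z by (simp add: fin_pres_functor_def is_ab_functor_def)
    then interpret FZ: comm_group "on_obj F Z" .
    have "trivial_group (on_obj F Z) \<longleftrightarrow> (\<forall>w\<in>carrier (on_obj F Z). w = \<one>\<^bsub>on_obj F Z\<^esub>)"
      by (auto simp: trivial_group_def)
    also have "\<dots> \<longleftrightarrow> (\<forall>u\<in>lin_maps A V Z. \<beta> Z u = \<one>\<^bsub>on_obj F Z\<^esub>)"
      unfolding ex(2)[OF Z, symmetric] by (simp add: Hom_group_def)
    also have "\<dots> \<longleftrightarrow> lin_maps A V Z \<subseteq> \<alpha> Z ` lin_maps A W Z"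
      using ex(1)[OF Z] by (auto simp: kernel_def Hom_group_def)
    also have "\<dots> \<longleftrightarrow> (\<forall>u\<in>lin_maps A V Z. \<exists>h\<in>lin_maps A W Z. u = compose (carrier V) h f)"
    proof -
      have "\<alpha> Z ` lin_maps A W Z = (\<lambda>h. compose (carrier V) h f) ` lin_maps A W Z"
        unfolding f_def by (rule image_cong[OF refl yoneda_precomposition(2)[OF V W Z \<alpha>]])
      then show ?thesis by (simp add: subset_iff image_iff Ball_def)
    qed
    also have "\<dots> \<longleftrightarrow> solvability_condition l m r l' m' r' a Z"
    proof
      assume L: "\<forall>u\<in>lin_maps A V Z. \<exists>h\<in>lin_maps A W Z. u = compose (carrier V) h f"
      show "solvability_condition l m r l' m' r' a Z"
        unfolding solvability_condition_def
      proof (intro ballI impI)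
        fix z assume z: "z \<in> {..<l} \<rightarrow> carrier Z" "\<forall>i<m. lincomb Z {..<l} (r i) z = \<zero>\<^bsub>Z\<^esub>"
        from presentation_lift[OF V Z P z] obtain u where u: "u \<in> lin_maps A V Z" "\<forall>j<l. u (b j) = z j" by blast
        from L u(1) obtain h where h: "h \<in> lin_maps A W Z" "u = compose (carrier V) h f" by blast
        have "lincomb Z {..<l'} (a i) (\<lambda>j. h (b' j)) = z i" if i: "i < l" for i
        proof -
          have "b i \<in> carrier V" using b i by auto
          then have "compose (carrier V) h f (b i) = h (f (b i))" by (simp add: compose_def)
          then have "z i = h (f (b i))" using i u(2) h(2) by metis
          also have "\<dots> = lincomb Z {..<l'} (a i) (\<lambda>j. h (b' j))"
            unfolding a(2)[OF i] by (rule lin_map_lincomb[OF W Z h(1) _ a(1)[OF i] b']) simp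
          finally show ?thesis by simp
        qed
        moreover have "(\<lambda>j. h (b' j)) \<in> {..<l'} \<rightarrow> carrier Z" using b' lin_mapsD(2)[OF h(1)] by auto
        ultimately show "\<exists>y\<in>{..<l'} \<rightarrow> carrier Z. (\<forall>i<m'. lincomb Z {..<l'} (r' i) y = \<zero>\<^bsub>Z\<^esub>) \<and>
           (\<forall>i<l. lincomb Z {..<l'} (a i) y = z i)"
          using presentation_relations[OF W Z P' h(1)] by blast
      qed
    next
      assume R: "solvability_condition l m r l' m' r' a Z"
      show "\<forall>u\<in>lin_maps A V Z. \<exists>h\<in>lin_maps A W Z. u = compose (carrier V) h f"
      proof
        fix u assume u: "u \<in> lin_maps A V Z"
        have "(\<lambda>j. u (b j)) \<in> {..<l} \<rightarrow> carrier Z" using b lin_mapsD(2)[OF u] by auto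
        moreover have "\<forall>i<m. lincomb Z {..<l} (r i) (\<lambda>j. u (b j)) = \<zero>\<^bsub>Z\<^esub>"
          using presentation_relations[OF V Z P u] by blast
        ultimately obtain y where y: "y \<in> {..<l'} \<rightarrow> carrier Z" "\<forall>i<m'. lincomb Z {..<l'} (r' i) y = \<zero>\<^bsub>Z\<^esub>"
          and ay: "\<forall>i<l. lincomb Z {..<l'} (a i) y = u (b i)"
          using R unfolding solvability_condition_def by blast
        from presentation_lift[OF W Z P' y] obtain h where h: "h \<in> lin_maps A W Z" "\<forall>j<l'. h (b' j) = y j" by blast
        have "u (b i) = compose (carrier V) h f (b i)" if i: "i < l" for i
        proof -
          have "compose (carrier V) h f (b i) = h (f (b i))" using b i by (auto simp: compose_def)
          also have "\<dots> = lincomb Z {..<l'} (a i) (\<lambda>j. h (b' j))"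
            unfolding a(2)[OF i] by (rule lin_map_lincomb[OF W Z h(1) _ a(1)[OF i] b']) simp
          also have "\<dots> = lincomb Z {..<l'} (a i) y"
            using h(2) y(1) a(1)[OF i] by (intro Z.lincomb_cong) auto
          finally show ?thesis using ay i by simp
        qed
        then have "u = compose (carrier V) h f"
          by (rule presentation_unique[OF V Z P u lin_maps_compose[OF f h(1) V]])
        with h(1) show "\<exists>h\<in>lin_maps A W Z. u = compose (carrier V) h f" by blast
      qed
    qed
    finally show ?thesis .
  qed
  have "\<forall>i<m. r i \<in> {..<l} \<rightarrow> carrier A" "\<forall>i<m'. r' i \<in> {..<l'} \<rightarrow> carrier A"
    using P P' by (simp_all add: presentation_def)
  with a(1) main show ?thesis by blast
qed

lemma solvability_condition_iso:
  assumes Z: "left_module A Z" and Z': "left_module A Z'" and iso: "lin_iso A Z Z'"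
    and r: "\<forall>i<m. r i \<in> {..<l} \<rightarrow> carrier A" and r': "\<forall>i<m'. r' i \<in> {..<l'} \<rightarrow> carrier A"
    and a: "\<forall>i<l. a i \<in> {..<l'} \<rightarrow> carrier A"
    and S: "solvability_condition l m r l' m' r' a Z"
  shows "solvability_condition l m r l' m' r' a Z'"
  unfolding solvability_condition_def
proof (intro ballI impI)
  interpret Z: left_module A Z by (rule Z)
  interpret Z': left_module A Z' by (rule Z')
  from iso obtain f where f: "f \<in> lin_maps A Z Z'" and bij: "bij_betw f (carrier Z) (carrier Z')"
    by (auto simp: lin_iso_def)
  note f0 = lin_map_zero[OF Z Z' f] and fl = lin_map_lincomb[OF Z Z' f]
  fix z' assume z': "z' \<in> {..<l} \<rightarrow> carrier Z'" and rel: "\<forall>i<m. lincomb Z' {..<l} (r i) z' = \<zero>\<^bsub>Z'\<^esub>"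
  define z where "z j = inv_into (carrier Z) f (z' j)" for j
  have zj: "z j \<in> carrier Z" "f (z j) = z' j" if "j < l" for j
  proof -
    have "z' j \<in> f ` carrier Z" using that z' bij by (auto simp: bij_betw_def)
    then show "z j \<in> carrier Z" "f (z j) = z' j"
      unfolding z_def by (rule inv_into_into, rule f_inv_into_f)
  qed
  then have z: "z \<in> {..<l} \<rightarrow> carrier Z" by auto
  have "lincomb Z {..<l} (r i) z = \<zero>\<^bsub>Z\<^esub>" if i: "i < m" for i
  proof -
    have ri: "r i \<in> {..<l} \<rightarrow> carrier A" using r i by blast
    have "f (lincomb Z {..<l} (r i) z) = lincomb Z' {..<l} (r i) (\<lambda>j. f (z j))"
      by (rule fl[OF _ ri z]) simp
    also have "\<dots> = lincomb Z' {..<l} (r i) z'"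
      using zj z' ri by (intro Z'.lincomb_cong) auto
    also have "\<dots> = f \<zero>\<^bsub>Z\<^esub>" using rel i f0 by simp
    finally show ?thesis
      using bij Z.lincomb_closed[OF ri z] by (auto simp: bij_betw_def dest: inj_onD)
  qed
  with S z obtain y where y: "y \<in> {..<l'} \<rightarrow> carrier Z" "\<forall>i<m'. lincomb Z {..<l'} (r' i) y = \<zero>\<^bsub>Z\<^esub>"
    "\<forall>i<l. lincomb Z {..<l'} (a i) y = z i"
    unfolding solvability_condition_def by blast
  have "lincomb Z' {..<l'} (r' i) (\<lambda>j. f (y j)) = \<zero>\<^bsub>Z'\<^esub>" if "i < m'" for i
  proof -
    have ri: "r' i \<in> {..<l'} \<rightarrow> carrier A" using r' that by blast
    show ?thesis using fl[OF _ ri y(1)] y(2) that f0 by simp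
  qed
  moreover have "lincomb Z' {..<l'} (a i) (\<lambda>j. f (y j)) = z' i" if "i < l" for i
  proof -
    have ai: "a i \<in> {..<l'} \<rightarrow> carrier A" using a that by blast
    show ?thesis using fl[OF _ ai y(1)] y(3) that zj(2) by simp
  qed
  moreover have "(\<lambda>j. f (y j)) \<in> {..<l'} \<rightarrow> carrier Z'"
    using y(1) lin_mapsD(2)[OF f] by auto
  ultimately show "\<exists>y\<in>{..<l'} \<rightarrow> carrier Z'. (\<forall>i<m'. lincomb Z' {..<l'} (r' i) y = \<zero>\<^bsub>Z'\<^esub>) \<and>
      (\<forall>i<l. lincomb Z' {..<l'} (a i) y = z' i)"
    by blast
qed

section \<open>Tensor products with a free bimodule\<close>

text \<open>
  The module \<open>N\<^sup>n\<close> on which \<open>a\<close> acts through the matrix \<open>\<mu> a\<close> with entries in \<open>C\<close>.  The universal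
  bimodule is the case \<open>N = C\<close> together with the right action of \<open>C\<close>.
\<close>

definition matrix_module ::
  "nat \<Rightarrow> ('a \<Rightarrow> nat \<Rightarrow> nat \<Rightarrow> 'c) \<Rightarrow> ('c, 'v) module \<Rightarrow> ('a, nat \<Rightarrow> 'v) module" where
  "matrix_module n \<mu> N = \<lparr>
     carrier = {..<n} \<rightarrow>\<^sub>E carrier N,
     mult = undefined,
     one = undefined,
     ring.zero = (\<lambda>i\<in>{..<n}. \<zero>\<^bsub>N\<^esub>),
     add = (\<lambda>u v. \<lambda>i\<in>{..<n}. u i \<oplus>\<^bsub>N\<^esub> v i),
     module.smult = (\<lambda>a v. \<lambda>i\<in>{..<n}. \<Oplus>\<^bsub>N\<^esub>j\<in>{..<n}. \<mu> a i j \<odot>\<^bsub>N\<^esub> v j)\<rparr>"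

definition matrix_bimodule ::
  "('c, 't) ring_scheme \<Rightarrow> nat \<Rightarrow> ('a \<Rightarrow> nat \<Rightarrow> nat \<Rightarrow> 'c) \<Rightarrow> ('a, 'c, nat \<Rightarrow> 'c) bimodule" where
  "matrix_bimodule C n \<mu> = \<lparr>
     carrier = {..<n} \<rightarrow>\<^sub>E carrier C,
     mult = undefined,
     one = undefined,
     ring.zero = (\<lambda>i\<in>{..<n}. \<zero>\<^bsub>C\<^esub>),
     add = (\<lambda>u v. \<lambda>i\<in>{..<n}. u i \<oplus>\<^bsub>C\<^esub> v i),
     module.smult = (\<lambda>a v. \<lambda>i\<in>{..<n}. \<Oplus>\<^bsub>C\<^esub>j\<in>{..<n}. \<mu> a i j \<otimes>\<^bsub>C\<^esub> v j),
     rsmult = (\<lambda>v c. \<lambda>i\<in>{..<n}. v i \<otimes>\<^bsub>C\<^esub> c)\<rparr>"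

lemma (in cring) finsum_delta_mult:
  assumes "finite I" "i \<in> I" "f \<in> I \<rightarrow> carrier R"
  shows "(\<Oplus>t\<in>I. f t \<otimes> (if t = i then \<one> else \<zero>)) = f i"
proof -
  have "(\<Oplus>t\<in>I. f t \<otimes> (if t = i then \<one> else \<zero>)) = (\<Oplus>t\<in>I. if i = t then f t else \<zero>)"
    using assms by (intro finsum_cong') (auto simp: Pi_iff)
  also have "\<dots> = f i" using assms by (intro add.finprod_singleton) auto
  finally show ?thesis .
qed

locale matrix_action = module C N
  for C :: "('c, 't) ring_scheme" and N :: "('c, 'v) module" (structure) +
  fixes n :: nat and \<mu> :: "'a \<Rightarrow> nat \<Rightarrow> nat \<Rightarrow> 'c" and A :: "('a, 's) ring_scheme"
  assumes \<mu>_closed: "\<lbrakk>a \<in> carrier A; i < n; j < n\<rbrakk> \<Longrightarrow> \<mu> a i j \<in> carrier C"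
begin

abbreviation "M \<equiv> matrix_bimodule C n \<mu>"
abbreviation "P \<equiv> matrix_module n \<mu> N"
abbreviation "G \<equiv> free_Abelian_group (carrier M \<times> carrier N)"
abbreviation "H \<equiv> generate G (tensor_relations C M N)"
abbreviation "cong z z' \<equiv> z - z' \<in> H"

definition unit_vec :: "nat \<Rightarrow> nat \<Rightarrow> 'c" where
  "unit_vec i = (\<lambda>j\<in>{..<n}. if j = i then \<one>\<^bsub>C\<^esub> else \<zero>\<^bsub>C\<^esub>)"

text \<open>
  A representative in the free abelian group of \<open>\<Sum> e\<^sub>i \<otimes> v\<^sub>i\<close>, where the \<open>e\<^sub>i\<close> are the unit vectors.
\<close>

definition elem_tensor :: "(nat \<Rightarrow> 'v) \<Rightarrow> ((nat \<Rightarrow> 'c) \<times> 'v \<Rightarrow>\<^sub>0 int)" where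
  "elem_tensor v = (\<Sum>i<n. frag_of (unit_vec i, v i))"

lemma carrier_M: "carrier M = {..<n} \<rightarrow>\<^sub>E carrier C"
  and add_M: "u \<oplus>\<^bsub>M\<^esub> u' = (\<lambda>i\<in>{..<n}. u i \<oplus>\<^bsub>C\<^esub> u' i)"
  and smult_M: "a \<odot>\<^bsub>M\<^esub> u = (\<lambda>i\<in>{..<n}. \<Oplus>\<^bsub>C\<^esub>j\<in>{..<n}. \<mu> a i j \<otimes>\<^bsub>C\<^esub> u j)"
  and rsmult_M: "rsmult M u c = (\<lambda>i\<in>{..<n}. u i \<otimes>\<^bsub>C\<^esub> c)"
  by (simp_all add: matrix_bimodule_def)

lemma carrier_P: "carrier P = {..<n} \<rightarrow>\<^sub>E carrier N"
  and add_P: "v \<oplus>\<^bsub>P\<^esub> v' = (\<lambda>i\<in>{..<n}. v i \<oplus> v' i)"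
  and smult_P: "a \<odot>\<^bsub>P\<^esub> v = (\<lambda>i\<in>{..<n}. \<Oplus>j\<in>{..<n}. \<mu> a i j \<odot> v j)"
  by (simp_all add: matrix_module_def)

lemma M_comp: "\<lbrakk>u \<in> carrier M; i < n\<rbrakk> \<Longrightarrow> u i \<in> carrier C"
  by (auto simp: carrier_M)

lemma P_comp: "\<lbrakk>v \<in> carrier P; i < n\<rbrakk> \<Longrightarrow> v i \<in> carrier N"
  by (auto simp: carrier_P)

lemma M_add_closed: "\<lbrakk>u \<in> carrier M; u' \<in> carrier M\<rbrakk> \<Longrightarrow> u \<oplus>\<^bsub>M\<^esub> u' \<in> carrier M"
  unfolding add_M by (auto simp: carrier_M)

lemma M_rsmult_closed: "\<lbrakk>u \<in> carrier M; c \<in> carrier C\<rbrakk> \<Longrightarrow> rsmult M u c \<in> carrier M"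
  unfolding rsmult_M by (auto simp: carrier_M)

lemma M_smult_closed: "\<lbrakk>a \<in> carrier A; u \<in> carrier M\<rbrakk> \<Longrightarrow> a \<odot>\<^bsub>M\<^esub> u \<in> carrier M"
  unfolding smult_M by (auto simp: carrier_M Pi_iff PiE_iff \<mu>_closed intro!: R.finsum_closed)

lemma unit_vec_closed: "unit_vec i \<in> carrier M"
  by (auto simp: unit_vec_def carrier_M)

lemma smult_unit_vec:
  assumes "a \<in> carrier A" "i < n" "j < n"
  shows "(a \<odot>\<^bsub>M\<^esub> unit_vec i) j = \<mu> a j i"
proof -
  have "(a \<odot>\<^bsub>M\<^esub> unit_vec i) j = (\<Oplus>\<^bsub>C\<^esub>t\<in>{..<n}. \<mu> a j t \<otimes>\<^bsub>C\<^esub> (if t = i then \<one>\<^bsub>C\<^esub> else \<zero>\<^bsub>C\<^esub>))"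
    using assms(2,3) unfolding smult_M
    by (simp, intro R.finsum_cong') (simp_all add: unit_vec_def \<mu>_closed assms(1))
  also have "\<dots> = \<mu> a j i"
    using assms by (intro R.finsum_delta_mult) (auto intro: \<mu>_closed)
  finally show ?thesis .
qed

lemma relations_subset: "tensor_relations C M N \<subseteq> carrier G"
proof -
  have "frag_of x - frag_of y - frag_of z \<in> carrier G"
    if "{x, y, z} \<subseteq> carrier M \<times> carrier N" for x y z
    using that keys_diff[of "frag_of x - frag_of y" "frag_of z"] keys_diff[of "frag_of x" "frag_of y"]
    by (auto simp: keys_frag_of)
  moreover have "frag_of x - frag_of y \<in> carrier G"
    if "{x, y} \<subseteq> carrier M \<times> carrier N" for x y
    using that keys_diff[of "frag_of x" "frag_of y"] by (auto simp: keys_frag_of)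
  ultimately show ?thesis
    unfolding tensor_relations_def
    by (auto simp del: carrier_free_Abelian_group_iff simp: M_add_closed M_rsmult_closed)
qed

lemma subgroup_H: "subgroup H G"
  by (rule group.generate_is_subgroup[OF group_free_Abelian_group relations_subset])

lemma H_closed: "z \<in> H \<Longrightarrow> z \<in> carrier G"
  using subgroup.mem_carrier[OF subgroup_H] .

lemma H_zero: "0 \<in> H"
  using subgroup.one_closed[OF subgroup_H] by simp

lemma H_add: "\<lbrakk>z \<in> H; z' \<in> H\<rbrakk> \<Longrightarrow> z + z' \<in> H"
  using subgroup.m_closed[OF subgroup_H, of z z'] by simp

lemma H_uminus: "z \<in> H \<Longrightarrow> - z \<in> H"
  using subgroup.m_inv_closed[OF subgroup_H, of z] H_closed[of z] by simp

lemma H_diff: "\<lbrakk>z \<in> H; z' \<in> H\<rbrakk> \<Longrightarrow> z - z' \<in> H"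
  using H_add[of z "- z'"] H_uminus[of z'] by simp

lemma H_sum: "\<lbrakk>finite I; \<And>i. i \<in> I \<Longrightarrow> f i \<in> H\<rbrakk> \<Longrightarrow> sum f I \<in> H"
  by (induction I rule: finite_induct) (auto simp: H_zero H_add)

lemma cong_trans: "\<lbrakk>cong x y; cong y z\<rbrakk> \<Longrightarrow> cong x z"
  using H_add[of "x - y" "y - z"] by simp

lemma cong_sym: "cong x y \<Longrightarrow> cong y x"
  using H_uminus[of "x - y"] by simp

lemma cong_add: "\<lbrakk>cong x x'; cong y y'\<rbrakk> \<Longrightarrow> cong (x + y) (x' + y')"
  using H_add[of "x - x'" "y - y'"] by (simp add: algebra_simps)

lemma cong_diff: "\<lbrakk>cong x x'; cong y y'\<rbrakk> \<Longrightarrow> cong (x - y) (x' - y')"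
  using H_diff[of "x - x'" "y - y'"] by (simp add: algebra_simps)

lemma cong_sum: "\<lbrakk>finite I; \<And>i. i \<in> I \<Longrightarrow> cong (f i) (g i)\<rbrakk> \<Longrightarrow> cong (sum f I) (sum g I)"
  using H_sum[of I "\<lambda>i. f i - g i"] by (simp add: sum_subtractf)

lemma coset: "H #>\<^bsub>G\<^esub> z = {h + z | h. h \<in> H}"
  by (auto simp: r_coset_def)

lemma coset_eq_iff: "H #>\<^bsub>G\<^esub> z = H #>\<^bsub>G\<^esub> z' \<longleftrightarrow> cong z z'"
proof
  assume "H #>\<^bsub>G\<^esub> z = H #>\<^bsub>G\<^esub> z'"
  moreover have "z \<in> H #>\<^bsub>G\<^esub> z" unfolding coset using H_zero by force
  ultimately show "cong z z'" unfolding coset by auto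
next
  have *: "H #>\<^bsub>G\<^esub> z \<subseteq> H #>\<^bsub>G\<^esub> z'" if "cong z z'" for z z'
  proof
    fix w assume "w \<in> H #>\<^bsub>G\<^esub> z"
    then obtain h where "h \<in> H" "w = h + z" unfolding coset by blast
    then have "w = (h + (z - z')) + z'" "h + (z - z') \<in> H" using that H_add by auto
    then show "w \<in> H #>\<^bsub>G\<^esub> z'" unfolding coset by blast
  qed
  assume "cong z z'"
  with * cong_sym show "H #>\<^bsub>G\<^esub> z = H #>\<^bsub>G\<^esub> z'" by blast
qed

lemma rel_add_left: "\<lbrakk>u \<in> carrier M; u' \<in> carrier M; v \<in> carrier N\<rbrakk> \<Longrightarrow>
    cong (frag_of (u \<oplus>\<^bsub>M\<^esub> u', v)) (frag_of (u, v) + frag_of (u', v))"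
  unfolding diff_diff_add[symmetric]
  by (rule generate.incl) (unfold tensor_relations_def, blast)

lemma rel_add_right: "\<lbrakk>u \<in> carrier M; v \<in> carrier N; v' \<in> carrier N\<rbrakk> \<Longrightarrow>
    cong (frag_of (u, v \<oplus> v')) (frag_of (u, v) + frag_of (u, v'))"
  unfolding diff_diff_add[symmetric]
  by (rule generate.incl) (unfold tensor_relations_def, blast)

lemma rel_balanced: "\<lbrakk>u \<in> carrier M; c \<in> carrier C; v \<in> carrier N\<rbrakk> \<Longrightarrow>
    cong (frag_of (rsmult M u c, v)) (frag_of (u, c \<odot> v))"
  by (rule generate.incl) (unfold tensor_relations_def, blast)

lemma frag_of_zero_right: "u \<in> carrier M \<Longrightarrow> frag_of (u, \<zero>) \<in> H"
  using H_uminus[OF rel_add_right[of u \<zero> \<zero>]] by simp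

lemma frag_of_zero_left:
  assumes "v \<in> carrier N"
  shows "frag_of (\<lambda>i\<in>{..<n}. \<zero>\<^bsub>C\<^esub>, v) \<in> H"
proof -
  let ?z = "\<lambda>i\<in>{..<n}. \<zero>\<^bsub>C\<^esub>"
  have "?z \<in> carrier M" "?z \<oplus>\<^bsub>M\<^esub> ?z = ?z" by (auto simp: carrier_M add_M)
  with H_uminus[OF rel_add_left[of ?z ?z v]] assms show ?thesis by simp
qed

lemma elem_tensor_add:
  assumes "v \<in> carrier P" "v' \<in> carrier P"
  shows "cong (elem_tensor (v \<oplus>\<^bsub>P\<^esub> v')) (elem_tensor v + elem_tensor v')"
  unfolding elem_tensor_def sum.distrib[symmetric]
proof (rule cong_sum)
  fix i assume "i \<in> {..<n}"
  then show "cong (frag_of (unit_vec i, (v \<oplus>\<^bsub>P\<^esub> v') i)) (frag_of (unit_vec i, v i) + frag_of (unit_vec i, v' i))"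
    using rel_add_right[OF unit_vec_closed assms[THEN P_comp], of i i] by (simp add: add_P)
qed simp

lemma elem_tensor_zero: "elem_tensor (\<lambda>i\<in>{..<n}. \<zero>) \<in> H"
  unfolding elem_tensor_def by (rule H_sum) (auto intro: frag_of_zero_right unit_vec_closed)

lemma elem_tensor_diff:
  assumes "v \<in> carrier P" "v' \<in> carrier P"
  shows "cong (elem_tensor v - elem_tensor v') (elem_tensor (\<lambda>i\<in>{..<n}. v i \<ominus> v' i))"
proof -
  let ?w = "\<lambda>i\<in>{..<n}. v i \<ominus> v' i"
  have w: "?w \<in> carrier P" using assms[THEN P_comp] by (simp add: carrier_P)
  have "v i \<ominus> v' i \<oplus> v' i = v i" if "i < n" for i
    using assms[THEN P_comp, OF that] by (simp add: M.minus_eq M.a_assoc M.l_neg)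
  then have "?w \<oplus>\<^bsub>P\<^esub> v' = v"
    using assms(1) by (auto simp: add_P carrier_P PiE_def extensional_def fun_eq_iff)
  with elem_tensor_add[OF w assms(2)] show ?thesis by (simp add: algebra_simps)
qed

lemma elem_tensor_finsum:
  assumes "finite I" "\<And>i. i \<in> I \<Longrightarrow> w i \<in> carrier P"
  shows "cong (\<Sum>i\<in>I. elem_tensor (w i)) (elem_tensor (\<lambda>j\<in>{..<n}. \<Oplus>i\<in>I. w i j))"
  using assms
proof (induction I rule: finite_induct)
  case empty
  then show ?case using H_uminus[OF elem_tensor_zero] by (simp del: restrict_apply)
next
  case (insert i I)
  let ?w = "\<lambda>j\<in>{..<n}. \<Oplus>i\<in>I. w i j"
  have w: "?w \<in> carrier P"
    using insert.prems by (auto simp: carrier_P intro!: M.finsum_closed)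
  have "w i \<oplus>\<^bsub>P\<^esub> ?w = (\<lambda>j\<in>{..<n}. \<Oplus>i\<in>insert i I. w i j)"
    unfolding add_P
  proof (rule restrict_ext)
    fix j assume "j \<in> {..<n}"
    then have "(\<lambda>i. w i j) \<in> I \<rightarrow> carrier N" "w i j \<in> carrier N" "j < n"
      using P_comp[OF insert.prems] by auto
    then show "w i j \<oplus> ?w j = (\<Oplus>i\<in>insert i I. w i j)"
      using insert.hyps by simp
  qed
  moreover have "cong (elem_tensor (w i) + elem_tensor ?w) (elem_tensor (w i \<oplus>\<^bsub>P\<^esub> ?w))"
    using cong_sym[OF elem_tensor_add[OF _ w]] insert.prems by blast
  moreover have "cong (elem_tensor (w i) + (\<Sum>i\<in>I. elem_tensor (w i))) (elem_tensor (w i) + elem_tensor ?w)"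
    using insert.IH insert.prems H_zero by (intro cong_add[of "elem_tensor (w i)"]) (simp_all del: restrict_apply)
  ultimately have "cong (elem_tensor (w i) + (\<Sum>i\<in>I. elem_tensor (w i)))
      (elem_tensor (\<lambda>j\<in>{..<n}. \<Oplus>i\<in>insert i I. w i j))"
    by (metis cong_trans)
  then show ?case using insert.hyps by (simp del: restrict_apply)
qed

text \<open>
  \<open>u \<otimes> v = \<Sum> e\<^sub>i u\<^sub>i \<otimes> v = \<Sum> e\<^sub>i \<otimes> u\<^sub>i v\<close>.
\<close>

lemma frag_of_cong_elem_tensor:
  assumes u: "u \<in> carrier M" and v: "v \<in> carrier N"
  shows "cong (frag_of (u, v)) (elem_tensor (\<lambda>i\<in>{..<n}. u i \<odot> v))"
proof -
  (* t k is u truncated to its first k entries; the entries are moved across one at a time *)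
  define t where "t k = (\<lambda>j\<in>{..<n}. if j < k then u j else \<zero>\<^bsub>C\<^esub>)" for k
  have t: "t k \<in> carrier M" for k
    using M_comp[OF u] by (auto simp: t_def carrier_M)
  have main: "cong (frag_of (t k, v)) (\<Sum>i<k. frag_of (unit_vec i, u i \<odot> v))" if "k \<le> n" for k
    using that
  proof (induction k)
    case 0
    have "t 0 = (\<lambda>i\<in>{..<n}. \<zero>\<^bsub>C\<^esub>)" by (simp add: t_def)
    then show ?case using frag_of_zero_left[OF v] by (simp del: restrict_apply)
  next
    case (Suc k)
    have uk: "u k \<in> carrier C" using Suc.prems u by (intro M_comp) simp_all
    have "t (Suc k) = t k \<oplus>\<^bsub>M\<^esub> rsmult M (unit_vec k) (u k)"
      unfolding add_M t_def
      by (rule restrict_ext)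
        (use M_comp[OF u] uk in \<open>auto simp: rsmult_M unit_vec_def less_Suc_eq\<close>)
    with rel_add_left[OF t M_rsmult_closed[OF unit_vec_closed uk] v]
    have "cong (frag_of (t (Suc k), v)) (frag_of (t k, v) + frag_of (rsmult M (unit_vec k) (u k), v))"
      by simp
    moreover have "cong (frag_of (t k, v) + frag_of (rsmult M (unit_vec k) (u k), v))
       ((\<Sum>i<k. frag_of (unit_vec i, u i \<odot> v)) + frag_of (unit_vec k, u k \<odot> v))"
      using Suc by (intro cong_add rel_balanced[OF unit_vec_closed uk v]) simp_all
    ultimately have "cong (frag_of (t (Suc k), v))
       ((\<Sum>i<k. frag_of (unit_vec i, u i \<odot> v)) + frag_of (unit_vec k, u k \<odot> v))"
      by (rule cong_trans)
    then show ?case by simp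
  qed
  have "t n = u"
    using u by (auto simp: t_def carrier_M PiE_def extensional_def fun_eq_iff)
  then have "cong (frag_of (u, v)) (\<Sum>i<n. frag_of (unit_vec i, u i \<odot> v))"
    using main[of n] by simp
  moreover have "(\<Sum>i<n. frag_of (unit_vec i, u i \<odot> v)) = elem_tensor (\<lambda>i\<in>{..<n}. u i \<odot> v)"
    unfolding elem_tensor_def by (rule sum.cong) simp_all
  ultimately show ?thesis by (simp del: restrict_apply)
qed

lemma smult_comp_closed: "\<lbrakk>u \<in> carrier M; v \<in> carrier N\<rbrakk> \<Longrightarrow> (\<lambda>i\<in>{..<n}. u i \<odot> v) \<in> carrier P"
  using M_comp[of u] by (simp add: carrier_P)

lemma ex_elem_tensor:
  assumes "z \<in> carrier G"
  shows "\<exists>v\<in>carrier P. cong z (elem_tensor v)"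
proof -
  have "Poly_Mapping.keys z \<subseteq> carrier M \<times> carrier N" using assms by simp
  then show ?thesis
  proof (induction rule: frag_induction)
    case zero
    then show ?case
      using H_uminus[OF elem_tensor_zero]
      by (intro bexI[of _ "\<lambda>i\<in>{..<n}. \<zero>"]) (simp_all add: carrier_P del: restrict_apply)
  next
    case (one x)
    then show ?case
      using frag_of_cong_elem_tensor smult_comp_closed by (cases x) blast
  next
    case (diff z z')
    then obtain v v' where v: "v \<in> carrier P" "cong z (elem_tensor v)" and v': "v' \<in> carrier P" "cong z' (elem_tensor v')"
      by blast
    let ?w = "\<lambda>i\<in>{..<n}. v i \<ominus> v' i"
    have "?w \<in> carrier P" using P_comp[OF v(1)] P_comp[OF v'(1)] by (simp add: carrier_P)
    moreover have "cong (z - z') (elem_tensor ?w)"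
      using cong_diff[OF v(2) v'(2)] elem_tensor_diff[OF v(1) v'(1)] by (rule cong_trans)
    ultimately show ?case by blast
  qed
qed

text \<open>
  The \<open>i\<close>-th coordinate \<open>u \<otimes> v \<mapsto> u\<^sub>i v\<close> respects the tensor relations and recovers \<open>v\<^sub>i\<close>
  from \<open>\<Sum> e\<^sub>j \<otimes> v\<^sub>j\<close>.
\<close>

lemma elem_tensor_inj:
  assumes v: "v \<in> carrier P" and v': "v' \<in> carrier P" and "cong (elem_tensor v) (elem_tensor v')"
  shows "v = v'"
proof -
  have "v i = v' i" if i: "i < n" for i
  proof -
    let ?A = "add_monoid N"
    obtain h where h: "h \<in> hom G ?A"
      and h_of: "\<And>x. x \<in> carrier M \<times> carrier N \<Longrightarrow> h (frag_of x) = fst x i \<odot> snd x"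
      by (rule M.add.free_Abelian_group_universal[of "\<lambda>x. fst x i \<odot> snd x" "carrier M \<times> carrier N"])
        (use i M_comp[OF _ i] in \<open>auto\<close>)
    have h_add: "h (x + y) = h x \<oplus> h y" if "x \<in> carrier G" "y \<in> carrier G" for x y
      using hom_mult[OF h that] by simp
    have h_closed: "h x \<in> carrier N" if "x \<in> carrier G" for x
      using hom_in_carrier[OF h that] by simp
    have h_0: "h 0 = \<zero>"
      using hom_one[OF h group_free_Abelian_group M.a_group] by simp
    interpret h: group_hom G ?A h
      using h M.a_group by (simp add: group_hom_def group_hom_axioms_def)
    have "tensor_relations C M N \<subseteq> kernel G ?A h"
    proof
      have eqI: "x - y \<in> kernel G ?A h" if "x \<in> carrier G" "y \<in> carrier G" "h x = h y" for x y
      proof -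
        have "x - y \<in> carrier G" using that keys_diff[of x y] by auto
        moreover have "h (x - y) \<oplus> h y = \<zero> \<oplus> h y"
          using h_add[OF calculation that(2)] that h_closed by simp
        ultimately have "h (x - y) = \<zero>" using that h_closed M.add.r_cancel by blast
        with \<open>x - y \<in> carrier G\<close> show ?thesis by (simp add: kernel_def)
      qed
      fix z assume "z \<in> tensor_relations C M N"
      then consider (1) u u' w where "u \<in> carrier M" "u' \<in> carrier M" "w \<in> carrier N"
          "z = frag_of (u \<oplus>\<^bsub>M\<^esub> u', w) - (frag_of (u, w) + frag_of (u', w))"
        | (2) u w w' where "u \<in> carrier M" "w \<in> carrier N" "w' \<in> carrier N"
          "z = frag_of (u, w \<oplus> w') - (frag_of (u, w) + frag_of (u, w'))"
        | (3) u c w where "u \<in> carrier M" "c \<in> carrier C" "w \<in> carrier N"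
          "z = frag_of (rsmult M u c, w) - frag_of (u, c \<odot> w)"
        unfolding tensor_relations_def by (auto simp: diff_diff_add)
      then show "z \<in> kernel G ?A h"
      proof cases
        case 1
        show ?thesis
          unfolding 1(4)
          by (rule eqI) (use 1 i keys_add[of "frag_of (u, w)" "frag_of (u', w)"] M_comp[OF 1(1) i] M_comp[OF 1(2) i] M_add_closed[OF 1(1,2)] in
            \<open>auto simp: keys_frag_of h_add h_of smult_l_distr\<close>, simp add: add_M smult_l_distr)
      next
        case 2
        show ?thesis
          unfolding 2(4)
          by (rule eqI) (use 2 i keys_add[of "frag_of (u, w)" "frag_of (u, w')"] in \<open>auto simp: keys_frag_of h_add h_of M_comp[OF 2(1) i] smult_r_distr\<close>)
      next
        case 3
        show ?thesis
          unfolding 3(4)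
          by (rule eqI) (use 3 i M_rsmult_closed[OF 3(1,2)] M_comp[OF 3(1) i] in
            \<open>simp_all add: keys_frag_of h_of, simp add: rsmult_M smult_assoc1\<close>)
      qed
    qed
    then have "H \<subseteq> kernel G ?A h"
      by (rule group.generate_subgroup_incl[OF group_free_Abelian_group _ h.subgroup_kernel])
    then have hH: "h z = \<zero>" if "z \<in> H" for z using that by (auto simp: kernel_def)
    have T_closed: "(\<Sum>j<k. frag_of (unit_vec j, w j)) \<in> carrier G" if "w \<in> carrier P" "k \<le> n" for k w
      using that P_comp[OF that(1)]
      by (intro sum_closed_free_Abelian_group) (auto simp: keys_frag_of unit_vec_closed)
    have hT: "h (\<Sum>j<k. frag_of (unit_vec j, w j)) = (if i < k then w i else \<zero>)"
      if w: "w \<in> carrier P" and "k \<le> n" for k w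
      using \<open>k \<le> n\<close>
    proof (induction k)
      case 0
      then show ?case by (simp add: h_0)
    next
      case (Suc k)
      have "h (\<Sum>j<Suc k. frag_of (unit_vec j, w j)) = (if i < k then w i else \<zero>) \<oplus> (unit_vec k i \<odot> w k)"
        using Suc T_closed[OF w, of k] P_comp[OF w, of k]
        by (simp add: h_add h_of unit_vec_closed keys_frag_of)
      also have "\<dots> = (if i < Suc k then w i else \<zero>)"
        using Suc.prems i P_comp[OF w, of k] P_comp[OF w i] by (auto simp: unit_vec_def less_Suc_eq)
      finally show ?case .
    qed
    have "elem_tensor v' \<in> carrier G"
      unfolding elem_tensor_def using T_closed[OF v', of n] by simp
    with h_add[OF H_closed[OF assms(3)], of "elem_tensor v'"]
    have "h (elem_tensor v) = h (elem_tensor v - elem_tensor v') \<oplus> h (elem_tensor v')"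
      by (simp only: diff_add_cancel)
    then show ?thesis
      using hT[OF v, of n] hT[OF v', of n] hH[OF assms(3)] i P_comp[OF v' i] by (simp add: elem_tensor_def)
  qed
  then show ?thesis
    using PiE_ext[OF v[unfolded carrier_P] v'[unfolded carrier_P]] by simp
qed

lemma smult_stable:
  assumes a: "a \<in> carrier A" and "z \<in> H"
  shows "frag_extend (\<lambda>(u, v). frag_of (a \<odot>\<^bsub>M\<^esub> u, v)) z \<in> H" (is "?f z \<in> H")
proof -
  have M1: "a \<odot>\<^bsub>M\<^esub> (u \<oplus>\<^bsub>M\<^esub> u') = (a \<odot>\<^bsub>M\<^esub> u) \<oplus>\<^bsub>M\<^esub> (a \<odot>\<^bsub>M\<^esub> u')" if "u \<in> carrier M" "u' \<in> carrier M" for u u'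
    unfolding add_M smult_M
  proof (rule restrict_ext)
    fix i assume "i \<in> {..<n}"
    then have i: "i < n" by simp
    have "(\<Oplus>\<^bsub>C\<^esub>j\<in>{..<n}. \<mu> a i j \<otimes>\<^bsub>C\<^esub> (\<lambda>i\<in>{..<n}. u i \<oplus>\<^bsub>C\<^esub> u' i) j)
      = (\<Oplus>\<^bsub>C\<^esub>j\<in>{..<n}. \<mu> a i j \<otimes>\<^bsub>C\<^esub> u j \<oplus>\<^bsub>C\<^esub> \<mu> a i j \<otimes>\<^bsub>C\<^esub> u' j)"
      using that a i M_comp[OF that(1)] M_comp[OF that(2)] by (intro R.finsum_cong') (auto simp: \<mu>_closed R.r_distr)
    also have "\<dots> = (\<Oplus>\<^bsub>C\<^esub>j\<in>{..<n}. \<mu> a i j \<otimes>\<^bsub>C\<^esub> u j) \<oplus>\<^bsub>C\<^esub> (\<Oplus>\<^bsub>C\<^esub>j\<in>{..<n}. \<mu> a i j \<otimes>\<^bsub>C\<^esub> u' j)"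
      using that a i M_comp[OF that(1)] M_comp[OF that(2)] by (intro R.finsum_addf) (auto simp: \<mu>_closed)
    finally show "(\<Oplus>\<^bsub>C\<^esub>j\<in>{..<n}. \<mu> a i j \<otimes>\<^bsub>C\<^esub> (\<lambda>i\<in>{..<n}. u i \<oplus>\<^bsub>C\<^esub> u' i) j) =
      (\<lambda>i\<in>{..<n}. \<Oplus>\<^bsub>C\<^esub>j\<in>{..<n}. \<mu> a i j \<otimes>\<^bsub>C\<^esub> u j) i \<oplus>\<^bsub>C\<^esub> (\<lambda>i\<in>{..<n}. \<Oplus>\<^bsub>C\<^esub>j\<in>{..<n}. \<mu> a i j \<otimes>\<^bsub>C\<^esub> u' j) i"
      using i by simp
  qed
  have M2: "a \<odot>\<^bsub>M\<^esub> rsmult M u c = rsmult M (a \<odot>\<^bsub>M\<^esub> u) c" if "u \<in> carrier M" "c \<in> carrier C" for u c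
    unfolding rsmult_M smult_M
  proof (rule restrict_ext)
    fix i assume "i \<in> {..<n}"
    then have i: "i < n" by simp
    have "(\<Oplus>\<^bsub>C\<^esub>j\<in>{..<n}. \<mu> a i j \<otimes>\<^bsub>C\<^esub> (\<lambda>i\<in>{..<n}. u i \<otimes>\<^bsub>C\<^esub> c) j)
      = (\<Oplus>\<^bsub>C\<^esub>j\<in>{..<n}. \<mu> a i j \<otimes>\<^bsub>C\<^esub> u j \<otimes>\<^bsub>C\<^esub> c)"
      using that a i M_comp[OF that(1)] by (intro R.finsum_cong') (auto simp: \<mu>_closed R.m_assoc)
    also have "\<dots> = (\<Oplus>\<^bsub>C\<^esub>j\<in>{..<n}. \<mu> a i j \<otimes>\<^bsub>C\<^esub> u j) \<otimes>\<^bsub>C\<^esub> c"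
      using that a i M_comp[OF that(1)] by (intro R.finsum_ldistr[symmetric]) (auto simp: \<mu>_closed)
    finally show "(\<Oplus>\<^bsub>C\<^esub>j\<in>{..<n}. \<mu> a i j \<otimes>\<^bsub>C\<^esub> (\<lambda>i\<in>{..<n}. u i \<otimes>\<^bsub>C\<^esub> c) j) =
      (\<lambda>i\<in>{..<n}. \<Oplus>\<^bsub>C\<^esub>j\<in>{..<n}. \<mu> a i j \<otimes>\<^bsub>C\<^esub> u j) i \<otimes>\<^bsub>C\<^esub> c"
      using i by simp
  qed
  have rel: "?f z \<in> H" if "z \<in> tensor_relations C M N" for z
  proof -
    from that consider (1) u u' w where "u \<in> carrier M" "u' \<in> carrier M" "w \<in> carrier N"
        "z = frag_of (u \<oplus>\<^bsub>M\<^esub> u', w) - (frag_of (u, w) + frag_of (u', w))"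
      | (2) u w w' where "u \<in> carrier M" "w \<in> carrier N" "w' \<in> carrier N"
        "z = frag_of (u, w \<oplus> w') - (frag_of (u, w) + frag_of (u, w'))"
      | (3) u c w where "u \<in> carrier M" "c \<in> carrier C" "w \<in> carrier N"
        "z = frag_of (rsmult M u c, w) - frag_of (u, c \<odot> w)"
      unfolding tensor_relations_def by (auto simp: diff_diff_add)
    then show ?thesis
    proof cases
      case 1
      then show ?thesis
        using rel_add_left[OF M_smult_closed[OF a] M_smult_closed[OF a]]
        by (simp add: frag_extend_diff frag_extend_add M1)
    next
      case 2
      then show ?thesis
        using rel_add_right[OF M_smult_closed[OF a]]
        by (simp add: frag_extend_diff frag_extend_add)
    next
      case 3
      then show ?thesis
        using rel_balanced[OF M_smult_closed[OF a]]
        by (simp add: frag_extend_diff M2)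
    qed
  qed
  show ?thesis
    using \<open>z \<in> H\<close>
  proof (induction rule: generate.induct)
    case one
    then show ?case by (simp add: H_zero)
  next
    case (incl h)
    then show ?case by (rule rel)
  next
    case (inv h)
    then have "h \<in> carrier G" using relations_subset by blast
    with rel[OF inv] show ?case by (simp add: frag_extend_minus H_uminus)
  next
    case (eng h1 h2)
    then show ?case by (simp add: frag_extend_add H_add)
  qed
qed

lemma elem_tensor_smult:
  assumes a: "a \<in> carrier A" and v: "v \<in> carrier P"
  shows "cong (frag_extend (\<lambda>(u, v). frag_of (a \<odot>\<^bsub>M\<^esub> u, v)) (elem_tensor v)) (elem_tensor (a \<odot>\<^bsub>P\<^esub> v))"
proof -
  let ?w = "\<lambda>i. \<lambda>j\<in>{..<n}. (a \<odot>\<^bsub>M\<^esub> unit_vec i) j \<odot> v i"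
  have "frag_extend (\<lambda>(u, v). frag_of (a \<odot>\<^bsub>M\<^esub> u, v)) (elem_tensor v) =
      (\<Sum>i<n. frag_of (a \<odot>\<^bsub>M\<^esub> unit_vec i, v i))"
    unfolding elem_tensor_def by (simp add: frag_extend_sum)
  moreover have "cong (\<Sum>i<n. frag_of (a \<odot>\<^bsub>M\<^esub> unit_vec i, v i)) (\<Sum>i<n. elem_tensor (?w i))"
    by (rule cong_sum)
      (auto intro!: frag_of_cong_elem_tensor M_smult_closed[OF a] unit_vec_closed P_comp[OF v])
  moreover have "cong (\<Sum>i<n. elem_tensor (?w i)) (elem_tensor (\<lambda>j\<in>{..<n}. \<Oplus>i\<in>{..<n}. ?w i j))"
    by (rule elem_tensor_finsum)
      (auto intro!: smult_comp_closed M_smult_closed[OF a] unit_vec_closed P_comp[OF v] simp del: restrict_apply)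
  moreover have "(\<lambda>j\<in>{..<n}. \<Oplus>i\<in>{..<n}. ?w i j) = a \<odot>\<^bsub>P\<^esub> v"
    unfolding smult_P
    by (rule restrict_ext, rule M.finsum_cong')
      (auto simp: smult_unit_vec[OF a] intro!: smult_closed \<mu>_closed[OF a] P_comp[OF v])
  ultimately show ?thesis by (metis (no_types, lifting) cong_trans)
qed

text \<open>
  \<open>C\<^sup>n \<otimes> N\<close> is \<open>N\<^sup>n\<close>, via \<open>v \<mapsto> \<Sum> e\<^sub>i \<otimes> v\<^sub>i\<close>.
\<close>

theorem tensor_product_iso: "lin_iso A P (tensor_product C M N)"
proof -
  let ?T = "tensor_product C M N"
  interpret H: normal H G
    by (rule comm_group.normal_iff_subgroup[THEN iffD2, OF abelian_free_Abelian_group subgroup_H])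
  have carrier_T: "carrier ?T = {H #>\<^bsub>G\<^esub> z | z. z \<in> carrier G}"
    unfolding tensor_product_def Let_def FactGroup_def RCOSETS_def by auto
  have add_T: "(H #>\<^bsub>G\<^esub> z) \<oplus>\<^bsub>?T\<^esub> (H #>\<^bsub>G\<^esub> z') = H #>\<^bsub>G\<^esub> (z + z')" if "z \<in> carrier G" "z' \<in> carrier G" for z z'
    using H.rcos_sum[OF that] by (simp add: tensor_product_def Let_def FactGroup_def)
  have smult_T: "a \<odot>\<^bsub>?T\<^esub> U = (\<Union>z\<in>U. H #>\<^bsub>G\<^esub> frag_extend (\<lambda>(u, v). frag_of (a \<odot>\<^bsub>M\<^esub> u, v)) z)" for a U
    by (simp add: tensor_product_def Let_def)
  have T_closed: "elem_tensor w \<in> carrier G" if "w \<in> carrier P" for w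
    unfolding elem_tensor_def using P_comp[OF that]
    by (intro sum_closed_free_Abelian_group) (auto simp: keys_frag_of unit_vec_closed)
  have P_add: "v \<oplus>\<^bsub>P\<^esub> v' \<in> carrier P" if "v \<in> carrier P" "v' \<in> carrier P" for v v'
    unfolding add_P using that by (auto simp: carrier_P)
  have P_smult: "a \<odot>\<^bsub>P\<^esub> v \<in> carrier P" if "a \<in> carrier A" "v \<in> carrier P" for a v
    unfolding smult_P using \<mu>_closed[OF that(1)] P_comp[OF that(2)] by (simp add: carrier_P Pi_iff)
  define \<psi> where "\<psi> = (\<lambda>v\<in>carrier P. H #>\<^bsub>G\<^esub> elem_tensor v)"
  have "\<psi> \<in> lin_maps A P ?T"
    unfolding lin_maps_def mem_Collect_eq
  proof (intro conjI ballI)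
    show "\<psi> \<in> carrier P \<rightarrow>\<^sub>E carrier ?T"
      unfolding \<psi>_def carrier_T using T_closed by auto
  next
    fix v v' assume v: "v \<in> carrier P" "v' \<in> carrier P"
    have "H #>\<^bsub>G\<^esub> elem_tensor (v \<oplus>\<^bsub>P\<^esub> v') = H #>\<^bsub>G\<^esub> (elem_tensor v + elem_tensor v')"
      unfolding coset_eq_iff by (rule elem_tensor_add[OF v])
    then show "\<psi> (v \<oplus>\<^bsub>P\<^esub> v') = \<psi> v \<oplus>\<^bsub>?T\<^esub> \<psi> v'"
      using v by (simp add: \<psi>_def P_add add_T T_closed del: carrier_free_Abelian_group_iff)
  next
    fix a v assume a: "a \<in> carrier A" and v: "v \<in> carrier P"
    let ?f = "frag_extend (\<lambda>(u, v). frag_of (a \<odot>\<^bsub>M\<^esub> u, v))"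
    have "H #>\<^bsub>G\<^esub> ?f z = H #>\<^bsub>G\<^esub> elem_tensor (a \<odot>\<^bsub>P\<^esub> v)" if z: "z \<in> H #>\<^bsub>G\<^esub> elem_tensor v" for z
    proof -
      from z obtain h where h: "h \<in> H" "z = h + elem_tensor v" unfolding coset by blast
      have "cong (?f z) (?f (elem_tensor v))"
        using smult_stable[OF a h(1)] by (simp add: h(2) frag_extend_add)
      then show ?thesis
        unfolding coset_eq_iff using elem_tensor_smult[OF a v] by (rule cong_trans)
    qed
    moreover have "elem_tensor v \<in> H #>\<^bsub>G\<^esub> elem_tensor v" unfolding coset using H_zero by force
    ultimately have "a \<odot>\<^bsub>?T\<^esub> (H #>\<^bsub>G\<^esub> elem_tensor v) = H #>\<^bsub>G\<^esub> elem_tensor (a \<odot>\<^bsub>P\<^esub> v)"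
      unfolding smult_T by blast
    then show "\<psi> (a \<odot>\<^bsub>P\<^esub> v) = a \<odot>\<^bsub>?T\<^esub> \<psi> v"
      using a v by (simp add: \<psi>_def P_smult)
  qed
  moreover have "bij_betw \<psi> (carrier P) (carrier ?T)"
    unfolding bij_betw_def
  proof
    show "inj_on \<psi> (carrier P)"
      by (rule inj_onI) (simp add: \<psi>_def coset_eq_iff elem_tensor_inj)
    show "\<psi> ` carrier P = carrier ?T"
    proof (rule equalityI)
      show "\<psi> ` carrier P \<subseteq> carrier ?T" unfolding \<psi>_def carrier_T using T_closed by auto
      show "carrier ?T \<subseteq> \<psi> ` carrier P"
      proof
        fix U assume "U \<in> carrier ?T"
        then obtain z where z: "z \<in> carrier G" "U = H #>\<^bsub>G\<^esub> z" unfolding carrier_T by blast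
        from ex_elem_tensor[OF z(1)] obtain v where "v \<in> carrier P" "cong z (elem_tensor v)" ..
        then have "U = \<psi> v" unfolding z(2) \<psi>_def using coset_eq_iff by simp
        with \<open>v \<in> carrier P\<close> show "U \<in> \<psi> ` carrier P" by blast
      qed
    qed
  qed
  ultimately show ?thesis unfolding lin_iso_def by blast
qed

end

section \<open>Evaluation of noncommutative polynomials\<close>

text \<open>
  Substitution of elements \<open>y\<^sub>l\<close> of a ring for the noncommuting variables, with central scalars.  It
  is used twice: for the generators of the algebra and for the generic matrices.
\<close>

locale word_evaluation = ring R for R :: "('b, 's) ring_scheme" (structure) +
  fixes \<sigma> :: "'k::field \<Rightarrow> 'b" and r :: nat and y :: "nat \<Rightarrow> 'b"
  assumes \<sigma>_hom: "\<sigma> \<in> ring_hom (ring_of_type_algebra :: 'k ring) R"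
    and \<sigma>_central: "b \<in> carrier R \<Longrightarrow> \<sigma> c \<otimes> b = b \<otimes> \<sigma> c"
    and y_closed: "l < r \<Longrightarrow> y l \<in> carrier R"
begin

definition monomial :: "nat list \<Rightarrow> 'b" where
  "monomial w = foldr (\<lambda>l z. y l \<otimes> z) w \<one>"

lemma \<sigma>_closed: "\<sigma> c \<in> carrier R"
  using \<sigma>_hom by (auto simp: ring_hom_def ring_of_type_algebra_def)

lemma \<sigma>_add: "\<sigma> (c + d) = \<sigma> c \<oplus> \<sigma> d"
  and \<sigma>_mult: "\<sigma> (c * d) = \<sigma> c \<otimes> \<sigma> d"
  and \<sigma>_one: "\<sigma> 1 = \<one>"
  using \<sigma>_hom by (auto simp: ring_hom_def ring_of_type_algebra_def)

lemma \<sigma>_zero: "\<sigma> 0 = \<zero>"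
  using \<sigma>_add[of 0 0] \<sigma>_closed[of 0] by (metis add.l_cancel_one' add_0)

lemma monomial_closed: "set w \<subseteq> {..<r} \<Longrightarrow> monomial w \<in> carrier R"
  by (induction w) (auto simp: monomial_def y_closed)

lemma monomial_append:
  "\<lbrakk>set u \<subseteq> {..<r}; set w \<subseteq> {..<r}\<rbrakk> \<Longrightarrow> monomial (u @ w) = monomial u \<otimes> monomial w"
proof (induction u)
  case Nil
  then show ?case using monomial_closed[of w] by (simp add: monomial_def)
next
  case (Cons l u)
  then have "monomial (u @ w) = monomial u \<otimes> monomial w" "y l \<in> carrier R"
    "monomial u \<in> carrier R" "monomial w \<in> carrier R"
    by (auto intro: monomial_closed y_closed)
  then show ?case by (simp add: monomial_def m_assoc)
qed

lemma nc_eval_superset: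
  assumes "finite S" "Poly_Mapping.keys q \<subseteq> S" "\<And>w. w \<in> S \<Longrightarrow> set w \<subseteq> {..<r}"
  shows "nc_eval R \<sigma> y q = (\<Oplus>w\<in>S. \<sigma> (Poly_Mapping.lookup q w) \<otimes> monomial w)"
  unfolding nc_eval_def monomial_def[symmetric]
proof (rule add.finprod_mono_neutral_cong_left)
  show "\<sigma> (Poly_Mapping.lookup q w) \<otimes> monomial w = \<zero>" if "w \<in> S - Poly_Mapping.keys q" for w
    using that monomial_closed[OF assms(3), of w] by (simp add: in_keys_iff \<sigma>_zero)
  show "(\<lambda>w. \<sigma> (Poly_Mapping.lookup q w) \<otimes> monomial w) \<in> S \<rightarrow> carrier R"
    using monomial_closed[OF assms(3)] \<sigma>_closed by auto
qed (use assms in auto)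

lemma nc_eval_closed:
  assumes "q \<in> free_algebra r"
  shows "nc_eval R \<sigma> y q \<in> carrier R"
proof -
  have "set w \<subseteq> {..<r}" if "w \<in> Poly_Mapping.keys q" for w
    using assms that by (auto simp: free_algebra_def)
  then show ?thesis
    unfolding nc_eval_def monomial_def[symmetric]
    using monomial_closed \<sigma>_closed by (intro finsum_closed) auto
qed

lemma nc_eval_add:
  assumes "q \<in> free_algebra r" "q' \<in> free_algebra r"
  shows "nc_eval R \<sigma> y (q + q') = nc_eval R \<sigma> y q \<oplus> nc_eval R \<sigma> y q'"
proof -
  let ?S = "Poly_Mapping.keys q \<union> Poly_Mapping.keys q'"
  have w: "set w \<subseteq> {..<r}" if "w \<in> ?S" for w using assms that by (auto simp: free_algebra_def)
  have mon: "monomial w \<in> carrier R" if "w \<in> ?S" for w using monomial_closed[OF w[OF that]] .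
  have "nc_eval R \<sigma> y (q + q') = (\<Oplus>w\<in>?S. \<sigma> (Poly_Mapping.lookup (q + q') w) \<otimes> monomial w)"
    using w keys_add[of q q'] by (intro nc_eval_superset) auto
  also have "\<dots> = (\<Oplus>w\<in>?S. \<sigma> (Poly_Mapping.lookup q w) \<otimes> monomial w \<oplus> \<sigma> (Poly_Mapping.lookup q' w) \<otimes> monomial w)"
    using mon \<sigma>_closed by (intro finsum_cong') (auto simp: lookup_add \<sigma>_add l_distr)
  also have "\<dots> = (\<Oplus>w\<in>?S. \<sigma> (Poly_Mapping.lookup q w) \<otimes> monomial w) \<oplus> (\<Oplus>w\<in>?S. \<sigma> (Poly_Mapping.lookup q' w) \<otimes> monomial w)"
    using mon \<sigma>_closed by (intro finsum_addf) auto
  also have "\<dots> = nc_eval R \<sigma> y q \<oplus> nc_eval R \<sigma> y q'"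
    using w nc_eval_superset[of ?S q] nc_eval_superset[of ?S q'] by simp
  finally show ?thesis .
qed

lemma nc_eval_zero: "nc_eval R \<sigma> y 0 = \<zero>"
  by (simp add: nc_eval_def)

lemma nc_eval_single:
  assumes "set w \<subseteq> {..<r}"
  shows "nc_eval R \<sigma> y (Poly_Mapping.single w c) = \<sigma> c \<otimes> monomial w"
  using assms nc_eval_superset[of "{w}" "Poly_Mapping.single w c"] monomial_closed[OF assms] \<sigma>_closed
  by simp

end

lemma free_algebra_zero: "0 \<in> free_algebra r"
  by (simp add: free_algebra_def)

lemma free_algebra_add: "\<lbrakk>q \<in> free_algebra r; q' \<in> free_algebra r\<rbrakk> \<Longrightarrow> q + q' \<in> free_algebra r"
  for q q' :: "nat list \<Rightarrow>\<^sub>0 'k::field"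
  using keys_add[of q q'] by (auto simp: free_algebra_def)

lemma free_algebra_diff: "\<lbrakk>q \<in> free_algebra r; q' \<in> free_algebra r\<rbrakk> \<Longrightarrow> q - q' \<in> free_algebra r"
  for q q' :: "nat list \<Rightarrow>\<^sub>0 'k::field"
proof -
  assume "q \<in> free_algebra r" "q' \<in> free_algebra r"
  moreover have "Poly_Mapping.keys (q - q') \<subseteq> Poly_Mapping.keys q \<union> Poly_Mapping.keys q'"
    by (auto simp: in_keys_iff lookup_minus)
  ultimately show ?thesis by (auto simp: free_algebra_def)
qed

lemma free_algebra_single: "set w \<subseteq> {..<r} \<Longrightarrow> Poly_Mapping.single w c \<in> free_algebra r"
  by (auto simp: free_algebra_def split: if_splits)

lemma free_algebra_sum:
  "\<lbrakk>finite I; \<And>i. i \<in> I \<Longrightarrow> f i \<in> free_algebra r\<rbrakk> \<Longrightarrow> sum f I \<in> free_algebra r"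
  for f :: "'i \<Rightarrow> nat list \<Rightarrow>\<^sub>0 'k::field"
  by (induction I rule: finite_induct) (auto simp: free_algebra_zero free_algebra_add)

text \<open>
  The product of the free algebra: words multiply by concatenation, whereas the product of
  polynomial mappings adds their keys.
\<close>

definition concat_mult :: "(nat list \<Rightarrow>\<^sub>0 'k::field) \<Rightarrow> (nat list \<Rightarrow>\<^sub>0 'k) \<Rightarrow> nat list \<Rightarrow>\<^sub>0 'k" where
  "concat_mult p q = (\<Sum>u\<in>Poly_Mapping.keys p. \<Sum>w\<in>Poly_Mapping.keys q.
     Poly_Mapping.single (u @ w) (Poly_Mapping.lookup p u * Poly_Mapping.lookup q w))"

lemma free_algebra_concat_mult:
  "\<lbrakk>p \<in> free_algebra r; q \<in> free_algebra r\<rbrakk> \<Longrightarrow> concat_mult p q \<in> free_algebra r"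
  unfolding concat_mult_def
  by (intro free_algebra_sum free_algebra_single) (auto simp: free_algebra_def)

context word_evaluation
begin

lemma nc_eval_diff:
  assumes "q \<in> free_algebra r" "q' \<in> free_algebra r"
  shows "nc_eval R \<sigma> y (q - q') = nc_eval R \<sigma> y q \<ominus> nc_eval R \<sigma> y q'"
proof -
  note c = nc_eval_closed[OF assms(1)] nc_eval_closed[OF assms(2)] nc_eval_closed[OF free_algebra_diff[OF assms]]
  have "nc_eval R \<sigma> y q = nc_eval R \<sigma> y (q - q') \<oplus> nc_eval R \<sigma> y q'"
    using nc_eval_add[OF free_algebra_diff[OF assms] assms(2)] by simp
  then show ?thesis using c by (simp add: minus_eq a_assoc r_neg)
qed

lemma nc_eval_sum:
  "\<lbrakk>finite I; \<And>i. i \<in> I \<Longrightarrow> f i \<in> free_algebra r\<rbrakk> \<Longrightarrow>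
    nc_eval R \<sigma> y (sum f I) = (\<Oplus>i\<in>I. nc_eval R \<sigma> y (f i))"
proof (induction I rule: finite_induct)
  case (insert i I)
  then have "(\<lambda>i. nc_eval R \<sigma> y (f i)) \<in> I \<rightarrow> carrier R" "nc_eval R \<sigma> y (f i) \<in> carrier R"
    using nc_eval_closed by auto
  with insert show ?case
    by (simp add: nc_eval_add free_algebra_sum)
qed (simp add: nc_eval_zero)

lemma nc_eval_concat_mult:
  assumes p: "p \<in> free_algebra r" and q: "q \<in> free_algebra r"
  shows "nc_eval R \<sigma> y (concat_mult p q) = nc_eval R \<sigma> y p \<otimes> nc_eval R \<sigma> y q"
proof -
  let ?p = "Poly_Mapping.lookup p" and ?q = "Poly_Mapping.lookup q"
  have up: "set u \<subseteq> {..<r}" if "u \<in> Poly_Mapping.keys p" for u using p that by (auto simp: free_algebra_def)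
  have wq: "set w \<subseteq> {..<r}" if "w \<in> Poly_Mapping.keys q" for w using q that by (auto simp: free_algebra_def)
  note mu = monomial_closed[OF up] and mw = monomial_closed[OF wq]
  have fa: "Poly_Mapping.single (u @ w) (?p u * ?q w) \<in> free_algebra r"
    if "u \<in> Poly_Mapping.keys p" "w \<in> Poly_Mapping.keys q" for u w
    using up[OF that(1)] wq[OF that(2)] by (intro free_algebra_single) auto
  have prod_term: "nc_eval R \<sigma> y (Poly_Mapping.single (u @ w) (?p u * ?q w)) =
      (\<sigma> (?p u) \<otimes> monomial u) \<otimes> (\<sigma> (?q w) \<otimes> monomial w)"
    if u: "u \<in> Poly_Mapping.keys p" and w: "w \<in> Poly_Mapping.keys q" for u w
  proof -
    have "nc_eval R \<sigma> y (Poly_Mapping.single (u @ w) (?p u * ?q w)) =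
        (\<sigma> (?p u) \<otimes> \<sigma> (?q w)) \<otimes> (monomial u \<otimes> monomial w)"
      using up[OF u] wq[OF w] by (subst nc_eval_single) (auto simp: \<sigma>_mult monomial_append)
    also have "\<dots> = \<sigma> (?p u) \<otimes> (\<sigma> (?q w) \<otimes> monomial u) \<otimes> monomial w"
      using mu[OF u] mw[OF w] \<sigma>_closed by (simp add: m_assoc)
    also have "\<dots> = \<sigma> (?p u) \<otimes> (monomial u \<otimes> \<sigma> (?q w)) \<otimes> monomial w"
      using \<sigma>_central[OF mu[OF u]] by simp
    also have "\<dots> = (\<sigma> (?p u) \<otimes> monomial u) \<otimes> (\<sigma> (?q w) \<otimes> monomial w)"
      using mu[OF u] mw[OF w] \<sigma>_closed by (simp add: m_assoc)
    finally show ?thesis .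
  qed
  have eq: "nc_eval R \<sigma> y q = (\<Oplus>w\<in>Poly_Mapping.keys q. \<sigma> (?q w) \<otimes> monomial w)"
    by (simp add: nc_eval_def monomial_def)
  have ep: "nc_eval R \<sigma> y p = (\<Oplus>u\<in>Poly_Mapping.keys p. \<sigma> (?p u) \<otimes> monomial u)"
    by (simp add: nc_eval_def monomial_def)
  have "nc_eval R \<sigma> y (concat_mult p q) =
      (\<Oplus>u\<in>Poly_Mapping.keys p. nc_eval R \<sigma> y (\<Sum>w\<in>Poly_Mapping.keys q. Poly_Mapping.single (u @ w) (?p u * ?q w)))"
    unfolding concat_mult_def using fa by (intro nc_eval_sum free_algebra_sum) auto
  also have "\<dots> = (\<Oplus>u\<in>Poly_Mapping.keys p. (\<sigma> (?p u) \<otimes> monomial u) \<otimes> nc_eval R \<sigma> y q)"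
  proof (rule finsum_cong'[OF refl])
    show "(\<lambda>u. (\<sigma> (?p u) \<otimes> monomial u) \<otimes> nc_eval R \<sigma> y q) \<in> Poly_Mapping.keys p \<rightarrow> carrier R"
      using mu \<sigma>_closed nc_eval_closed[OF q] by auto
    fix u assume u: "u \<in> Poly_Mapping.keys p"
    have "nc_eval R \<sigma> y (\<Sum>w\<in>Poly_Mapping.keys q. Poly_Mapping.single (u @ w) (?p u * ?q w)) =
        (\<Oplus>w\<in>Poly_Mapping.keys q. nc_eval R \<sigma> y (Poly_Mapping.single (u @ w) (?p u * ?q w)))"
      using fa[OF u] by (intro nc_eval_sum) auto
    also have "\<dots> = (\<Oplus>w\<in>Poly_Mapping.keys q. (\<sigma> (?p u) \<otimes> monomial u) \<otimes> (\<sigma> (?q w) \<otimes> monomial w))"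
      using mu[OF u] mw \<sigma>_closed prod_term[OF u] by (intro finsum_cong') auto
    also have "\<dots> = (\<sigma> (?p u) \<otimes> monomial u) \<otimes> nc_eval R \<sigma> y q"
      unfolding eq using mu[OF u] mw \<sigma>_closed by (intro finsum_rdistr[symmetric]) auto
    finally show "nc_eval R \<sigma> y (\<Sum>w\<in>Poly_Mapping.keys q. Poly_Mapping.single (u @ w) (?p u * ?q w)) =
      (\<sigma> (?p u) \<otimes> monomial u) \<otimes> nc_eval R \<sigma> y q" .
  qed
  also have "\<dots> = nc_eval R \<sigma> y p \<otimes> nc_eval R \<sigma> y q"
    unfolding ep using mu \<sigma>_closed nc_eval_closed[OF q] by (intro finsum_ldistr[symmetric]) auto
  finally show ?thesis .
qed

lemma nc_eval_one: "nc_eval R \<sigma> y (Poly_Mapping.single [] 1) = \<one>"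
  by (simp add: nc_eval_single \<sigma>_one monomial_def)

lemma nc_eval_in_subring:
  assumes "q \<in> free_algebra r" and Q: "Q \<subseteq> carrier R" "\<zero> \<in> Q" "\<one> \<in> Q"
    "\<And>a b. \<lbrakk>a \<in> Q; b \<in> Q\<rbrakk> \<Longrightarrow> a \<oplus> b \<in> Q" "\<And>a b. \<lbrakk>a \<in> Q; b \<in> Q\<rbrakk> \<Longrightarrow> a \<otimes> b \<in> Q"
    and \<sigma>: "\<And>c. \<sigma> c \<in> Q" and y: "\<And>l. l < r \<Longrightarrow> y l \<in> Q"
  shows "nc_eval R \<sigma> y q \<in> Q"
proof -
  have mon: "monomial w \<in> Q" if "set w \<subseteq> {..<r}" for w
    using that by (induction w) (auto simp: monomial_def Q y)
  have fin: "finsum R f I \<in> Q" if "finite I" "\<And>i. i \<in> I \<Longrightarrow> f i \<in> Q" for f :: "'i \<Rightarrow> 'b" and I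
    using that
  proof (induction I rule: finite_induct)
    case (insert i I)
    then have "f i \<in> Q" "finsum R f I \<in> Q" "f \<in> I \<rightarrow> carrier R" "f i \<in> carrier R" using Q(1) by auto
    with insert.hyps Q(4) show ?case by simp
  qed (simp add: Q)
  show ?thesis
    unfolding nc_eval_def monomial_def[symmetric]
    using assms(1) by (intro fin Q \<sigma> mon) (auto simp: free_algebra_def)
qed

end

definition entry_polys :: "nat \<Rightarrow> nat \<Rightarrow> ('k::field entry_poly) set" where
  "entry_polys r n = {f. \<forall>m\<in>Poly_Mapping.keys f. Poly_Mapping.keys m \<subseteq> {..<r} \<times> {..<n} \<times> {..<n}}"

lemma entry_polys_zero: "0 \<in> entry_polys r n"
  and entry_polys_one: "1 \<in> entry_polys r n"
  and entry_polys_const: "Poly_Mapping.single 0 c \<in> entry_polys r n"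
  by (auto simp: entry_polys_def)

lemma entry_polys_add: "\<lbrakk>f \<in> entry_polys r n; g \<in> entry_polys r n\<rbrakk> \<Longrightarrow> f + g \<in> entry_polys r n"
  using keys_add[of f g] by (auto simp: entry_polys_def)

lemma entry_polys_uminus: "f \<in> entry_polys r n \<Longrightarrow> - f \<in> entry_polys r n"
  by (auto simp: entry_polys_def in_keys_iff)

lemma entry_polys_mult:
  assumes "f \<in> entry_polys r n" "g \<in> entry_polys r n"
  shows "f * g \<in> entry_polys r n"
  unfolding entry_polys_def mem_Collect_eq
proof
  fix m assume "m \<in> Poly_Mapping.keys (f * g)"
  then obtain a b where ab: "a \<in> Poly_Mapping.keys f" "b \<in> Poly_Mapping.keys g" "m = a + b"
    using keys_mult[of f g] by blast
  then show "Poly_Mapping.keys m \<subseteq> {..<r} \<times> {..<n} \<times> {..<n}"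
    using assms keys_add[of a b] unfolding entry_polys_def by blast
qed

lemma entry_polys_sum: "(\<And>i. i \<in> I \<Longrightarrow> f i \<in> entry_polys r n) \<Longrightarrow> sum f I \<in> entry_polys r n"
  by (induction I rule: infinite_finite_induct) (auto simp: entry_polys_zero entry_polys_add)

lemma entry_ring_simps:
  "carrier (entry_ring r n) = entry_polys r n"
  "f \<oplus>\<^bsub>entry_ring r n\<^esub> g = f + g" "f \<otimes>\<^bsub>entry_ring r n\<^esub> g = f * g"
  "\<zero>\<^bsub>entry_ring r n\<^esub> = 0" "\<one>\<^bsub>entry_ring r n\<^esub> = 1"
  by (simp_all add: entry_ring_def ring_of_type_algebra_def entry_polys_def)

lemma cring_entry_ring: "cring (entry_ring r n)"
proof (rule cringI)
  show "abelian_group (entry_ring r n)"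
  proof (rule abelian_groupI)
    fix f assume "f \<in> carrier (entry_ring r n)"
    then show "\<exists>g\<in>carrier (entry_ring r n). g \<oplus>\<^bsub>entry_ring r n\<^esub> f = \<zero>\<^bsub>entry_ring r n\<^esub>"
      by (intro bexI[of _ "- f"]) (simp_all add: entry_ring_simps entry_polys_uminus)
  qed (simp_all add: entry_ring_simps entry_polys_add entry_polys_zero algebra_simps)
  show "comm_monoid (entry_ring r n)"
    by (rule comm_monoidI) (simp_all add: entry_ring_simps entry_polys_mult entry_polys_one algebra_simps)
qed (simp add: entry_ring_simps algebra_simps)

lemma entry_ring_minus:
  assumes "f \<in> entry_polys r n" "g \<in> entry_polys r n"
  shows "f \<ominus>\<^bsub>entry_ring r n\<^esub> g = f - g"
proof -
  interpret P: cring "entry_ring r n" by (rule cring_entry_ring)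
  have "\<ominus>\<^bsub>entry_ring r n\<^esub> g = - g"
    using assms by (intro P.minus_equality) (auto simp: entry_ring_simps entry_polys_uminus)
  then show ?thesis by (simp add: P.minus_eq entry_ring_simps)
qed

lemma entry_ring_finsum:
  assumes "finite I" "\<And>i. i \<in> I \<Longrightarrow> f i \<in> entry_polys r n"
  shows "(\<Oplus>\<^bsub>entry_ring r n\<^esub>i\<in>I. f i) = sum f I"
proof -
  interpret P: cring "entry_ring r n" by (rule cring_entry_ring)
  show ?thesis using assms
  proof (induction I rule: finite_induct)
    case (insert i I)
    then have "f \<in> I \<rightarrow> carrier (entry_ring r n)" "f i \<in> carrier (entry_ring r n)"
      by (auto simp: entry_ring_simps)
    with insert show ?case by (simp add: entry_ring_simps)
  qed (simp add: entry_ring_simps)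
qed

lemma word_evaluation_generic:
  "word_evaluation (ring_mat TYPE('k::field entry_poly) n ())
     (\<lambda>c. Poly_Mapping.single 0 c \<cdot>\<^sub>m 1\<^sub>m n) r (generic_mat n)"
proof -
  interpret M: ring "ring_mat TYPE('k entry_poly) n ()" by (rule ring_mat)
  show ?thesis
  proof
    show "(\<lambda>c. Poly_Mapping.single 0 c \<cdot>\<^sub>m 1\<^sub>m n) \<in>
        ring_hom (ring_of_type_algebra :: 'k ring) (ring_mat TYPE('k entry_poly) n ())"
    proof (rule ring_hom_memI)
      fix c d :: 'k
      let ?c = "Poly_Mapping.single 0 c :: 'k entry_poly" and ?d = "Poly_Mapping.single 0 d :: 'k entry_poly"
      have "(?c \<cdot>\<^sub>m 1\<^sub>m n) * (?d \<cdot>\<^sub>m 1\<^sub>m n) = ?c \<cdot>\<^sub>m (1\<^sub>m n * (?d \<cdot>\<^sub>m 1\<^sub>m n))"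
        by (rule mult_smult_assoc_mat) auto
      also have "\<dots> = ?c \<cdot>\<^sub>m (?d \<cdot>\<^sub>m 1\<^sub>m n)" by (subst left_mult_one_mat[of _ n n]) auto
      also have "\<dots> = Poly_Mapping.single 0 (c * d) \<cdot>\<^sub>m 1\<^sub>m n"
        by (rule eq_matI) (auto simp: mult_single)
      finally show "Poly_Mapping.single 0 (c \<otimes>\<^bsub>ring_of_type_algebra\<^esub> d) \<cdot>\<^sub>m 1\<^sub>m n =
          (?c \<cdot>\<^sub>m 1\<^sub>m n) \<otimes>\<^bsub>ring_mat TYPE('k entry_poly) n ()\<^esub> (?d \<cdot>\<^sub>m 1\<^sub>m n)"
        by (simp add: ring_mat_simps ring_of_type_algebra_def)
    qed (auto simp: ring_mat_simps ring_of_type_algebra_def single_add add_smult_distrib_right_mat)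
  next
    fix b c assume "b \<in> carrier (ring_mat TYPE('k entry_poly) n ())"
    then have "b \<in> carrier_mat n n" by (simp add: ring_mat_simps)
    then show "Poly_Mapping.single 0 c \<cdot>\<^sub>m 1\<^sub>m n \<otimes>\<^bsub>ring_mat TYPE('k entry_poly) n ()\<^esub> b =
        b \<otimes>\<^bsub>ring_mat TYPE('k entry_poly) n ()\<^esub> (Poly_Mapping.single 0 c \<cdot>\<^sub>m 1\<^sub>m n)"
      by (simp add: ring_mat_simps mult_smult_distrib[of b n n "1\<^sub>m n" n] mult_smult_assoc_mat[of "1\<^sub>m n" n n b n])
  next
    fix l show "generic_mat n l \<in> carrier (ring_mat TYPE('k entry_poly) n ())"
      by (simp add: ring_mat_simps generic_mat_def)
  qed
qed

context
  fixes n r :: nat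
begin

interpretation W: word_evaluation "ring_mat TYPE('k::field entry_poly) n ()"
    "\<lambda>c. Poly_Mapping.single 0 c \<cdot>\<^sub>m 1\<^sub>m n" r "generic_mat n"
  by (rule word_evaluation_generic)

lemma generic_eval_closed:
  "(q :: nat list \<Rightarrow>\<^sub>0 'k::field) \<in> free_algebra r \<Longrightarrow> generic_eval n q \<in> carrier_mat n n"
  using W.nc_eval_closed[of q] by (simp add: generic_eval_def ring_mat_simps)

lemma generic_eval_add:
  "\<lbrakk>(q :: nat list \<Rightarrow>\<^sub>0 'k::field) \<in> free_algebra r; q' \<in> free_algebra r\<rbrakk> \<Longrightarrow>
    generic_eval n (q + q') = generic_eval n q + generic_eval n q'"
  using W.nc_eval_add[of q q'] by (simp add: generic_eval_def ring_mat_simps)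

lemma generic_eval_diff_entry:
  assumes "(q :: nat list \<Rightarrow>\<^sub>0 'k::field) \<in> free_algebra r" "q' \<in> free_algebra r" "i < n" "j < n"
  shows "generic_eval n (q - q') $$ (i, j) = generic_eval n q $$ (i, j) - generic_eval n q' $$ (i, j)"
proof -
  have "generic_eval n q = generic_eval n (q - q') + generic_eval n q'"
    using generic_eval_add[OF free_algebra_diff[OF assms(1,2)] assms(2)] by simp
  then have "generic_eval n q $$ (i, j) = (generic_eval n (q - q') + generic_eval n q') $$ (i, j)" by simp
  with generic_eval_closed[OF assms(2)] assms(3,4) show ?thesis by simp
qed

lemma generic_eval_mult:
  "\<lbrakk>(q :: nat list \<Rightarrow>\<^sub>0 'k::field) \<in> free_algebra r; q' \<in> free_algebra r\<rbrakk> \<Longrightarrow>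
    generic_eval n (concat_mult q q') = generic_eval n q * generic_eval n q'"
  using W.nc_eval_concat_mult[of q q'] by (simp add: generic_eval_def ring_mat_simps)

lemma generic_eval_one: "generic_eval n (Poly_Mapping.single [] (1 :: 'k::field)) = 1\<^sub>m n"
  using W.nc_eval_one by (simp add: generic_eval_def ring_mat_simps)

lemma generic_eval_entry:
  assumes "(q :: nat list \<Rightarrow>\<^sub>0 'k::field) \<in> free_algebra r" "i < n" "j < n"
  shows "generic_eval n q $$ (i, j) \<in> entry_polys r n"
proof -
  let ?Q = "{B \<in> carrier_mat n n. \<forall>i<n. \<forall>j<n. B $$ (i, j) \<in> (entry_polys r n :: 'k entry_poly set)}"
  have "nc_eval (ring_mat TYPE('k entry_poly) n ()) (\<lambda>c. Poly_Mapping.single 0 c \<cdot>\<^sub>m 1\<^sub>m n) (generic_mat n) q \<in> ?Q"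
  proof (rule W.nc_eval_in_subring[OF assms(1)])
    show "?Q \<subseteq> carrier (ring_mat TYPE('k entry_poly) n ())" by (auto simp: ring_mat_simps)
    show "\<zero>\<^bsub>ring_mat TYPE('k entry_poly) n ()\<^esub> \<in> ?Q" "\<one>\<^bsub>ring_mat TYPE('k entry_poly) n ()\<^esub> \<in> ?Q"
      by (auto simp: ring_mat_simps entry_polys_zero entry_polys_one)
    show "a \<oplus>\<^bsub>ring_mat TYPE('k entry_poly) n ()\<^esub> b \<in> ?Q" if "a \<in> ?Q" "b \<in> ?Q" for a b
      using that by (auto simp: ring_mat_simps entry_polys_add)
    show "a \<otimes>\<^bsub>ring_mat TYPE('k entry_poly) n ()\<^esub> b \<in> ?Q" if "a \<in> ?Q" "b \<in> ?Q" for a b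
      using that by (auto simp: ring_mat_simps scalar_prod_def intro!: entry_polys_sum entry_polys_mult)
    show "Poly_Mapping.single 0 c \<cdot>\<^sub>m 1\<^sub>m n \<in> ?Q" for c :: 'k
      by (auto simp: entry_polys_const entry_polys_zero)
    show "generic_mat n l \<in> ?Q" if "l < r" for l
      using that by (auto simp: generic_mat_def entry_polys_def)
  qed
  with assms(2,3) show ?thesis by (simp add: generic_eval_def)
qed

end

section \<open>Vanishing on the fibres of the universal bimodule\<close>

lemma module_imp_left_module:
  assumes "module C (N :: ('c, 'v) module)"
  shows "left_module C N"
proof -
  interpret N: module C N by fact
  show ?thesis
    by unfold_locales (auto simp: N.smult_l_distr N.smult_r_distr N.smult_assoc1)
qed

text \<open>
  A ring homomorphism from \<open>A\<close> to the \<open>n \<times> n\<close> matrices over the commutative ring \<open>C\<close>, given by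
  its entries.
\<close>

locale matrix_representation = C: cring C + A: ring A
  for C :: "('c, 't) ring_scheme" and A :: "('a, 's) ring_scheme" +
  fixes n :: nat and \<mu> :: "'a \<Rightarrow> nat \<Rightarrow> nat \<Rightarrow> 'c"
  assumes \<mu>_closed: "\<lbrakk>a \<in> carrier A; i < n; j < n\<rbrakk> \<Longrightarrow> \<mu> a i j \<in> carrier C"
    and \<mu>_add: "\<lbrakk>a \<in> carrier A; b \<in> carrier A; i < n; j < n\<rbrakk> \<Longrightarrow> \<mu> (a \<oplus>\<^bsub>A\<^esub> b) i j = \<mu> a i j \<oplus>\<^bsub>C\<^esub> \<mu> b i j"
    and \<mu>_mult: "\<lbrakk>a \<in> carrier A; b \<in> carrier A; i < n; j < n\<rbrakk> \<Longrightarrow>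
      \<mu> (a \<otimes>\<^bsub>A\<^esub> b) i j = (\<Oplus>\<^bsub>C\<^esub>t\<in>{..<n}. \<mu> a i t \<otimes>\<^bsub>C\<^esub> \<mu> b t j)"
    and \<mu>_one: "\<lbrakk>i < n; j < n\<rbrakk> \<Longrightarrow> \<mu> \<one>\<^bsub>A\<^esub> i j = (if i = j then \<one>\<^bsub>C\<^esub> else \<zero>\<^bsub>C\<^esub>)"
begin

lemma matrix_action:
  assumes "module C N"
  shows "matrix_action C N n \<mu> A"
proof -
  interpret module C N by fact
  show ?thesis by unfold_locales (rule \<mu>_closed)
qed

lemma left_module_matrix_module:
  assumes "module C N"
  shows "left_module A (matrix_module n \<mu> N)"
proof -
  interpret N: left_module C N
    using assms by (rule module_imp_left_module)
  let ?P = "matrix_module n \<mu> N"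
  have P: "carrier ?P = {..<n} \<rightarrow>\<^sub>E carrier N" "\<zero>\<^bsub>?P\<^esub> = (\<lambda>i\<in>{..<n}. \<zero>\<^bsub>N\<^esub>)"
    "u \<oplus>\<^bsub>?P\<^esub> v = (\<lambda>i\<in>{..<n}. u i \<oplus>\<^bsub>N\<^esub> v i)" "a \<odot>\<^bsub>?P\<^esub> v = (\<lambda>i\<in>{..<n}. lincomb N {..<n} (\<mu> a i) v)" for u v a
    by (simp_all add: matrix_module_def lincomb_def)
  have row: "\<mu> a i \<in> {..<n} \<rightarrow> carrier C" if "a \<in> carrier A" "i < n" for a i
    using that by (auto intro: \<mu>_closed)
  have vec: "v \<in> {..<n} \<rightarrow> carrier N" if "v \<in> carrier ?P" for v
    using that by (auto simp: P)
  have "abelian_group ?P"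
  proof (rule abelian_groupI)
    fix u assume "u \<in> carrier ?P"
    then have "(\<lambda>i\<in>{..<n}. \<ominus>\<^bsub>N\<^esub> u i) \<in> carrier ?P" "(\<lambda>i\<in>{..<n}. \<ominus>\<^bsub>N\<^esub> u i) \<oplus>\<^bsub>?P\<^esub> u = \<zero>\<^bsub>?P\<^esub>"
      by (auto simp: P N.M.l_neg PiE_iff)
    then show "\<exists>v\<in>carrier ?P. v \<oplus>\<^bsub>?P\<^esub> u = \<zero>\<^bsub>?P\<^esub>" by blast
  qed (auto simp: P N.M.a_ac PiE_iff extensional_def fun_eq_iff)
  moreover have "left_module_axioms A ?P"
  proof
    fix a v assume a: "a \<in> carrier A" and v: "v \<in> carrier ?P"
    show "a \<odot>\<^bsub>?P\<^esub> v \<in> carrier ?P"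
      using N.lincomb_closed[OF row[OF a] vec[OF v]] by (simp add: P(1,4))
  next
    fix a b v assume a: "a \<in> carrier A" and b: "b \<in> carrier A" and v: "v \<in> carrier ?P"
    show "(a \<oplus>\<^bsub>A\<^esub> b) \<odot>\<^bsub>?P\<^esub> v = a \<odot>\<^bsub>?P\<^esub> v \<oplus>\<^bsub>?P\<^esub> b \<odot>\<^bsub>?P\<^esub> v"
      unfolding P(3,4)
    proof (rule restrict_ext)
      fix i assume i: "i \<in> {..<n}"
      have "lincomb N {..<n} (\<mu> (a \<oplus>\<^bsub>A\<^esub> b) i) v = lincomb N {..<n} (\<lambda>j. \<mu> a i j \<oplus>\<^bsub>C\<^esub> \<mu> b i j) v"
        using i a b v by (intro N.lincomb_cong) (auto simp: \<mu>_add vec row)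
      also have "\<dots> = lincomb N {..<n} (\<mu> a i) v \<oplus>\<^bsub>N\<^esub> lincomb N {..<n} (\<mu> b i) v"
        using i by (intro N.lincomb_add row a b vec v) auto
      finally show "lincomb N {..<n} (\<mu> (a \<oplus>\<^bsub>A\<^esub> b) i) v =
        (\<lambda>i\<in>{..<n}. lincomb N {..<n} (\<mu> a i) v) i \<oplus>\<^bsub>N\<^esub> (\<lambda>i\<in>{..<n}. lincomb N {..<n} (\<mu> b i) v) i"
        using i by simp
    qed
    show "(a \<otimes>\<^bsub>A\<^esub> b) \<odot>\<^bsub>?P\<^esub> v = a \<odot>\<^bsub>?P\<^esub> (b \<odot>\<^bsub>?P\<^esub> v)"
      unfolding P(4)
    proof (rule restrict_ext)
      fix i assume "i \<in> {..<n}"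
      then have i: "i < n" by simp
      have "lincomb N {..<n} (\<mu> (a \<otimes>\<^bsub>A\<^esub> b) i) v =
          lincomb N {..<n} (\<lambda>j. \<Oplus>\<^bsub>C\<^esub>t\<in>{..<n}. \<mu> a i t \<otimes>\<^bsub>C\<^esub> \<mu> b t j) v"
        using i a b v by (intro N.lincomb_cong) (auto simp: \<mu>_mult vec row)
      also have "\<dots> = lincomb N {..<n} (\<mu> a i) (\<lambda>t. lincomb N {..<n} (\<mu> b t) v)"
        using i by (intro N.lincomb_finsum \<mu>_closed row vec a b v) auto
      also have "\<dots> = lincomb N {..<n} (\<mu> a i) (\<lambda>i\<in>{..<n}. lincomb N {..<n} (\<mu> b i) v)"
        using N.lincomb_closed[OF row[OF b] vec[OF v]] row[OF a i]
        by (intro N.lincomb_cong) auto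
      finally show "lincomb N {..<n} (\<mu> (a \<otimes>\<^bsub>A\<^esub> b) i) v =
          lincomb N {..<n} (\<mu> a i) (\<lambda>i\<in>{..<n}. lincomb N {..<n} (\<mu> b i) v)" .
    qed
  next
    fix a v w assume a: "a \<in> carrier A" and v: "v \<in> carrier ?P" and w: "w \<in> carrier ?P"
    show "a \<odot>\<^bsub>?P\<^esub> (v \<oplus>\<^bsub>?P\<^esub> w) = a \<odot>\<^bsub>?P\<^esub> v \<oplus>\<^bsub>?P\<^esub> a \<odot>\<^bsub>?P\<^esub> w"
      unfolding P(3,4)
    proof (rule restrict_ext)
      fix i assume i: "i \<in> {..<n}"
      have "lincomb N {..<n} (\<mu> a i) (\<lambda>i\<in>{..<n}. v i \<oplus>\<^bsub>N\<^esub> w i) = lincomb N {..<n} (\<mu> a i) (\<lambda>i. v i \<oplus>\<^bsub>N\<^esub> w i)"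
        using i vec[OF v] vec[OF w] row[OF a] by (intro N.lincomb_cong) auto
      also have "\<dots> = lincomb N {..<n} (\<mu> a i) v \<oplus>\<^bsub>N\<^esub> lincomb N {..<n} (\<mu> a i) w"
        using i by (intro N.lincomb_add_right row a vec v w) auto
      finally show "lincomb N {..<n} (\<mu> a i) (\<lambda>i\<in>{..<n}. v i \<oplus>\<^bsub>N\<^esub> w i) =
        (\<lambda>i\<in>{..<n}. lincomb N {..<n} (\<mu> a i) v) i \<oplus>\<^bsub>N\<^esub> (\<lambda>i\<in>{..<n}. lincomb N {..<n} (\<mu> a i) w) i"
        using i by simp
    qed
  next
    fix v assume v: "v \<in> carrier ?P"
    have "lincomb N {..<n} (\<mu> \<one>\<^bsub>A\<^esub> i) v = v i" if "i < n" for i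
    proof -
      have "lincomb N {..<n} (\<mu> \<one>\<^bsub>A\<^esub> i) v =
          lincomb N {..<n} (\<lambda>j. if i = j then \<one>\<^bsub>C\<^esub> else \<zero>\<^bsub>C\<^esub>) v"
        using that v by (intro N.lincomb_cong) (auto simp: \<mu>_one vec row)
      also have "\<dots> = v i" using that vec[OF v] by (intro N.lincomb_unit) auto
      finally show ?thesis .
    qed
    then have "\<one>\<^bsub>A\<^esub> \<odot>\<^bsub>?P\<^esub> v = (\<lambda>i\<in>{..<n}. v i)"
      unfolding P(4) by (intro restrict_ext) simp
    then show "\<one>\<^bsub>A\<^esub> \<odot>\<^bsub>?P\<^esub> v = v"
      using v by (simp add: P(1) PiE_iff extensional_restrict)
  qed
  ultimately show ?thesis using A.ring_axioms by (simp add: left_module_def)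
qed

text \<open>
  The function \<open>f\<close> stands for the entries of \<open>z\<close>; it is separate so that they can be read off from
  an assignment of values to variables.
\<close>

lemma lincomb_matrix_module:
  fixes l :: nat
  assumes N: "module C N" and c: "c \<in> {..<l} \<rightarrow> carrier A" and z: "z \<in> {..<l} \<rightarrow> carrier (matrix_module n \<mu> N)"
    and f: "\<And>j t. \<lbrakk>j < l; t < n\<rbrakk> \<Longrightarrow> z j t = f j t"
  shows "lincomb (matrix_module n \<mu> N) {..<l} c z =
    (\<lambda>s\<in>{..<n}. \<Oplus>\<^bsub>N\<^esub>j\<in>{..<l}. \<Oplus>\<^bsub>N\<^esub>t\<in>{..<n}. \<mu> (c j) s t \<odot>\<^bsub>N\<^esub> f j t)"
proof -
  interpret N: module C N by fact
  let ?P = "matrix_module n \<mu> N"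
  interpret P: left_module A ?P by (rule left_module_matrix_module[OF N])
  have P: "carrier ?P = {..<n} \<rightarrow>\<^sub>E carrier N" "\<zero>\<^bsub>?P\<^esub> = (\<lambda>i\<in>{..<n}. \<zero>\<^bsub>N\<^esub>)"
    "u \<oplus>\<^bsub>?P\<^esub> v = (\<lambda>i\<in>{..<n}. u i \<oplus>\<^bsub>N\<^esub> v i)"
    "a \<odot>\<^bsub>?P\<^esub> v = (\<lambda>i\<in>{..<n}. \<Oplus>\<^bsub>N\<^esub>j\<in>{..<n}. \<mu> a i j \<odot>\<^bsub>N\<^esub> v j)" for u v a
    by (simp_all add: matrix_module_def)
  have cl: "\<mu> (c j) s t \<odot>\<^bsub>N\<^esub> f j t \<in> carrier N" if "j < l" "s < n" "t < n" for j s t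
  proof -
    have "z j t \<in> carrier N" using z that by (auto simp: P(1))
    moreover have "c j \<in> carrier A" using c that by auto
    ultimately show ?thesis using that f by (simp add: \<mu>_closed)
  qed
  have u: "(\<lambda>j. c j \<odot>\<^bsub>?P\<^esub> z j) \<in> {..<l} \<rightarrow> carrier ?P"
    using c z by (auto intro: P.smult_closed)
  have "lincomb ?P {..<l} c z = (\<lambda>s\<in>{..<n}. \<Oplus>\<^bsub>N\<^esub>j\<in>{..<l}. (c j \<odot>\<^bsub>?P\<^esub> z j) s)"
    unfolding lincomb_def
    by (rule finsum_pointwise[OF P.M.abelian_monoid_axioms N.M.abelian_monoid_axioms P(1-3) _ u]) simp
  also have "\<dots> = (\<lambda>s\<in>{..<n}. \<Oplus>\<^bsub>N\<^esub>j\<in>{..<l}. \<Oplus>\<^bsub>N\<^esub>t\<in>{..<n}. \<mu> (c j) s t \<odot>\<^bsub>N\<^esub> f j t)"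
  proof (rule restrict_ext)
    fix s assume "s \<in> {..<n}"
    then have s: "s < n" by simp
    show "(\<Oplus>\<^bsub>N\<^esub>j\<in>{..<l}. (c j \<odot>\<^bsub>?P\<^esub> z j) s) = (\<Oplus>\<^bsub>N\<^esub>j\<in>{..<l}. \<Oplus>\<^bsub>N\<^esub>t\<in>{..<n}. \<mu> (c j) s t \<odot>\<^bsub>N\<^esub> f j t)"
    proof (rule N.M.finsum_cong'[OF refl])
      show "(\<lambda>j. \<Oplus>\<^bsub>N\<^esub>t\<in>{..<n}. \<mu> (c j) s t \<odot>\<^bsub>N\<^esub> f j t) \<in> {..<l} \<rightarrow> carrier N"
        using cl s by (auto intro!: N.M.finsum_closed)
      fix j assume "j \<in> {..<l}"
      then have j: "j < l" by simp
      have "(c j \<odot>\<^bsub>?P\<^esub> z j) s = (\<Oplus>\<^bsub>N\<^esub>t\<in>{..<n}. \<mu> (c j) s t \<odot>\<^bsub>N\<^esub> z j t)"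
        using s by (simp add: P(4))
      also have "\<dots> = (\<Oplus>\<^bsub>N\<^esub>t\<in>{..<n}. \<mu> (c j) s t \<odot>\<^bsub>N\<^esub> f j t)"
        using cl j s f by (intro N.M.finsum_cong') auto
      finally show "(c j \<odot>\<^bsub>?P\<^esub> z j) s = (\<Oplus>\<^bsub>N\<^esub>t\<in>{..<n}. \<mu> (c j) s t \<odot>\<^bsub>N\<^esub> f j t)" .
    qed
  qed
  finally show ?thesis .
qed

end

lemma residue_module_simps:
  "carrier (residue_module C p) = carrier (Frac (C Quot p))"
  "\<zero>\<^bsub>residue_module C p\<^esub> = \<zero>\<^bsub>Frac (C Quot p)\<^esub>"
  "c \<odot>\<^bsub>residue_module C p\<^esub> z = residue_map C p c \<otimes>\<^bsub>Frac (C Quot p)\<^esub> z"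
  "z \<oplus>\<^bsub>residue_module C p\<^esub> z' = z \<oplus>\<^bsub>Frac (C Quot p)\<^esub> z'"
  "finsum (residue_module C p) = finsum (Frac (C Quot p))"
  by (simp_all add: residue_module_def Let_def residue_map_def finsum_def finprod_def fun_eq_iff)

lemma module_residue_module:
  assumes "cring C" "primeideal p C"
  shows "module C (residue_module C p)"
proof -
  interpret C: cring C by fact
  interpret K: field "Frac (C Quot p)" by (rule field_residue[OF assms(2)])
  interpret h: ring_hom_ring C "Frac (C Quot p)" "residue_map C p"
    by (rule ring_hom_ringI2[OF C.ring_axioms K.ring_axioms residue_map_hom[OF assms(2)]])
  have "abelian_group (residue_module C p)"
  proof (rule abelian_groupI)
    fix z assume "z \<in> carrier (residue_module C p)"
    then show "\<exists>z'\<in>carrier (residue_module C p). z' \<oplus>\<^bsub>residue_module C p\<^esub> z = \<zero>\<^bsub>residue_module C p\<^esub>"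
      using K.l_neg by (auto simp: residue_module_simps)
  qed (simp_all add: residue_module_simps K.a_ac)
  then show ?thesis
    by (intro module.intro C.cring_axioms module_axioms.intro)
      (simp_all add: residue_module_simps K.l_distr K.r_distr K.m_assoc)
qed

lemma field_family_residue:
  assumes "cring C"
  shows "field_family C (\<lambda>p. Frac (C Quot p)) (residue_map C)"
proof (intro field_family.intro field_family_axioms.intro assms)
  fix p c assume "p \<in> Spec C"
  then have p: "primeideal p C" by (simp add: Spec_def)
  show "field (Frac (C Quot p))" by (rule field_residue[OF p])
  show "residue_map C p \<in> ring_hom C (Frac (C Quot p))" by (rule residue_map_hom[OF p])
  assume "c \<in> carrier C"
  then show "residue_map C p c = \<zero>\<^bsub>Frac (C Quot p)\<^esub> \<longleftrightarrow> c \<in> p" by (rule residue_map_eq_zero_iff[OF p])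
qed

lemma (in field_family) linear_form_double_sum:
  assumes "finite I" "finite J" and c: "\<And>i j. \<lbrakk>i \<in> I; j \<in> J\<rbrakk> \<Longrightarrow> c i j \<in> carrier C"
    and v: "\<And>i j. \<lbrakk>i \<in> I; j \<in> J\<rbrakk> \<Longrightarrow> v i j \<in> V"
  shows "\<exists>L. linear_form V L \<and> (\<forall>p\<in>Spec C. \<forall>z\<in>V \<rightarrow> carrier (K p).
    L p z = (\<Oplus>\<^bsub>K p\<^esub>i\<in>I. \<Oplus>\<^bsub>K p\<^esub>j\<in>J. \<phi> p (c i j) \<otimes>\<^bsub>K p\<^esub> z (v i j)))"
proof -
  have "\<exists>L. linear_form V L \<and> (\<forall>p\<in>Spec C. \<forall>z\<in>V \<rightarrow> carrier (K p).
    L p z = (\<Oplus>\<^bsub>K p\<^esub>j\<in>J. \<phi> p (c i j) \<otimes>\<^bsub>K p\<^esub> z (v i j)))" if "i \<in> I" for i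
    by (rule linear_form_finsum[OF assms(2)])
      (rule linear_form.scale[OF c[OF that] linear_form.coord[OF v[OF that]]])
  then have "\<forall>i\<in>I. \<exists>L. linear_form V L \<and> (\<forall>p\<in>Spec C. \<forall>z\<in>V \<rightarrow> carrier (K p).
    L p z = (\<Oplus>\<^bsub>K p\<^esub>j\<in>J. \<phi> p (c i j) \<otimes>\<^bsub>K p\<^esub> z (v i j)))" by blast
  from bchoice[OF this] obtain L where L: "\<forall>i\<in>I. linear_form V (L i) \<and> (\<forall>p\<in>Spec C. \<forall>z\<in>V \<rightarrow> carrier (K p).
    L i p z = (\<Oplus>\<^bsub>K p\<^esub>j\<in>J. \<phi> p (c i j) \<otimes>\<^bsub>K p\<^esub> z (v i j)))" ..
  then have "linear_form V (L i)" if "i \<in> I" for i using that by blast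
  from linear_form_finsum[of I V L, OF assms(1) this] obtain M where M: "linear_form V M"
    "\<forall>p\<in>Spec C. \<forall>z\<in>V \<rightarrow> carrier (K p). M p z = (\<Oplus>\<^bsub>K p\<^esub>i\<in>I. L i p z)" by blast
  show ?thesis
  proof (intro exI[of _ M] conjI ballI M(1))
    fix p z assume p: "p \<in> Spec C" and z: "z \<in> V \<rightarrow> carrier (K p)"
    interpret K: field "K p" using p by (rule field_K)
    have "M p z = (\<Oplus>\<^bsub>K p\<^esub>i\<in>I. L i p z)" using M(2) p z by blast
    also have "\<dots> = (\<Oplus>\<^bsub>K p\<^esub>i\<in>I. \<Oplus>\<^bsub>K p\<^esub>j\<in>J. \<phi> p (c i j) \<otimes>\<^bsub>K p\<^esub> z (v i j))"
    proof (rule K.finsum_cong'[OF refl])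
      show "L i p z = (\<Oplus>\<^bsub>K p\<^esub>j\<in>J. \<phi> p (c i j) \<otimes>\<^bsub>K p\<^esub> z (v i j))" if "i \<in> I" for i
        using L that p z by blast
      have "\<phi> p (c i j) \<otimes>\<^bsub>K p\<^esub> z (v i j) \<in> carrier (K p)" if "i \<in> I" "j \<in> J" for i j
        using \<phi>_closed[OF p c[OF that]] z v[OF that] by auto
      then show "(\<lambda>i. \<Oplus>\<^bsub>K p\<^esub>j\<in>J. \<phi> p (c i j) \<otimes>\<^bsub>K p\<^esub> z (v i j)) \<in> I \<rightarrow> carrier (K p)"
        by (auto intro!: K.finsum_closed)
    qed
    finally show "M p z = (\<Oplus>\<^bsub>K p\<^esub>i\<in>I. \<Oplus>\<^bsub>K p\<^esub>j\<in>J. \<phi> p (c i j) \<otimes>\<^bsub>K p\<^esub> z (v i j))" .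
  qed
qed

context matrix_representation
begin

interpretation field_family C "\<lambda>p. Frac (C Quot p)" "residue_map C"
  by (rule field_family_residue) (rule C.cring_axioms)

text \<open>
  An unknown in \<open>\<kappa>(p)\<^sup>n\<close> is \<open>n\<close> unknowns in the residue field \<open>\<kappa>(p)\<close>, and an equation over \<open>A\<close> is \<open>n\<close>
  equations over \<open>\<kappa>(p)\<close> whose coefficients are the images of matrix entries in \<open>C\<close>.  So the
  condition is an instance of \<open>constructible_solvability\<close>: the variables \<open>Inl (j, t)\<close> are the
  entries of \<open>z\<close> and the variables \<open>Inr (j, t)\<close> those of \<open>y\<close>.
\<close>

lemma constructible_solvability_condition:
  assumes r: "\<forall>i<m. r i \<in> {..<l} \<rightarrow> carrier A" and r': "\<forall>i<m'. r' i \<in> {..<l'} \<rightarrow> carrier A"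
    and a: "\<forall>i<l. a i \<in> {..<l'} \<rightarrow> carrier A"
  shows "{p \<in> Spec C. solvability_condition l m r l' m' r' a (matrix_module n \<mu> (residue_module C p))}
    \<in> constructible_sets C"
proof -
  let ?K = "\<lambda>p. Frac (C Quot p)" and ?\<phi> = "residue_map C"
  let ?P = "\<lambda>p. matrix_module n \<mu> (residue_module C p)"
  define V :: "(nat \<times> nat + nat \<times> nat) set" where "V = Inl ` ({..<l} \<times> {..<n})"
  define W :: "(nat \<times> nat + nat \<times> nat) set" where "W = Inr ` ({..<l'} \<times> {..<n})"
  define lin where "lin p k c f s = (\<Oplus>\<^bsub>?K p\<^esub>j\<in>{..<k}. \<Oplus>\<^bsub>?K p\<^esub>t\<in>{..<n}. ?\<phi> p (\<mu> (c j) s t) \<otimes>\<^bsub>?K p\<^esub> f (j, t))"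
    for p and k :: nat and c f s
  have form: "\<exists>L. linear_form U L \<and> (\<forall>p\<in>Spec C. \<forall>z\<in>U \<rightarrow> carrier (?K p). L p z = lin p k c (\<lambda>x. z (v x)) s)"
    if "c \<in> {..<k} \<rightarrow> carrier A" "s < n" "v ` ({..<k} \<times> {..<n}) \<subseteq> U" for c and k :: nat and s and v :: "nat \<times> nat \<Rightarrow> nat \<times> nat + nat \<times> nat" and U
    unfolding lin_def
    by (rule linear_form_double_sum[of _ _ "\<lambda>j t. \<mu> (c j) s t" "\<lambda>j t. v (j, t)"]) (use that in \<open>auto intro: \<mu>_closed\<close>)
  have "\<forall>x\<in>{..<m}\<times>{..<n}. \<exists>L. linear_form V L \<and> (\<forall>p\<in>Spec C. \<forall>z\<in>V \<rightarrow> carrier (?K p).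
      L p z = lin p l (r (fst x)) (\<lambda>x. z (Inl x)) (snd x))"
    by (intro ballI form) (use r in \<open>auto simp: V_def Pi_iff\<close>)
  from bchoice[OF this] obtain L1 where L1: "\<forall>x\<in>{..<m}\<times>{..<n}. linear_form V (L1 x) \<and>
      (\<forall>p\<in>Spec C. \<forall>z\<in>V \<rightarrow> carrier (?K p). L1 x p z = lin p l (r (fst x)) (\<lambda>x. z (Inl x)) (snd x))" ..
  have "\<forall>x\<in>{..<m'}\<times>{..<n}. \<exists>L. linear_form (V \<union> W) L \<and> (\<forall>p\<in>Spec C. \<forall>z\<in>V \<union> W \<rightarrow> carrier (?K p).
      L p z = lin p l' (r' (fst x)) (\<lambda>x. z (Inr x)) (snd x))"
    by (intro ballI form) (use r' in \<open>auto simp: W_def Pi_iff\<close>)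
  from bchoice[OF this] obtain L2 where L2: "\<forall>x\<in>{..<m'}\<times>{..<n}. linear_form (V \<union> W) (L2 x) \<and>
      (\<forall>p\<in>Spec C. \<forall>z\<in>V \<union> W \<rightarrow> carrier (?K p). L2 x p z = lin p l' (r' (fst x)) (\<lambda>x. z (Inr x)) (snd x))" ..
  have "\<forall>x\<in>{..<l}\<times>{..<n}. \<exists>L. linear_form (V \<union> W) L \<and> (\<forall>p\<in>Spec C. \<forall>z\<in>V \<union> W \<rightarrow> carrier (?K p).
      L p z = lin p l' (a (fst x)) (\<lambda>x. z (Inr x)) (snd x))"
    by (intro ballI form) (use a in \<open>auto simp: W_def Pi_iff\<close>)
  from bchoice[OF this] obtain L3 where L3: "\<forall>x\<in>{..<l}\<times>{..<n}. linear_form (V \<union> W) (L3 x) \<and>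
      (\<forall>p\<in>Spec C. \<forall>z\<in>V \<union> W \<rightarrow> carrier (?K p). L3 x p z = lin p l' (a (fst x)) (\<lambda>x. z (Inr x)) (snd x))" ..
  (* z is moved to the left-hand side; its coefficient -1 is taken in C to obtain a linear form *)
  define D where "D x = (\<lambda>p z. L3 x p z \<oplus>\<^bsub>?K p\<^esub> ?\<phi> p (\<ominus>\<^bsub>C\<^esub> \<one>\<^bsub>C\<^esub>) \<otimes>\<^bsub>?K p\<^esub> z (Inl x))" for x
  have D: "linear_form (V \<union> W) (D x)" if "x \<in> {..<l}\<times>{..<n}" for x
    unfolding D_def
  proof (rule linear_form.add)
    show "linear_form (V \<union> W) (L3 x)" using L3 that by blast
    show "linear_form (V \<union> W) (\<lambda>p z. ?\<phi> p (\<ominus>\<^bsub>C\<^esub> \<one>\<^bsub>C\<^esub>) \<otimes>\<^bsub>?K p\<^esub> z (Inl x))"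
      using that by (intro linear_form.scale linear_form.coord) (auto simp: V_def)
  qed
  let ?G = "L1 ` ({..<m}\<times>{..<n})" and ?F = "L2 ` ({..<m'}\<times>{..<n}) \<union> D ` ({..<l}\<times>{..<n})"
  let ?Q = "\<lambda>p. \<forall>z\<in>V \<rightarrow> carrier (?K p). (\<forall>L\<in>?G. L p z = \<zero>\<^bsub>?K p\<^esub>) \<longrightarrow>
      (\<exists>y\<in>V \<union> W \<rightarrow> carrier (?K p). (\<forall>v\<in>V. y v = z v) \<and> (\<forall>L\<in>?F. L p y = \<zero>\<^bsub>?K p\<^esub>))"
  have "{p \<in> Spec C. ?Q p} \<in> constructible_sets C"
    by (rule constructible_solvability) (use L1 L2 D in \<open>auto simp: V_def W_def\<close>)
  moreover have "solvability_condition l m r l' m' r' a (?P p) \<longleftrightarrow> ?Q p" if p: "p \<in> Spec C" for p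
  proof -
    have N: "module C (residue_module C p)"
      using p by (intro module_residue_module C.cring_axioms) (simp add: Spec_def)
    interpret K: field "?K p" using p by (rule field_K)
    interpret h: ring_hom_ring C "?K p" "?\<phi> p" using p by (rule ring_hom_ring_\<phi>)
    have P: "carrier (?P p) = {..<n} \<rightarrow>\<^sub>E carrier (?K p)" "\<zero>\<^bsub>?P p\<^esub> = (\<lambda>i\<in>{..<n}. \<zero>\<^bsub>?K p\<^esub>)"
      by (simp_all add: matrix_module_def residue_module_simps)
    have lc: "lincomb (?P p) {..<k} c z = (\<lambda>s\<in>{..<n}. lin p k c f s)"
      if "c \<in> {..<k} \<rightarrow> carrier A" "z \<in> {..<k} \<rightarrow> carrier (?P p)" "\<And>j t. \<lbrakk>j < k; t < n\<rbrakk> \<Longrightarrow> z j t = f (j, t)"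
      for k :: nat and c z f
      unfolding lin_def
      using lincomb_matrix_module[OF N that(1,2), of "\<lambda>j t. f (j, t)"] that(3)
      by (simp only: residue_module_simps)
    have lc0: "lincomb (?P p) {..<k} c z = \<zero>\<^bsub>?P p\<^esub> \<longleftrightarrow> (\<forall>s<n. lin p k c f s = \<zero>\<^bsub>?K p\<^esub>)"
      if "c \<in> {..<k} \<rightarrow> carrier A" "z \<in> {..<k} \<rightarrow> carrier (?P p)" "\<And>j t. \<lbrakk>j < k; t < n\<rbrakk> \<Longrightarrow> z j t = f (j, t)"
      for k :: nat and c z f
    proof -
      have "lincomb (?P p) {..<k} c z = \<zero>\<^bsub>?P p\<^esub> \<longleftrightarrow>
          (\<lambda>s\<in>{..<n}. lin p k c f s) = (\<lambda>i\<in>{..<n}. \<zero>\<^bsub>?K p\<^esub>)"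
        by (simp only: lc[OF that] P(2))
      also have "\<dots> \<longleftrightarrow> (\<forall>s<n. lin p k c f s = \<zero>\<^bsub>?K p\<^esub>)"
        by (auto simp: fun_eq_iff restrict_def)
      finally show ?thesis .
    qed
    have L1': "L1 (i, s) p w = lin p l (r i) (\<lambda>x. w (Inl x)) s"
      if "i < m" "s < n" "w \<in> V \<rightarrow> carrier (?K p)" for i s w
      using L1 p that by force
    have L2': "L2 (i, s) p w = lin p l' (r' i) (\<lambda>x. w (Inr x)) s"
      if "i < m'" "s < n" "w \<in> V \<union> W \<rightarrow> carrier (?K p)" for i s w
      using L2 p that by force
    have L3': "L3 (i, s) p w = lin p l' (a i) (\<lambda>x. w (Inr x)) s"
      if "i < l" "s < n" "w \<in> V \<union> W \<rightarrow> carrier (?K p)" for i s w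
      using L3 p that by force
    have D0: "D (i, s) p w = \<zero>\<^bsub>?K p\<^esub> \<longleftrightarrow> L3 (i, s) p w = w (Inl (i, s))"
      if "i < l" "s < n" "w \<in> V \<union> W \<rightarrow> carrier (?K p)" for i s w
    proof -
      have w: "w (Inl (i, s)) \<in> carrier (?K p)" using that by (auto simp: V_def)
      have "linear_form (V \<union> W) (L3 (i, s))" using L3 that by force
      then have L: "L3 (i, s) p w \<in> carrier (?K p)" using p that(3) by (rule linear_form_closed)
      have "D (i, s) p w = L3 (i, s) p w \<ominus>\<^bsub>?K p\<^esub> w (Inl (i, s))"
        using w by (simp add: D_def K.minus_eq K.l_minus)
      then show ?thesis using w L by (simp add: K.r_right_minus_eq)
    qed
    show ?thesis
    proof
      assume S: "solvability_condition l m r l' m' r' a (?P p)"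
      show "?Q p"
      proof (intro ballI impI)
        fix w assume w: "w \<in> V \<rightarrow> carrier (?K p)" and G: "\<forall>L\<in>?G. L p w = \<zero>\<^bsub>?K p\<^esub>"
        define z where "z j = (\<lambda>t\<in>{..<n}. w (Inl (j, t)))" for j
        have z: "z \<in> {..<l} \<rightarrow> carrier (?P p)"
          using w by (auto simp: z_def P(1) V_def)
        have zw: "z j t = w (Inl (j, t))" if "t < n" for j t using that by (simp add: z_def)
        have "lincomb (?P p) {..<l} (r i) z = \<zero>\<^bsub>?P p\<^esub>" if i: "i < m" for i
        proof (subst lc0[OF _ z, of _ "\<lambda>x. w (Inl x)"])
          show "r i \<in> {..<l} \<rightarrow> carrier A" using r i by blast
          show "\<forall>s<n. lin p l (r i) (\<lambda>x. w (Inl x)) s = \<zero>\<^bsub>?K p\<^esub>"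
          proof (intro allI impI)
            fix s assume s: "s < n"
            have "L1 (i, s) \<in> ?G" using i s by blast
            with G have "L1 (i, s) p w = \<zero>\<^bsub>?K p\<^esub>" by (rule bspec)
            then show "lin p l (r i) (\<lambda>x. w (Inl x)) s = \<zero>\<^bsub>?K p\<^esub>"
              using L1'[OF i s w] by simp
          qed
        qed (rule zw)
        with S z obtain y where y: "y \<in> {..<l'} \<rightarrow> carrier (?P p)"
          "\<forall>i<m'. lincomb (?P p) {..<l'} (r' i) y = \<zero>\<^bsub>?P p\<^esub>"
          "\<forall>i<l. lincomb (?P p) {..<l'} (a i) y = z i"
          unfolding solvability_condition_def by blast
        define y' where "y' = case_sum (\<lambda>x. w (Inl x)) (\<lambda>(j, t). y j t)"
        have y'_simps: "y' (Inl x) = w (Inl x)" "y' (Inr (j, t)) = y j t" for x j t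
          by (simp_all add: y'_def)
        have y': "y' \<in> V \<union> W \<rightarrow> carrier (?K p)"
        proof (rule Pi_I)
          fix v assume "v \<in> V \<union> W"
          then consider (V) "v \<in> V" | (W) j t where "v = Inr (j, t)" "j < l'" "t < n"
            by (auto simp: W_def)
          then show "y' v \<in> carrier (?K p)"
          proof cases
            case V
            then have "y' v = w v" by (auto simp: V_def y'_simps)
            with V w show ?thesis by auto
          next
            case W
            then have "y j \<in> {..<n} \<rightarrow>\<^sub>E carrier (?K p)" using y(1) by (auto simp: P(1))
            with W show ?thesis by (auto simp: y'_simps)
          qed
        qed
        have "L2 (i, s) p y' = \<zero>\<^bsub>?K p\<^esub>" if i: "i < m'" and s: "s < n" for i s
        proof -
          have ri: "r' i \<in> {..<l'} \<rightarrow> carrier A" using r' i by blast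
          show ?thesis
            using lc0[OF ri y(1), of "\<lambda>x. y' (Inr x)"] y(2) i s L2'[OF i s y'] by (simp add: y'_simps)
        qed
        moreover have "D (i, s) p y' = \<zero>\<^bsub>?K p\<^esub>" if i: "i < l" and s: "s < n" for i s
        proof -
          have ai: "a i \<in> {..<l'} \<rightarrow> carrier A" using a i by blast
          have "z i = (\<lambda>s\<in>{..<n}. lin p l' (a i) (\<lambda>x. y' (Inr x)) s)"
            using lc[OF ai y(1), of "\<lambda>x. y' (Inr x)"] y(3) i by (simp only: y'_simps)
          then have "z i s = lin p l' (a i) (\<lambda>x. y' (Inr x)) s" using s by simp
          then show ?thesis using D0[OF i s y'] L3'[OF i s y'] zw[OF s] by (simp add: y'_simps)
        qed
        ultimately have "\<forall>L\<in>?F. L p y' = \<zero>\<^bsub>?K p\<^esub>" by auto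
        moreover have "\<forall>v\<in>V. y' v = w v" by (auto simp: V_def y'_simps)
        ultimately show "\<exists>y\<in>V \<union> W \<rightarrow> carrier (?K p). (\<forall>v\<in>V. y v = w v) \<and> (\<forall>L\<in>?F. L p y = \<zero>\<^bsub>?K p\<^esub>)"
          using y' by blast
      qed
    next
      assume Q: "?Q p"
      show "solvability_condition l m r l' m' r' a (?P p)"
        unfolding solvability_condition_def
      proof (intro ballI impI)
        fix z assume z: "z \<in> {..<l} \<rightarrow> carrier (?P p)" and rel: "\<forall>i<m. lincomb (?P p) {..<l} (r i) z = \<zero>\<^bsub>?P p\<^esub>"
        define w where "w = case_sum (\<lambda>(j, t). z j t) (\<lambda>x :: nat \<times> nat. \<zero>\<^bsub>?K p\<^esub>)"
        have w_simps: "w (Inl (j, t)) = z j t" for j t by (simp add: w_def)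
        have zj: "z j \<in> {..<n} \<rightarrow>\<^sub>E carrier (?K p)" if "j < l" for j using z that by (auto simp: P(1))
        have w: "w \<in> V \<rightarrow> carrier (?K p)"
        proof (rule Pi_I)
          fix v assume "v \<in> V"
          then obtain j t where "v = Inl (j, t)" "j < l" "t < n" by (auto simp: V_def)
          with zj[of j] show "w v \<in> carrier (?K p)" by (auto simp: w_simps)
        qed
        have "L1 (i, s) p w = \<zero>\<^bsub>?K p\<^esub>" if i: "i < m" and s: "s < n" for i s
        proof -
          have ri: "r i \<in> {..<l} \<rightarrow> carrier A" using r i by blast
          show ?thesis
            using lc0[OF ri z, of "\<lambda>x. w (Inl x)"] rel i s L1'[OF i s w] by (simp add: w_simps)
        qed
        then have "\<forall>L\<in>?G. L p w = \<zero>\<^bsub>?K p\<^esub>" by auto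
        with bspec[OF Q w] have "\<exists>y\<in>V \<union> W \<rightarrow> carrier (?K p). (\<forall>v\<in>V. y v = w v) \<and> (\<forall>L\<in>?F. L p y = \<zero>\<^bsub>?K p\<^esub>)"
          by (rule mp)
        then obtain y' where y': "y' \<in> V \<union> W \<rightarrow> carrier (?K p)" and agree: "\<forall>v\<in>V. y' v = w v"
          and F: "\<forall>L\<in>?F. L p y' = \<zero>\<^bsub>?K p\<^esub>" by (elim bexE conjE)
        define y where "y j = (\<lambda>t\<in>{..<n}. y' (Inr (j, t)))" for j
        have y: "y \<in> {..<l'} \<rightarrow> carrier (?P p)"
          using y' by (auto simp: y_def P(1) W_def)
        have yy: "y j t = y' (Inr (j, t))" if "t < n" for j t using that by (simp add: y_def)
        have "lincomb (?P p) {..<l'} (r' i) y = \<zero>\<^bsub>?P p\<^esub>" if i: "i < m'" for i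
        proof (subst lc0[OF _ y, of _ "\<lambda>x. y' (Inr x)"])
          show "r' i \<in> {..<l'} \<rightarrow> carrier A" using r' i by blast
          show "\<forall>s<n. lin p l' (r' i) (\<lambda>x. y' (Inr x)) s = \<zero>\<^bsub>?K p\<^esub>"
          proof (intro allI impI)
            fix s assume s: "s < n"
            have "L2 (i, s) \<in> ?F" using i s by blast
            with F have "L2 (i, s) p y' = \<zero>\<^bsub>?K p\<^esub>" by (rule bspec)
            then show "lin p l' (r' i) (\<lambda>x. y' (Inr x)) s = \<zero>\<^bsub>?K p\<^esub>"
              using L2'[OF i s y'] by simp
          qed
        qed (rule yy)
        moreover have "lincomb (?P p) {..<l'} (a i) y = z i" if i: "i < l" for i
        proof -
          have ai: "a i \<in> {..<l'} \<rightarrow> carrier A" using a i by blast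
          have "lincomb (?P p) {..<l'} (a i) y = (\<lambda>s\<in>{..<n}. lin p l' (a i) (\<lambda>x. y' (Inr x)) s)"
            by (rule lc[OF ai y]) (rule yy)
          also have "\<dots> = (\<lambda>s\<in>{..<n}. z i s)"
          proof (rule restrict_ext)
            fix s assume "s \<in> {..<n}"
            then have s: "s < n" by simp
            have "D (i, s) \<in> ?F" using i s by blast
            with F have "D (i, s) p y' = \<zero>\<^bsub>?K p\<^esub>" by (rule bspec)
            moreover have "y' (Inl (i, s)) = z i s" using agree i s by (simp add: V_def w_simps)
            ultimately show "lin p l' (a i) (\<lambda>x. y' (Inr x)) s = z i s"
              using D0[OF i s y'] L3'[OF i s y'] by simp
          qed
          also have "\<dots> = z i" using zj[OF i] by (simp add: PiE_iff extensional_restrict)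
          finally show ?thesis .
        qed
        ultimately show "\<exists>y\<in>{..<l'} \<rightarrow> carrier (?P p). (\<forall>i<m'. lincomb (?P p) {..<l'} (r' i) y = \<zero>\<^bsub>?P p\<^esub>) \<and>
            (\<forall>i<l. lincomb (?P p) {..<l'} (a i) y = z i)"
          using y by blast
      qed
    qed
  qed
  then have "{p \<in> Spec C. solvability_condition l m r l' m' r' a (?P p)} = {p \<in> Spec C. ?Q p}"
    by (rule Collect_cong[OF conj_cong[OF refl]])
  ultimately show ?thesis by (simp only:)
qed

end

text \<open>
  The matrix by which an element of \<open>A\<close> acts in \<^const>\<open>universal_bimodule\<close>, with the same choice of
  a representing polynomial as there.
\<close>

definition action_matrix ::
  "('a, 's) ring_scheme \<Rightarrow> ('k::field \<Rightarrow> 'a) \<Rightarrow> nat \<Rightarrow> (nat \<Rightarrow> 'a) \<Rightarrow> nat \<Rightarrow>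
   'a \<Rightarrow> nat \<Rightarrow> nat \<Rightarrow> 'k entry_poly set" where
  "action_matrix A \<eta> r x n a i j =
     scheme_ideal A \<eta> r x n +>\<^bsub>entry_ring r n\<^esub>
       (generic_eval n (SOME q. q \<in> free_algebra r \<and> nc_eval A \<eta> x q = a) $$ (i, j))"

lemma universal_bimodule_eq:
  "universal_bimodule A \<eta> r x n = matrix_bimodule (coord_ring A \<eta> r x n) n (action_matrix A \<eta> r x n)"
  by (simp add: universal_bimodule_def matrix_bimodule_def Let_def action_matrix_def)

context fin_gen_algebra
begin

abbreviation "J \<equiv> scheme_ideal A \<eta> r x"
abbreviation "E \<equiv> (entry_ring r :: nat \<Rightarrow> ('k::field) entry_poly ring)"

lemma word_evaluation: "word_evaluation A \<eta> r x"
  by unfold_locales (rule scalar_hom, rule scalar_central, assumption, rule gens_closed)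

lemma scheme_ideal_ideal: "ideal (J n) (E n)"
proof -
  interpret E: cring "E n" by (rule cring_entry_ring)
  have "ideal (carrier (E n)) (E n)" by (rule E.oneideal)
  moreover have "carrier (E n) +>\<^bsub>E n\<^esub> (generic_eval n q $$ (i, j)) = \<zero>\<^bsub>E n Quot carrier (E n)\<^esub>"
    if "q \<in> relation_ideal A \<eta> r x" "i < n" "j < n" for q i j
  proof -
    have "generic_eval n q $$ (i, j) \<in> carrier (E n)"
      using that generic_eval_entry[of q r i n j] by (simp add: relation_ideal_def entry_ring_simps)
    then show ?thesis
      using E.a_rcos_zero[OF E.oneideal] by (simp add: FactRing_def)
  qed
  ultimately show ?thesis
    unfolding scheme_ideal_def by (intro E.i_Intersect) auto
qed

lemma relation_entry_in_scheme_ideal: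
  assumes "q \<in> relation_ideal A \<eta> r x" "i < n" "j < n"
  shows "generic_eval n q $$ (i, j) \<in> J n"
  unfolding scheme_ideal_def
proof (clarify)
  fix I assume I: "ideal I (E n)" and *: "\<forall>q\<in>relation_ideal A \<eta> r x. \<forall>i<n. \<forall>j<n.
    I +>\<^bsub>E n\<^esub> (generic_eval n q $$ (i, j)) = \<zero>\<^bsub>E n Quot I\<^esub>"
  have "generic_eval n q $$ (i, j) \<in> carrier (E n)"
    using assms generic_eval_entry[of q r i n j] by (simp add: relation_ideal_def entry_ring_simps)
  moreover have "I +>\<^bsub>E n\<^esub> (generic_eval n q $$ (i, j)) = I"
    using * assms by (simp add: FactRing_def)
  ultimately show "generic_eval n q $$ (i, j) \<in> I"
    by (rule ideal.rcos_const_imp_mem[OF I])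
qed

text \<open>
  Two polynomials representing \<open>a\<close> differ by a relation, and relations evaluate to zero modulo the
  scheme ideal.
\<close>

lemma action_matrix_eq:
  assumes q: "q \<in> free_algebra r" and "nc_eval A \<eta> x q = a" and ij: "i < n" "j < n"
  shows "action_matrix A \<eta> r x n a i j = J n +>\<^bsub>E n\<^esub> (generic_eval n q $$ (i, j))"
proof -
  interpret W: word_evaluation A \<eta> r x by (rule word_evaluation)
  interpret E: cring "E n" by (rule cring_entry_ring)
  let ?q = "SOME q. q \<in> free_algebra r \<and> nc_eval A \<eta> x q = a"
  have q': "?q \<in> free_algebra r \<and> nc_eval A \<eta> x ?q = a"
    by (rule someI[of _ q]) (use assms in blast)
  have "nc_eval A \<eta> x (?q - q) = \<zero>\<^bsub>A\<^esub>"
    using q' W.nc_eval_diff[of ?q q] W.nc_eval_closed[OF q] assms(1,2) by (simp add: r_neg minus_eq)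
  then have "?q - q \<in> relation_ideal A \<eta> r x"
    using q' q by (simp add: relation_ideal_def free_algebra_diff)
  then have "generic_eval n (?q - q) $$ (i, j) \<in> J n"
    using ij by (rule relation_entry_in_scheme_ideal)
  then have "generic_eval n ?q $$ (i, j) - generic_eval n q $$ (i, j) \<in> J n"
    using generic_eval_diff_entry[of ?q r q i n j] q' q ij by simp
  then show ?thesis
    unfolding action_matrix_def
    using E.quotient_eq_iff_same_a_r_cos[OF scheme_ideal_ideal, of "generic_eval n ?q $$ (i, j)" "generic_eval n q $$ (i, j)"]
      generic_eval_entry[of ?q r i n j] generic_eval_entry[of q r i n j] q' q ij
    by (simp add: entry_ring_simps entry_ring_minus)
qed

text \<open>
  Evaluation at the generators and evaluation at the generic matrices both turn products of
  polynomials into products, and the matrix of an element can be computed from any representative.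
\<close>

lemma matrix_representation_action:
  "matrix_representation (coord_ring A \<eta> r x n) A n (action_matrix A \<eta> r x n)"
proof -
  interpret W: word_evaluation A \<eta> r x by (rule word_evaluation)
  interpret E: cring "E n" by (rule cring_entry_ring)
  interpret J: ideal "J n" "E n" by (rule scheme_ideal_ideal)
  let ?C = "coord_ring A \<eta> r x n" and ?\<pi> = "(+>\<^bsub>E n\<^esub>) (J n)"
  have C: "cring ?C" unfolding coord_ring_def by (rule J.quotient_is_cring) (rule cring_entry_ring)
  interpret C: cring ?C by (rule C)
  interpret \<pi>: ring_hom_cring "E n" ?C ?\<pi>
    by (intro ring_hom_cring.intro ring_hom_cring_axioms.intro cring_entry_ring C)
      (simp add: coord_ring_def J.rcos_ring_hom)
  have rep: "\<exists>q\<in>free_algebra r. nc_eval A \<eta> x q = a" if "a \<in> carrier A" for a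
    using that gens_generate by (metis (no_types, lifting) imageE)
  show ?thesis
  proof
    fix a i j assume "a \<in> carrier A" and ij: "i < n" "j < n"
    then obtain q where q: "q \<in> free_algebra r" "nc_eval A \<eta> x q = a" using rep by blast
    show "action_matrix A \<eta> r x n a i j \<in> carrier ?C"
      unfolding action_matrix_eq[OF q ij] using generic_eval_entry[OF q(1) ij]
      by (intro \<pi>.hom_closed) (simp add: entry_ring_simps)
  next
    fix a b i j assume "a \<in> carrier A" "b \<in> carrier A" and ij: "i < n" "j < n"
    then obtain p q where p: "p \<in> free_algebra r" "nc_eval A \<eta> x p = a"
      and q: "q \<in> free_algebra r" "nc_eval A \<eta> x q = b" using rep by meson
    have pe: "generic_eval n p $$ (s, t) \<in> carrier (E n)" and qe: "generic_eval n q $$ (s, t) \<in> carrier (E n)"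
      if "s < n" "t < n" for s t
      using generic_eval_entry[OF p(1) that] generic_eval_entry[OF q(1) that] by (simp_all add: entry_ring_simps)
    note pc = generic_eval_closed[OF p(1), of n] and qc = generic_eval_closed[OF q(1), of n]
    have "action_matrix A \<eta> r x n (a \<oplus>\<^bsub>A\<^esub> b) i j = ?\<pi> (generic_eval n (p + q) $$ (i, j))"
      using p q ij by (intro action_matrix_eq) (simp_all add: free_algebra_add W.nc_eval_add)
    also have "generic_eval n (p + q) $$ (i, j) = generic_eval n p $$ (i, j) \<oplus>\<^bsub>E n\<^esub> generic_eval n q $$ (i, j)"
      using generic_eval_add[OF p(1) q(1)] pc qc ij by (simp add: entry_ring_simps)
    also have "?\<pi> \<dots> = ?\<pi> (generic_eval n p $$ (i, j)) \<oplus>\<^bsub>?C\<^esub> ?\<pi> (generic_eval n q $$ (i, j))"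
      by (rule \<pi>.hom_add[OF pe[OF ij] qe[OF ij]])
    finally show "action_matrix A \<eta> r x n (a \<oplus>\<^bsub>A\<^esub> b) i j =
        action_matrix A \<eta> r x n a i j \<oplus>\<^bsub>?C\<^esub> action_matrix A \<eta> r x n b i j"
      by (simp only: action_matrix_eq[OF p ij] action_matrix_eq[OF q ij])
    have "action_matrix A \<eta> r x n (a \<otimes>\<^bsub>A\<^esub> b) i j = ?\<pi> (generic_eval n (concat_mult p q) $$ (i, j))"
      using p q ij by (intro action_matrix_eq) (simp_all add: free_algebra_concat_mult W.nc_eval_concat_mult)
    also have "generic_eval n (concat_mult p q) $$ (i, j) =
        (\<Sum>t\<in>{..<n}. generic_eval n p $$ (i, t) * generic_eval n q $$ (t, j))"
      using generic_eval_mult[OF p(1) q(1), of n] pc qc ij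
      by (simp add: scalar_prod_def lessThan_atLeast0)
    also have "\<dots> = (\<Oplus>\<^bsub>E n\<^esub>t\<in>{..<n}. generic_eval n p $$ (i, t) \<otimes>\<^bsub>E n\<^esub> generic_eval n q $$ (t, j))"
      using pe qe ij by (subst entry_ring_finsum) (auto simp: entry_ring_simps entry_polys_mult)
    also have "?\<pi> \<dots> = (\<Oplus>\<^bsub>?C\<^esub>t\<in>{..<n}. (?\<pi> \<circ> (\<lambda>t. generic_eval n p $$ (i, t) \<otimes>\<^bsub>E n\<^esub> generic_eval n q $$ (t, j))) t)"
      using pe qe ij by (intro \<pi>.hom_finsum) auto
    also have "\<dots> = (\<Oplus>\<^bsub>?C\<^esub>t\<in>{..<n}. action_matrix A \<eta> r x n a i t \<otimes>\<^bsub>?C\<^esub> action_matrix A \<eta> r x n b t j)"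
      using pe qe ij by (intro C.finsum_cong') (auto simp: action_matrix_eq[OF p] action_matrix_eq[OF q])
    finally show "action_matrix A \<eta> r x n (a \<otimes>\<^bsub>A\<^esub> b) i j =
        (\<Oplus>\<^bsub>?C\<^esub>t\<in>{..<n}. action_matrix A \<eta> r x n a i t \<otimes>\<^bsub>?C\<^esub> action_matrix A \<eta> r x n b t j)" .
  next
    fix i j assume ij: "i < n" "j < n"
    have "action_matrix A \<eta> r x n \<one>\<^bsub>A\<^esub> i j = ?\<pi> (generic_eval n (Poly_Mapping.single [] 1) $$ (i, j))"
      using ij by (intro action_matrix_eq) (simp_all add: free_algebra_single W.nc_eval_one)
    also have "\<dots> = ?\<pi> (if i = j then \<one>\<^bsub>E n\<^esub> else \<zero>\<^bsub>E n\<^esub>)"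
      using ij by (simp add: generic_eval_one[of n] entry_ring_simps)
    finally show "action_matrix A \<eta> r x n \<one>\<^bsub>A\<^esub> i j = (if i = j then \<one>\<^bsub>?C\<^esub> else \<zero>\<^bsub>?C\<^esub>)"
      by simp
  qed
qed

end

lemma cring_coord_ring: "fin_gen_algebra A \<eta> r x \<Longrightarrow> cring (coord_ring A \<eta> r x n)"
  using fin_gen_algebra.matrix_representation_action[THEN matrix_representation.axioms(1)] .

text \<open>
  A fraction over a quotient of the polynomial ring \<open>k[t]\<close> is coded by two polynomials, and a
  polynomial by finitely many monomials and scalars; so \<open>\<kappa>(p)\<close> has at most \<open>max(|k|, \<aleph>\<^sub>0)\<close> elements.
\<close>

lemma residue_vectors_embed:
  fixes \<iota> :: "'k::field \<Rightarrow> 'm" and A :: "('a, 's) ring_scheme" and \<eta> :: "'k \<Rightarrow> 'a"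
  assumes "infinite (UNIV :: 'm set)" "inj \<iota>"
  shows "\<exists>g :: _ \<Rightarrow> 'm. inj_on g ({..<n::nat} \<rightarrow>\<^sub>E carrier (Frac (coord_ring A \<eta> r x n Quot p)))"
proof -
  let ?C = "coord_ring A \<eta> r x n"
  have "lepoll (carrier (?C Quot p)) (carrier ?C)" by (rule carrier_FactRing_lepoll)
  also have "lepoll (carrier ?C) (carrier (entry_ring r n :: 'k entry_poly ring))"
    unfolding coord_ring_def by (rule carrier_FactRing_lepoll)
  also have "lepoll \<dots> (UNIV :: 'k entry_poly set)" by (rule subset_imp_lepoll) simp
  also have "lepoll \<dots> (UNIV :: 'm set)" by (rule entry_poly_lepoll[OF assms])
  finally have D: "lepoll (carrier (?C Quot p)) (UNIV :: 'm set)" .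
  have "lepoll (carrier (Frac (?C Quot p))) (carrier (?C Quot p) \<times> carrier (?C Quot p))"
    by (rule carrier_Frac_lepoll)
  also have "lepoll \<dots> (UNIV :: 'm set)"
    by (rule times_lepoll_infinite[OF assms(1) D D])
  finally have "lepoll ({..<n} \<rightarrow>\<^sub>E carrier (Frac (?C Quot p))) (UNIV :: 'm set)"
    by (rule PiE_lepoll_infinite[OF assms(1)])
  then show ?thesis unfolding lepoll_def by blast
qed

text \<open>
  Every functor \<open>F\<close> contributes the constructible set of those \<open>p\<close> at which the solvability condition
  of \<open>F\<close> holds for \<open>\<kappa>(p)\<^sup>n\<close>.  The condition is invariant under isomorphism, so it can
  be tested on \<open>M \<otimes> \<kappa>(p)\<close> or on any copy of it in the universe.
\<close>

theorem Mod_subset_vanishing: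
  fixes A :: "'a ring" and \<eta> :: "'k::field \<Rightarrow> 'a" and \<iota> :: "'k \<Rightarrow> 'm"
    and S :: "('a, 'm, 'g) ab_functor set"
  assumes alg: "fin_gen_algebra A \<eta> r x"
    and inf: "infinite (UNIV :: 'm set)" "inj \<iota>"
    and S: "\<forall>F\<in>S. fin_pres_functor A F"
  shows "\<exists>U. (\<forall>F\<in>S. U F \<in> constructible_sets (coord_ring A \<eta> r x n)) \<and>
    Mod_subset A \<eta> r x {V. left_module A V \<and> (\<forall>F\<in>S. trivial_group (on_obj F V))} n =
      {p \<in> Spec (coord_ring A \<eta> r x n). \<forall>F\<in>S. p \<in> U F}"
proof -
  let ?C = "coord_ring A \<eta> r x n" and ?\<mu> = "action_matrix A \<eta> r x n"
  let ?X = "{V :: ('a, 'm) module. left_module A V \<and> (\<forall>F\<in>S. trivial_group (on_obj F V))}"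
  interpret A: fin_gen_algebra A \<eta> r x by fact
  interpret R: matrix_representation ?C A n ?\<mu> by (rule A.matrix_representation_action)
  let ?P = "\<lambda>p. matrix_module n ?\<mu> (residue_module ?C p)"
  let ?T = "\<lambda>p. tensor_product ?C (universal_bimodule A \<eta> r x n) (residue_module ?C p)"
  have "\<exists>U. U \<in> constructible_sets ?C \<and> (\<forall>p\<in>Spec ?C. \<forall>V :: ('a, 'm) module. left_module A V \<longrightarrow> lin_iso A (?P p) V \<longrightarrow>
      (trivial_group (on_obj F V) \<longleftrightarrow> p \<in> U))" if F: "F \<in> S" for F
  proof -
    from S F have "fin_pres_functor A F" by blast
    from fin_pres_functor_vanishing[OF A.ring_axioms this] obtain l m q l' m' q' a where
      q: "\<forall>i<m. q i \<in> {..<l} \<rightarrow> carrier A" and q': "\<forall>i<m'. q' i \<in> {..<l'} \<rightarrow> carrier A"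
      and a: "\<forall>i<l. a i \<in> {..<l'} \<rightarrow> carrier A"
      and van: "\<forall>Z. left_module A Z \<longrightarrow> (trivial_group (on_obj F Z) \<longleftrightarrow> solvability_condition l m q l' m' q' a Z)"
      by blast
    let ?U = "{p \<in> Spec ?C. solvability_condition l m q l' m' q' a (?P p)}"
    have "trivial_group (on_obj F V) \<longleftrightarrow> p \<in> ?U"
      if p: "p \<in> Spec ?C" and V: "left_module A V" and iso: "lin_iso A (?P p) V" for p and V :: "('a, 'm) module"
    proof -
      have P: "left_module A (?P p)"
        using p by (intro R.left_module_matrix_module module_residue_module R.C.cring_axioms) (simp add: Spec_def)
      have "solvability_condition l m q l' m' q' a V \<longleftrightarrow> solvability_condition l m q l' m' q' a (?P p)"
        using solvability_condition_iso[OF P V iso q q' a]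
          solvability_condition_iso[OF V P lin_iso_sym[OF P iso] q q' a] by blast
      with van V p show ?thesis by simp
    qed
    then show ?thesis
      using R.constructible_solvability_condition[OF q q' a] by blast
  qed
  then have "\<forall>F\<in>S. \<exists>U. U \<in> constructible_sets ?C \<and> (\<forall>p\<in>Spec ?C. \<forall>V :: ('a, 'm) module. left_module A V \<longrightarrow> lin_iso A (?P p) V \<longrightarrow>
      (trivial_group (on_obj F V) \<longleftrightarrow> p \<in> U))" by blast
  from bchoice[OF this] obtain U where U: "\<forall>F\<in>S. U F \<in> constructible_sets ?C \<and> (\<forall>p\<in>Spec ?C. \<forall>V :: ('a, 'm) module. left_module A V \<longrightarrow>
      lin_iso A (?P p) V \<longrightarrow> (trivial_group (on_obj F V) \<longleftrightarrow> p \<in> U F))" ..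
  have "p \<in> Mod_subset A \<eta> r x ?X n \<longleftrightarrow> (\<forall>F\<in>S. p \<in> U F)" if p: "p \<in> Spec ?C" for p
  proof -
    have N: "module ?C (residue_module ?C p)"
      using p by (intro module_residue_module R.C.cring_axioms) (simp add: Spec_def)
    have P: "left_module A (?P p)" by (rule R.left_module_matrix_module[OF N])
    have PT: "lin_iso A (?P p) (?T p)"
      unfolding universal_bimodule_eq by (rule matrix_action.tensor_product_iso[OF R.matrix_action[OF N]])
    show ?thesis
    proof
      assume "p \<in> Mod_subset A \<eta> r x ?X n"
      then obtain V where V: "V \<in> ?X" "lin_iso A (?T p) V"
        unfolding Mod_subset_def Let_def by blast
      have "lin_iso A (?P p) V" by (rule lin_iso_trans[OF P PT V(2)])
      with U V(1) p show "\<forall>F\<in>S. p \<in> U F" by blast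
    next
      assume pU: "\<forall>F\<in>S. p \<in> U F"
      obtain g :: "_ \<Rightarrow> 'm" where "inj_on g ({..<n} \<rightarrow>\<^sub>E carrier (Frac (?C Quot p)))"
        using residue_vectors_embed[OF inf] by blast
      then have "inj_on g (carrier (?P p))"
        by (simp add: matrix_module_def residue_module_simps)
      from left_module_transport[OF P this] obtain V :: "('a, 'm) module"
        where V: "left_module A V" "lin_iso A (?P p) V" by blast
      then have "V \<in> ?X" using U pU p by blast
      moreover have "lin_iso A (?T p) V"
      proof -
        have "lin_iso A V (?T p)" by (rule lin_iso_trans[OF V(1) lin_iso_sym[OF P V(2)] PT])
        with V(1) show ?thesis by (rule lin_iso_sym)
      qed
      ultimately show "p \<in> Mod_subset A \<eta> r x ?X n"
        using p unfolding Mod_subset_def Let_def by blast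
    qed
  qed
  moreover have "Mod_subset A \<eta> r x ?X n \<subseteq> Spec ?C"
    unfolding Mod_subset_def Let_def by blast
  ultimately have "Mod_subset A \<eta> r x ?X n = {p \<in> Spec ?C. \<forall>F\<in>S. p \<in> U F}" by blast
  with U show ?thesis by blast
qed

text \<open>
  An intersection of clopen sets is closed; a single functor gives a single constructible set.
\<close>

theorem lemma3p3:
  fixes A :: "'a ring"
    and \<eta> :: "'k::field \<Rightarrow> 'a"
    and r n :: nat
    and x :: "nat \<Rightarrow> 'a"
    and \<X> :: "('a, 'm) module set"
    and \<iota> :: "'k \<Rightarrow> 'm"
  assumes "fin_gen_algebra A \<eta> r x"
    and "infinite (UNIV :: 'm set)" and "inj \<iota>"
    and "full_additive_subcategory A \<X>"
  shows "(definable_subcategory TYPE('g) A \<X> \<longrightarrow>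
            closedin (constructible_topology (coord_ring A \<eta> r x n)) (Mod_subset A \<eta> r x \<X> n))
       \<and> (constructible_subcategory TYPE('g) A \<X> \<longrightarrow>
            Mod_subset A \<eta> r x \<X> n \<in> constructible_sets (coord_ring A \<eta> r x n))"
proof (intro conjI impI)
  let ?C = "coord_ring A \<eta> r x n"
  interpret C: cring ?C by (rule cring_coord_ring[OF assms(1)])
  {
    assume "definable_subcategory TYPE('g) A \<X>"
    then obtain S :: "('a, 'm, 'g) ab_functor set" where S: "\<forall>F\<in>S. fin_pres_functor A F"
      and \<X>: "\<X> = {V. left_module A V \<and> (\<forall>F\<in>S. trivial_group (on_obj F V))}"
      unfolding definable_subcategory_def by blast
    from Mod_subset_vanishing[OF assms(1-3) S] obtain U where
      U: "\<forall>F\<in>S. U F \<in> constructible_sets ?C" and eq: "Mod_subset A \<eta> r x \<X> n = {p \<in> Spec ?C. \<forall>F\<in>S. p \<in> U F}"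
      unfolding \<X> by blast
    have "{p \<in> Spec ?C. \<forall>F\<in>S. p \<in> U F} = \<Inter> (insert (Spec ?C) (U ` S))" by blast
    moreover have "closedin (constructible_topology ?C) \<dots>"
      using U C.constructible_Spec by (intro closedin_Inter) (auto intro: constructible_closedin)
    ultimately show "closedin (constructible_topology ?C) (Mod_subset A \<eta> r x \<X> n)"
      by (simp only: eq)
  }
  {
    assume "constructible_subcategory TYPE('g) A \<X>"
    then obtain F :: "('a, 'm, 'g) ab_functor" where F: "fin_pres_functor A F"
      and \<X>: "\<X> = {V. left_module A V \<and> (\<forall>F\<in>{F}. trivial_group (on_obj F V))}"
      unfolding constructible_subcategory_def by auto
    have "\<forall>F\<in>{F}. fin_pres_functor A F" using F by simp
    from Mod_subset_vanishing[OF assms(1-3) this] obtain U where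
      U: "\<forall>F\<in>{F}. U F \<in> constructible_sets ?C" and eq: "Mod_subset A \<eta> r x \<X> n = {p \<in> Spec ?C. \<forall>F\<in>{F}. p \<in> U F}"
      unfolding \<X> by blast
    have "{p \<in> Spec ?C. \<forall>F\<in>{F}. p \<in> U F} = Spec ?C \<inter> U F" by blast
    with U C.constructible_Spec show "Mod_subset A \<eta> r x \<X> n \<in> constructible_sets ?C"
      unfolding eq by (simp add: constructible_sets.inter)
  }
qed

end
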